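(* Over a field $\mathbb{K}$ of characteristic zero, the Koszul dual operad of the operad $\mathbf{sDiAss}$ of symmetric dialgebras is the operad $\mathbf{AssAdm}$ of associative admissible algebras: $\mathbf{sDiAss}^! = \mathbf{AssAdm}$ (up to isomorphism of operads).
   Context: All multiplications are bilinear and identities are required for all elements. A symmetric dialgebra is a $\mathbb{K}$-vector space with two associative multiplications $\vdash,\dashv$ such that $(a \circ_1 b) \circ_2 c = a \circ_3 (b \circ_4 c)$ for all choices of $\circ_1,\circ_2,\circ_3,\circ_4 \in \{\vdash,\dashv\}$. An associative admissible algebra is a $\mathbb{K}$-vector space with two operations $\succ,\prec$ such that $a * b = a \succ b + a \prec b$ is an associative multiplication. $\mathbf{sDiAss}$ and $\mathbf{AssAdm}$ are the binary quadratic symmetric operads whose algebras are these. For a binary quadratic operad $\mathcal{P} = \mathbb{F}(V)/(R)$ with $V$ finite dimensional in arity 2 and $R \subset \mathbb{F}(V)(3)$, the Koszul dual operad is $\mathcal{P}^! = \mathbb{F}(V^\vee)/(R^\perp)$, where $\mathbb{F}$ denotes the free operad, $V^\vee = V^* \otimes \mathrm{sgn}$, and $R^\perp$ is the orthogonal complement of $R$ with respect to the standard pairing between $\mathbb{F}(V^\vee)(3)$ and $\mathbb{F}(V)(3)$. *)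

theory Defs
  imports "HOL-Algebra.Module" "HOL-Algebra.AbelCoset" "HOL-Combinatorics.Permutations"
begin

section \<open>Vector spaces\<close>

text \<open>The field is a type of class \<^class>\<open>field\<close>; \<open>module scalars M\<close> then says that \<open>M\<close> is a
  vector space over it. The multiplicative fields of a module record are not used.\<close>

definition scalars :: "'k::field ring" where
  "scalars = \<lparr>carrier = UNIV, monoid.mult = (*), one = 1, zero = 0, add = (+)\<rparr>"

definition basis :: "'x \<Rightarrow> 'x \<Rightarrow> 'k::field" where
  "basis x = (\<lambda>y. if y = x then 1 else 0)"

definition free_space :: "'x set \<Rightarrow> ('k::field, 'x \<Rightarrow> 'k) module" where
  "free_space S =
    \<lparr>carrier = {f. finite {x. f x \<noteq> 0} \<and> {x. f x \<noteq> 0} \<subseteq> S},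
     monoid.mult = undefined, one = undefined,
     zero = (\<lambda>x. 0), add = (\<lambda>f g x. f x + g x), smult = (\<lambda>c f x. c * f x)\<rparr>"

definition quot_space :: "('k, 'a) module \<Rightarrow> 'a set \<Rightarrow> ('k, 'a set) module" where
  "quot_space M N =
    \<lparr>carrier = a_rcosets\<^bsub>M\<^esub> N,
     monoid.mult = undefined, one = undefined,
     zero = N, add = (\<lambda>A B. A <+>\<^bsub>M\<^esub> B),
     smult = (\<lambda>c A. \<Union>x\<in>A. N +>\<^bsub>M\<^esub> (c \<odot>\<^bsub>M\<^esub> x))\<rparr>"


section \<open>Symmetric operads\<close>

text \<open>Operads are given by partial compositions. Inputs are numbered from \<open>0\<close>, and
  \<open>pcomp P m n i \<mu> \<nu>\<close> is \<open>\<mu> \<circ>\<^sub>i \<nu>\<close> for \<open>\<mu> \<in> P(m)\<close>, \<open>\<nu> \<in> P(n)\<close>, \<open>i < m\<close>. The symmetric groups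
  act from the right: \<open>act P n \<sigma> \<mu>\<close> is \<open>\<mu>\<^sup>\<sigma>\<close>, with
  \<open>\<mu>\<^sup>\<sigma>(x\<^sub>0,\<dots>) = \<mu>(x\<^bsub>inv \<sigma> 0\<^esub>,\<dots>)\<close>.\<close>

record ('k, 'a) operad =
  space :: "nat \<Rightarrow> ('k, 'a) module"
  unit :: 'a
  pcomp :: "nat \<Rightarrow> nat \<Rightarrow> nat \<Rightarrow> 'a \<Rightarrow> 'a \<Rightarrow> 'a"
  act :: "nat \<Rightarrow> (nat \<Rightarrow> nat) \<Rightarrow> 'a \<Rightarrow> 'a"

abbreviation ops :: "('k, 'a) operad \<Rightarrow> nat \<Rightarrow> 'a set" where
  "ops P n \<equiv> carrier (space P n)"

text \<open>The permutation \<open>\<sigma> \<circ>\<^sub>i \<tau>\<close> of \<open>m + n - 1\<close> letters: the block \<open>i, \<dots>, i + n - 1\<close> is permuted by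
  \<open>\<tau>\<close> and moved as the single letter \<open>i\<close> by \<open>\<sigma>\<close>.\<close>

definition perm_comp ::
  "nat \<Rightarrow> nat \<Rightarrow> nat \<Rightarrow> (nat \<Rightarrow> nat) \<Rightarrow> (nat \<Rightarrow> nat) \<Rightarrow> nat \<Rightarrow> nat" where
  "perm_comp m n i \<sigma> \<tau> = (\<lambda>l.
     let shift = (\<lambda>j. if j < \<sigma> i then j else j + n - 1) in
     if l < i then shift (\<sigma> l)
     else if l < i + n then \<sigma> i + \<tau> (l - i)
     else if l < m + n - 1 then shift (\<sigma> (l + 1 - n))
     else l)"

locale symmetric_operad =
  fixes P :: "('k::field, 'a) operad"
  assumes vector_space: "module scalars (space P n)"
    and unit_closed: "unit P \<in> ops P 1"
    and pcomp_closed: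
      "\<lbrakk>i < m; \<mu> \<in> ops P m; \<nu> \<in> ops P n\<rbrakk> \<Longrightarrow> pcomp P m n i \<mu> \<nu> \<in> ops P (m + n - 1)"
    and pcomp_add_left:
      "\<lbrakk>i < m; \<mu> \<in> ops P m; \<mu>' \<in> ops P m; \<nu> \<in> ops P n\<rbrakk> \<Longrightarrow>
       pcomp P m n i (\<mu> \<oplus>\<^bsub>space P m\<^esub> \<mu>') \<nu> =
       pcomp P m n i \<mu> \<nu> \<oplus>\<^bsub>space P (m + n - 1)\<^esub> pcomp P m n i \<mu>' \<nu>"
    and pcomp_add_right:
      "\<lbrakk>i < m; \<mu> \<in> ops P m; \<nu> \<in> ops P n; \<nu>' \<in> ops P n\<rbrakk> \<Longrightarrow>
       pcomp P m n i \<mu> (\<nu> \<oplus>\<^bsub>space P n\<^esub> \<nu>') =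
       pcomp P m n i \<mu> \<nu> \<oplus>\<^bsub>space P (m + n - 1)\<^esub> pcomp P m n i \<mu> \<nu>'"
    and pcomp_smult_left:
      "\<lbrakk>i < m; \<mu> \<in> ops P m; \<nu> \<in> ops P n\<rbrakk> \<Longrightarrow>
       pcomp P m n i (c \<odot>\<^bsub>space P m\<^esub> \<mu>) \<nu> = c \<odot>\<^bsub>space P (m + n - 1)\<^esub> pcomp P m n i \<mu> \<nu>"
    and pcomp_smult_right:
      "\<lbrakk>i < m; \<mu> \<in> ops P m; \<nu> \<in> ops P n\<rbrakk> \<Longrightarrow>
       pcomp P m n i \<mu> (c \<odot>\<^bsub>space P n\<^esub> \<nu>) = c \<odot>\<^bsub>space P (m + n - 1)\<^esub> pcomp P m n i \<mu> \<nu>"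
    and act_closed: "\<lbrakk>\<sigma> permutes {..<n}; \<mu> \<in> ops P n\<rbrakk> \<Longrightarrow> act P n \<sigma> \<mu> \<in> ops P n"
    and act_add:
      "\<lbrakk>\<sigma> permutes {..<n}; \<mu> \<in> ops P n; \<nu> \<in> ops P n\<rbrakk> \<Longrightarrow>
       act P n \<sigma> (\<mu> \<oplus>\<^bsub>space P n\<^esub> \<nu>) = act P n \<sigma> \<mu> \<oplus>\<^bsub>space P n\<^esub> act P n \<sigma> \<nu>"
    and act_smult:
      "\<lbrakk>\<sigma> permutes {..<n}; \<mu> \<in> ops P n\<rbrakk> \<Longrightarrow>
       act P n \<sigma> (c \<odot>\<^bsub>space P n\<^esub> \<mu>) = c \<odot>\<^bsub>space P n\<^esub> act P n \<sigma> \<mu>"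
    and act_id: "\<mu> \<in> ops P n \<Longrightarrow> act P n id \<mu> = \<mu>"
    and act_comp:
      "\<lbrakk>\<sigma> permutes {..<n}; \<tau> permutes {..<n}; \<mu> \<in> ops P n\<rbrakk> \<Longrightarrow>
       act P n (\<sigma> \<circ> \<tau>) \<mu> = act P n \<tau> (act P n \<sigma> \<mu>)"
    and unit_left: "\<nu> \<in> ops P n \<Longrightarrow> pcomp P 1 n 0 (unit P) \<nu> = \<nu>"
    and unit_right: "\<lbrakk>i < m; \<mu> \<in> ops P m\<rbrakk> \<Longrightarrow> pcomp P m 1 i \<mu> (unit P) = \<mu>"
    and sequential:
      "\<lbrakk>i < l; j < m; \<kappa> \<in> ops P l; \<mu> \<in> ops P m; \<nu> \<in> ops P n\<rbrakk> \<Longrightarrow>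
       pcomp P (l + m - 1) n (i + j) (pcomp P l m i \<kappa> \<mu>) \<nu> =
       pcomp P l (m + n - 1) i \<kappa> (pcomp P m n j \<mu> \<nu>)"
    and parallel:
      "\<lbrakk>i < k; k < l; \<kappa> \<in> ops P l; \<mu> \<in> ops P m; \<nu> \<in> ops P n\<rbrakk> \<Longrightarrow>
       pcomp P (l + m - 1) n (k + m - 1) (pcomp P l m i \<kappa> \<mu>) \<nu> =
       pcomp P (l + n - 1) m i (pcomp P l n k \<kappa> \<nu>) \<mu>"
    and equivariance:
      "\<lbrakk>i < m; \<sigma> permutes {..<m}; \<tau> permutes {..<n}; \<mu> \<in> ops P m; \<nu> \<in> ops P n\<rbrakk> \<Longrightarrow>
       pcomp P m n i (act P m \<sigma> \<mu>) (act P n \<tau> \<nu>) =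
       act P (m + n - 1) (perm_comp m n i \<sigma> \<tau>) (pcomp P m n (\<sigma> i) \<mu> \<nu>)"

locale operad_hom = P: symmetric_operad P + Q: symmetric_operad Q
  for P :: "('k::field, 'a) operad" and Q :: "('k, 'b) operad" +
  fixes f :: "nat \<Rightarrow> 'a \<Rightarrow> 'b"
  assumes hom_closed: "\<mu> \<in> ops P n \<Longrightarrow> f n \<mu> \<in> ops Q n"
    and hom_add:
      "\<lbrakk>\<mu> \<in> ops P n; \<nu> \<in> ops P n\<rbrakk> \<Longrightarrow> f n (\<mu> \<oplus>\<^bsub>space P n\<^esub> \<nu>) = f n \<mu> \<oplus>\<^bsub>space Q n\<^esub> f n \<nu>"
    and hom_smult:
      "\<mu> \<in> ops P n \<Longrightarrow> f n (c \<odot>\<^bsub>space P n\<^esub> \<mu>) = c \<odot>\<^bsub>space Q n\<^esub> f n \<mu>"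
    and hom_unit: "f 1 (unit P) = unit Q"
    and hom_pcomp:
      "\<lbrakk>i < m; \<mu> \<in> ops P m; \<nu> \<in> ops P n\<rbrakk> \<Longrightarrow>
       f (m + n - 1) (pcomp P m n i \<mu> \<nu>) = pcomp Q m n i (f m \<mu>) (f n \<nu>)"
    and hom_act:
      "\<lbrakk>\<sigma> permutes {..<n}; \<mu> \<in> ops P n\<rbrakk> \<Longrightarrow> f n (act P n \<sigma> \<mu>) = act Q n \<sigma> (f n \<mu>)"

text \<open>Being symmetric operads is part of the morphism locale, hence of this relation.\<close>

definition operad_isomorphic :: "('k::field, 'a) operad \<Rightarrow> ('k, 'b) operad \<Rightarrow> bool"
    (infix \<open>\<cong>\<^sub>o\<^sub>p\<close> 50) where
  "P \<cong>\<^sub>o\<^sub>p Q \<longleftrightarrow> (\<exists>f. operad_hom P Q f \<and> (\<forall>n. bij_betw (f n) (ops P n) (ops Q n)))"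


section \<open>Ideals and quotients\<close>

definition sym_submodule :: "('k::field, 'a) operad \<Rightarrow> nat \<Rightarrow> 'a set \<Rightarrow> bool" where
  "sym_submodule P n N \<longleftrightarrow>
     submodule N scalars (space P n) \<and> (\<forall>\<sigma> \<mu>. \<sigma> permutes {..<n} \<and> \<mu> \<in> N \<longrightarrow> act P n \<sigma> \<mu> \<in> N)"

definition sym_span :: "('k::field, 'a) operad \<Rightarrow> nat \<Rightarrow> 'a set \<Rightarrow> 'a set" where
  "sym_span P n X = \<Inter>{N. sym_submodule P n N \<and> X \<subseteq> N}"

definition operad_ideal :: "('k::field, 'a) operad \<Rightarrow> (nat \<Rightarrow> 'a set) \<Rightarrow> bool" where
  "operad_ideal P I \<longleftrightarrow>
     (\<forall>n. sym_submodule P n (I n)) \<and>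
     (\<forall>m n i \<mu> \<nu>. i < m \<and> \<mu> \<in> ops P m \<and> \<nu> \<in> ops P n \<and> (\<mu> \<in> I m \<or> \<nu> \<in> I n) \<longrightarrow>
        pcomp P m n i \<mu> \<nu> \<in> I (m + n - 1))"

text \<open>The ideal generated by a set \<open>X\<close> of operations of arity \<open>k\<close>.\<close>

definition ideal_gen :: "('k::field, 'a) operad \<Rightarrow> nat \<Rightarrow> 'a set \<Rightarrow> nat \<Rightarrow> 'a set" where
  "ideal_gen P k X = (\<lambda>n. \<Inter>{I n | I. operad_ideal P I \<and> X \<subseteq> I k})"

definition quot_operad :: "('k, 'a) operad \<Rightarrow> (nat \<Rightarrow> 'a set) \<Rightarrow> ('k, 'a set) operad" where
  "quot_operad P I =
    \<lparr>space = (\<lambda>n. quot_space (space P n) (I n)),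
     unit = I 1 +>\<^bsub>space P 1\<^esub> unit P,
     pcomp = (\<lambda>m n i A B. \<Union>\<mu>\<in>A. \<Union>\<nu>\<in>B.
                I (m + n - 1) +>\<^bsub>space P (m + n - 1)\<^esub> pcomp P m n i \<mu> \<nu>),
     act = (\<lambda>n \<sigma> A. \<Union>\<mu>\<in>A. I n +>\<^bsub>space P n\<^esub> act P n \<sigma> \<mu>)\<rparr>"


section \<open>The free operad on binary generators\<close>

datatype (vertices: 'v, 'l) btree = Leaf 'l | Node 'v "('v, 'l) btree" "('v, 'l) btree"

primrec leaves :: "('v, 'l) btree \<Rightarrow> 'l list" where
  "leaves (Leaf l) = [l]"
| "leaves (Node v s t) = leaves s @ leaves t"

abbreviation relabel :: "('l \<Rightarrow> 'm) \<Rightarrow> ('v, 'l) btree \<Rightarrow> ('v, 'm) btree" where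
  "relabel \<equiv> map_btree id"

definition trees :: "'v set \<Rightarrow> nat \<Rightarrow> ('v, nat) btree set" where
  "trees S n = {t. vertices t \<subseteq> S \<and> distinct (leaves t) \<and> set (leaves t) = {..<n}}"

text \<open>\<open>graft n i s t\<close> substitutes the tree \<open>t\<close> with \<open>n\<close> leaves for the leaf \<open>i\<close> of \<open>s\<close>.\<close>

primrec graft :: "nat \<Rightarrow> nat \<Rightarrow> ('v, nat) btree \<Rightarrow> ('v, nat) btree \<Rightarrow> ('v, nat) btree" where
  "graft n i (Leaf j) t =
     (if j < i then Leaf j else if j = i then relabel (\<lambda>l. i + l) t else Leaf (j + n - 1))"
| "graft n i (Node v r s) t = Node v (graft n i r t) (graft n i s t)"

text \<open>The free operad on a mere set \<open>S\<close> of binary operations without symmetries. A leaf labelled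
  \<open>j\<close> stands for the argument \<open>x\<^sub>j\<close>, so \<open>\<sigma>\<close> sends the tree \<open>t\<close> to \<open>relabel (inv \<sigma>) t\<close>; on
  coefficient functions this is precomposition with \<open>relabel \<sigma>\<close>.\<close>

definition tree_operad :: "'v set \<Rightarrow> ('k::field, ('v, nat) btree \<Rightarrow> 'k) operad" where
  "tree_operad S =
    \<lparr>space = (\<lambda>n. free_space (trees S n)),
     unit = basis (Leaf 0),
     pcomp = (\<lambda>m n i f g t. \<Sum>p | f p \<noteq> 0. \<Sum>q | g q \<noteq> 0. f p * g q * basis (graft n i p q) t),
     act = (\<lambda>n \<sigma> f t. f (relabel \<sigma> t))\<rparr>"

text \<open>A vector space with an action of the symmetric group on two letters, given by the action
  of the transposition.\<close>

record ('k, 'v) s2_module = "('k, 'v) module" +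
  flip :: "'v \<Rightarrow> 'v"

definition corolla :: "'v \<Rightarrow> ('v, nat) btree \<Rightarrow> 'k::field" where
  "corolla v = basis (Node v (Leaf 0) (Leaf 1))"

text \<open>The free operad \<open>F(V)\<close> on \<open>V\<close> placed in arity 2 is the free operad on the underlying set
  of \<open>V\<close> modulo the ideal making \<open>v \<mapsto> corolla v\<close> linear and equivariant.\<close>

definition free_relations :: "('k::field, 'v) s2_module \<Rightarrow> (('v, nat) btree \<Rightarrow> 'k) set" where
  "free_relations V =
     {\<lambda>t. corolla (v \<oplus>\<^bsub>V\<^esub> w) t - corolla v t - corolla w t | v w. v \<in> carrier V \<and> w \<in> carrier V} \<union>
     {\<lambda>t. corolla (c \<odot>\<^bsub>V\<^esub> v) t - c * corolla v t | c v. v \<in> carrier V} \<union>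
     {\<lambda>t. corolla (flip V v) t - basis (Node v (Leaf 1) (Leaf 0)) t | v. v \<in> carrier V}"

definition free_ideal ::
  "('k::field, 'v) s2_module \<Rightarrow> nat \<Rightarrow> (('v, nat) btree \<Rightarrow> 'k) set" where
  "free_ideal V = ideal_gen (tree_operad (carrier V)) 2 (free_relations V)"

definition free_operad ::
  "('k::field, 'v) s2_module \<Rightarrow> ('k, (('v, nat) btree \<Rightarrow> 'k) set) operad" where
  "free_operad V = quot_operad (tree_operad (carrier V)) (free_ideal V)"

definition gen :: "('k::field, 'v) s2_module \<Rightarrow> 'v \<Rightarrow> (('v, nat) btree \<Rightarrow> 'k) set" where
  "gen V v = free_ideal V 2 +>\<^bsub>space (tree_operad (carrier V)) 2\<^esub> corolla v"


section \<open>Binary quadratic operads and Koszul duality\<close>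

text \<open>Quadratic data: an \<open>S\<^sub>2\<close>-module \<open>V\<close> and an \<open>S\<^sub>3\<close>-submodule \<open>R\<close> of \<open>F(V)(3)\<close>. The Koszul
  dual operad is a construction on such a presentation \<open>F(V)/(R)\<close>.\<close>

record ('k, 'v) quadratic_data =
  gens :: "('k, 'v) s2_module"
  rels :: "(('v, nat) btree \<Rightarrow> 'k) set set"

definition quadratic_operad ::
  "('k::field, 'v) quadratic_data \<Rightarrow> ('k, (('v, nat) btree \<Rightarrow> 'k) set set) operad" where
  "quadratic_operad D =
     quot_operad (free_operad (gens D)) (ideal_gen (free_operad (gens D)) 3 (rels D))"

text \<open>\<open>V\<^sup>\<or> = V\<^sup>* \<otimes> sgn\<close>; functionals are extended by \<open>0\<close> outside the carrier.\<close>

definition sgn_dual :: "('k::field, 'v) s2_module \<Rightarrow> ('k, 'v \<Rightarrow> 'k) s2_module" where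
  "sgn_dual V =
    \<lparr>carrier = {f. (\<forall>v\<in>carrier V. \<forall>w\<in>carrier V. f (v \<oplus>\<^bsub>V\<^esub> w) = f v + f w) \<and>
                   (\<forall>c. \<forall>v\<in>carrier V. f (c \<odot>\<^bsub>V\<^esub> v) = c * f v) \<and>
                   (\<forall>v. v \<notin> carrier V \<longrightarrow> f v = 0)},
     monoid.mult = undefined, one = undefined,
     zero = (\<lambda>v. 0), add = (\<lambda>f g v. f v + g v), smult = (\<lambda>c f v. c * f v),
     flip = (\<lambda>f v. if v \<in> carrier V then - f (flip V v) else 0)\<rparr>"

text \<open>\<open>F(V)(3)\<close> is the direct sum of three copies of \<open>V \<otimes> V\<close>, the tensor \<open>v \<otimes> w\<close> in the copy
  \<open>k \<in> {0, 1, 2}\<close> being the left comb \<open>v(w(x\<^sub>i, x\<^sub>j), x\<^sub>k)\<close> with \<open>(i, j, k)\<close> a cyclic permutation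
  of \<open>(0, 1, 2)\<close>. The function \<open>left_comb\<close> brings a tree to this form using \<open>v(y, x) = (flip v)(x, y)\<close>.
  The standard pairing is evaluation on each copy, distinct copies being orthogonal.\<close>

fun left_comb :: "('v \<Rightarrow> 'v) \<Rightarrow> ('v, nat) btree \<Rightarrow> 'v \<times> 'v \<times> nat" where
  "left_comb \<phi> (Node v (Node w (Leaf i) (Leaf j)) (Leaf k)) =
     (v, if j = (i + 1) mod 3 then w else \<phi> w, k)"
| "left_comb \<phi> (Node v (Leaf k) (Node w (Leaf i) (Leaf j))) =
     (\<phi> v, if j = (i + 1) mod 3 then w else \<phi> w, k)"

definition tree_pairing ::
  "('k::field, 'v) s2_module \<Rightarrow> ('v \<Rightarrow> 'k, nat) btree \<Rightarrow> ('v, nat) btree \<Rightarrow> 'k" where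
  "tree_pairing V s t =
     (case (left_comb (flip (sgn_dual V)) s, left_comb (flip V) t) of
        ((f, g, k), (v, w, l)) \<Rightarrow> if k = l then f v * g w else 0)"

definition formal_pairing ::
  "('k::field, 'v) s2_module \<Rightarrow>
   (('v \<Rightarrow> 'k, nat) btree \<Rightarrow> 'k) \<Rightarrow> (('v, nat) btree \<Rightarrow> 'k) \<Rightarrow> 'k" where
  "formal_pairing V x y = (\<Sum>s | x s \<noteq> 0. \<Sum>t | y t \<noteq> 0. x s * y t * tree_pairing V s t)"

text \<open>Elements of \<open>F(V\<^sup>\<or>)(3)\<close> and \<open>F(V)(3)\<close> are cosets; the value does not depend on the
  representatives.\<close>

definition pairing ::
  "('k::field, 'v) s2_module \<Rightarrow>
   (('v \<Rightarrow> 'k, nat) btree \<Rightarrow> 'k) set \<Rightarrow> (('v, nat) btree \<Rightarrow> 'k) set \<Rightarrow> 'k" where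
  "pairing V X Y = (THE c. \<forall>x\<in>X. \<forall>y\<in>Y. formal_pairing V x y = c)"

definition koszul_dual :: "('k::field, 'v) quadratic_data \<Rightarrow> ('k, 'v \<Rightarrow> 'k) quadratic_data" where
  "koszul_dual D =
    \<lparr>gens = sgn_dual (gens D),
     rels = {X \<in> ops (free_operad (sgn_dual (gens D))) 3. \<forall>Y\<in>rels D. pairing (gens D) X Y = 0}\<rparr>"


section \<open>Symmetric dialgebras and associative admissible algebras\<close>

text \<open>The \<open>S\<^sub>2\<close>-module generated by binary operations \<open>b :: 'b\<close> without symmetries: a direct sum of
  regular representations, with basis the operations \<open>(b, False)\<close> and their opposites
  \<open>(b, True)\<close>.\<close>

definition regular_s2 :: "('k::field, 'b \<times> bool \<Rightarrow> 'k) s2_module" where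
  "regular_s2 =
    \<lparr>carrier = carrier (free_space UNIV), monoid.mult = undefined, one = undefined,
     zero = zero (free_space UNIV), add = add (free_space UNIV), smult = smult (free_space UNIV),
     flip = (\<lambda>f (b, e). f (b, \<not> e))\<rparr>"

abbreviation operation :: "'b \<Rightarrow> (('b \<times> bool \<Rightarrow> 'k::field, nat) btree \<Rightarrow> 'k) set" where
  "operation b \<equiv> gen regular_s2 (basis (b, False))"

abbreviation free3 ::
  "('k::field, (('b \<times> bool \<Rightarrow> 'k, nat) btree \<Rightarrow> 'k) set) module" where
  "free3 \<equiv> space (free_operad regular_s2) 3"

text \<open>For binary operations \<open>\<mu>\<close> and \<open>\<nu>\<close>: \<open>left_mon \<mu> \<nu> = \<mu>(\<nu>(a, b), c)\<close> and
  \<open>right_mon \<mu> \<nu> = \<mu>(a, \<nu>(b, c))\<close>.\<close>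

abbreviation "left_mon \<equiv> pcomp (free_operad regular_s2) 2 2 0"
abbreviation "right_mon \<equiv> pcomp (free_operad regular_s2) 2 2 1"

datatype dialgebra_op = Vdash | Dashv

text \<open>\<open>(a \<circ>\<^sub>1 b) \<circ>\<^sub>2 c = a \<circ>\<^sub>3 (b \<circ>\<^sub>4 c)\<close>; the case \<open>\<circ>\<^sub>1 = \<circ>\<^sub>2 = \<circ>\<^sub>3 = \<circ>\<^sub>4\<close> is associativity
  of the two multiplications.\<close>

definition sDiAss :: "('k::field, dialgebra_op \<times> bool \<Rightarrow> 'k) quadratic_data" where
  "sDiAss =
    \<lparr>gens = regular_s2,
     rels = sym_span (free_operad regular_s2) 3
       {left_mon (operation o2) (operation o1) \<ominus>\<^bsub>free3\<^esub> right_mon (operation o3) (operation o4) |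
          o1 o2 o3 o4. True}\<rparr>"

datatype admissible_op = Succ | Prec

definition star :: "((admissible_op \<times> bool \<Rightarrow> 'k::field, nat) btree \<Rightarrow> 'k) set" where
  "star = operation Succ \<oplus>\<^bsub>space (free_operad regular_s2) 2\<^esub> operation Prec"

definition AssAdm :: "('k::field, admissible_op \<times> bool \<Rightarrow> 'k) quadratic_data" where
  "AssAdm =
    \<lparr>gens = regular_s2,
     rels = sym_span (free_operad regular_s2) 3 {left_mon star star \<ominus>\<^bsub>free3\<^esub> right_mon star star}\<rparr>"

end

theory Submission
  imports Defs
begin

text \<open>Identify the generators of \<open>AssAdm\<close> with the basis of \<open>V\<^sup>\<or>\<close> dual to the generators of
  \<open>sDiAss\<close>; then \<open>star\<close> becomes the functional \<open>total\<close> taking the value 1 on both products and 0 on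
  their opposites. An element \<open>x\<close> of \<open>F(V\<^sup>\<or>)(3)\<close> is orthogonal to the relations of \<open>sDiAss\<close> iff for
  each permutation \<open>\<sigma>\<close> of the inputs its pairings with all eight monomials of shape \<open>\<sigma>\<close> agree, say
  with value \<open>c \<sigma>\<close>. The associator of \<open>total\<close> has this property with \<open>c = 1\<close> at the identity and
  \<open>c = 0\<close> elsewhere, and its translates realise all functions \<open>c\<close>. Since the pairing is
  nondegenerate, they span the orthogonal complement.

  An isomorphism of \<open>S\<^sub>2\<close>-modules acts on trees by renaming vertices, and this carries both
  quotients (by the relations of the free operad and by the quadratic relations) to each other.\<close>

text \<open>\<open>free_operad V\<close> is only known as a quotient by a generated ideal, so
  neither the size of F(V)(3) nor the independence of \<open>pairing\<close> from representatives is
  visible from the definitions. The ideal is bounded from above by another ideal, the common kernel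
  of the functionals \<alpha> \<otimes> \<beta> on the three copies of V \<otimes> V
  (\<open>kernel\<close>); this makes the pairing well defined. It is bounded from below by
  rewriting every tree, modulo the ideal, to the comb computed by \<open>left_comb\<close>; with a
  finite basis this gives nondegeneracy. For two operations F(V)(3) has dimension 3 * 4 * 4 = 48:
  six labellings times eight monomials. The relations identify the eight monomials of each
  labelling, so the complement has dimension six, one for each translate of an associator. The sign
  twist leaves the dual a regular representation, because it can be absorbed by negating the
  coordinates of the opposites. It also gives right monomials the opposite sign from left ones in
  the pairing, and the minus sign of the associator compensates for that.\<close>

section \<open>Finitely supported functions and the tree operad\<close>

text \<open>HOL-Algebra claims the notation \<open>inv\<close>.\<close>

abbreviation pinv :: "(nat \<Rightarrow> nat) \<Rightarrow> nat \<Rightarrow> nat" where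
  "pinv \<equiv> inv_into UNIV"

text \<open>The linear extension of \<open>L\<close> from basis vectors. Summing over the support
  matches the sums in the definitions of the tree operad and of the pairing; for infinite support
  the value is the default 0.\<close>

definition ev :: "('x \<Rightarrow> 'k::field) \<Rightarrow> ('x \<Rightarrow> 'k) \<Rightarrow> 'k" where
  "ev L x = (\<Sum>p | x p \<noteq> 0. x p * L p)"

definition lin :: "('x \<Rightarrow> 'y \<Rightarrow> 'k::field) \<Rightarrow> ('x \<Rightarrow> 'k) \<Rightarrow> 'y \<Rightarrow> 'k" where
  "lin F x = (\<lambda>t. ev (\<lambda>p. F p t) x)"

abbreviation fin :: "('x \<Rightarrow> 'k::field) \<Rightarrow> bool" where
  "fin x \<equiv> finite {p. x p \<noteq> 0}"

text \<open>Linearity in \<open>x\<close> is obstructed by index sets that vary with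
  \<open>x\<close>; enlarging them to a common finite set removes the obstruction.\<close>

lemma ev_superset:
  assumes "finite A" "{p. x p \<noteq> 0} \<subseteq> A"
  shows "ev L x = (\<Sum>p\<in>A. x p * L p)"
  unfolding ev_def by (rule sum.mono_neutral_left) (use assms in auto)

lemma ev_cong: "(\<And>p. x p \<noteq> 0 \<Longrightarrow> L p = M p) \<Longrightarrow> ev L x = ev M x"
  unfolding ev_def by (rule sum.cong) auto

lemma supp_basis: "{p. basis q p \<noteq> (0::'k::field)} = {q}"
  by (auto simp: basis_def)

lemma fin_basis [simp]: "fin (basis q)"
  by (simp add: supp_basis)

lemma ev_basis [simp]: "ev L (basis p) = L p"
  unfolding ev_def supp_basis by (simp add: basis_def)

lemma fin_add: "fin x \<Longrightarrow> fin y \<Longrightarrow> fin (\<lambda>t. x t + y t)"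
  by (rule finite_subset[of _ "{p. x p \<noteq> 0} \<union> {p. y p \<noteq> 0}"]) auto

lemma fin_smult: "fin x \<Longrightarrow> fin (\<lambda>t. c * x t)"
  by (rule finite_subset[of _ "{p. x p \<noteq> 0}"]) auto

lemma fin_diff: "fin x \<Longrightarrow> fin y \<Longrightarrow> fin (\<lambda>t. x t - y t)"
  by (rule finite_subset[of _ "{p. x p \<noteq> 0} \<union> {p. y p \<noteq> 0}"]) auto

lemma ev_add:
  assumes "fin x" "fin y"
  shows "ev L (\<lambda>t. x t + y t) = ev L x + ev L y"
proof -
  let ?A = "{p. x p \<noteq> 0} \<union> {p. y p \<noteq> 0}"
  have "finite ?A" using assms by auto
  then show ?thesis
    by (subst (1 2 3) ev_superset[where A = ?A]) (auto simp: sum.distrib algebra_simps)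
qed

lemma ev_smult: "ev L (\<lambda>t. c * x t) = c * ev L x"
  by (cases "c = 0") (simp_all add: ev_def sum_distrib_left mult.assoc)

lemma ev_diff:
  assumes "fin x" "fin y"
  shows "ev L (\<lambda>t. x t - y t) = ev L x - ev L y"
  using ev_add[OF assms(1) fin_smult[OF assms(2)], of L "-1"] ev_smult[of L "-1" y] by simp

lemma ev_zero [simp]: "ev L (\<lambda>_. 0) = 0"
  by (simp add: ev_def)

lemma ev_zero_fun [simp]: "ev (\<lambda>_. 0) x = 0"
  by (simp add: ev_def)

lemma ev_add_fun: "ev (\<lambda>p. L p + M p) x = ev L x + ev M x"
  by (simp add: ev_def sum.distrib algebra_simps)

lemma ev_smult_fun: "ev (\<lambda>p. c * L p) x = c * ev L x"
  by (simp add: ev_def sum_distrib_left mult.left_commute)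

lemma ev_mult_fun: "ev (\<lambda>p. L p * c) x = ev L x * c"
  by (simp add: ev_def sum_distrib_right mult.assoc)

lemma ev_sum_fun: "ev (\<lambda>p. \<Sum>i\<in>A. L i p) x = (\<Sum>i\<in>A. ev (L i) x)"
  unfolding ev_def by (simp add: sum_distrib_left) (rule sum.swap)

lemma ev_swap: "ev (\<lambda>p. ev (L p) y) x = ev (\<lambda>q. ev (\<lambda>p. L p q) x) y"
  unfolding ev_def by (simp add: sum_distrib_left) (subst sum.swap, simp add: mult.left_commute)

lemma supp_lin: "{t. lin F x t \<noteq> 0} \<subseteq> (\<Union>p\<in>{p. x p \<noteq> 0}. {t. F p t \<noteq> 0})"
  unfolding lin_def ev_def by (auto elim!: sum.not_neutral_contains_not_neutral)

lemma fin_lin: "fin x \<Longrightarrow> (\<And>p. x p \<noteq> 0 \<Longrightarrow> fin (F p)) \<Longrightarrow> fin (lin F x)"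
  by (rule finite_subset[OF supp_lin]) auto

text \<open>An interchange of two finite sums. The union \<open>?B\<close> of the supports of the
  \<open>F p\<close> bounds the support of \<open>lin F x\<close>, which may be smaller through
  cancellation.\<close>

lemma ev_lin:
  assumes "fin x" "\<And>p. x p \<noteq> 0 \<Longrightarrow> fin (F p)"
  shows "ev L (lin F x) = ev (\<lambda>p. ev L (F p)) x"
proof -
  let ?A = "{p. x p \<noteq> 0}"
  let ?B = "\<Union>p\<in>?A. {t. F p t \<noteq> 0}"
  have B: "finite ?B" using assms by auto
  have "ev L (lin F x) = (\<Sum>t\<in>?B. (\<Sum>p\<in>?A. x p * F p t) * L t)"
    by (subst ev_superset[OF B supp_lin]) (simp add: lin_def ev_def)
  also have "\<dots> = (\<Sum>p\<in>?A. x p * (\<Sum>t\<in>?B. F p t * L t))"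
    by (simp add: sum_distrib_left sum_distrib_right mult.assoc) (rule sum.swap)
  also have "\<dots> = (\<Sum>p\<in>?A. x p * ev L (F p))"
    by (intro sum.cong refl arg_cong2[where f = "(*)"] ev_superset[symmetric, OF B]) auto
  finally show ?thesis by (simp add: ev_def)
qed

lemma lin_cong: "(\<And>p. x p \<noteq> 0 \<Longrightarrow> F p = G p) \<Longrightarrow> lin F x = lin G x"
  unfolding lin_def by (intro ext ev_cong) auto

lemma lin_basis_arg [simp]: "lin F (basis p) = F p"
  by (simp add: lin_def)

lemma lin_basis [simp]:
  assumes "fin x" shows "lin basis x = x"
proof
  fix t
  \<comment> \<open>With \<open>t\<close> added to the index set the sum collapses to the term at
    \<open>t\<close> also when \<open>x t = 0\<close>.\<close>
  have "lin basis x t = (\<Sum>p\<in>insert t {p. x p \<noteq> 0}. x p * basis p t)"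
    unfolding lin_def using assms by (intro ev_superset) auto
  also have "\<dots> = (\<Sum>p\<in>{t}. x p * basis p t)"
    using assms by (intro sum.mono_neutral_right) (auto simp: basis_def)
  finally show "lin basis x t = x t" by (simp add: basis_def)
qed

lemma lin_lin:
  assumes "fin x" "\<And>p. x p \<noteq> 0 \<Longrightarrow> fin (G p)"
  shows "lin F (lin G x) = lin (\<lambda>p. lin F (G p)) x"
  using ev_lin[OF assms] by (simp add: lin_def)

lemma lin_swap: "lin (\<lambda>p. lin (F p) y) x = lin (\<lambda>q. lin (\<lambda>p. F p q) x) y"
  unfolding lin_def by (intro ext ev_swap)

lemma lin_zero [simp]: "lin F (\<lambda>_. 0) = (\<lambda>_. 0)" "lin (\<lambda>_ _. 0) x = (\<lambda>_. 0)"
  by (simp_all add: lin_def)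

lemma lin_add: "fin x \<Longrightarrow> fin y \<Longrightarrow> lin F (\<lambda>t. x t + y t) = (\<lambda>t. lin F x t + lin F y t)"
  by (simp add: lin_def ev_add)

lemma lin_diff: "fin x \<Longrightarrow> fin y \<Longrightarrow> lin F (\<lambda>t. x t - y t) = (\<lambda>t. lin F x t - lin F y t)"
  by (simp add: lin_def ev_diff)

lemma lin_smult: "lin F (\<lambda>t. c * x t) = (\<lambda>t. c * lin F x t)"
  by (simp add: lin_def ev_smult)

lemma lin_add_fun: "lin (\<lambda>p t. F p t + G p t) x = (\<lambda>t. lin F x t + lin G x t)"
  by (simp add: lin_def ev_add_fun)

lemma lin_smult_fun: "lin (\<lambda>p t. c * F p t) x = (\<lambda>t. c * lin F x t)"
  by (simp add: lin_def ev_smult_fun)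

lemma cring_scalars: "cring scalars"
  by (intro cringI abelian_groupI comm_monoidI)
     (auto simp: scalars_def algebra_simps intro: exI[of _ "- _"] add.left_inverse
        dest: spec[where x = "- _"])

lemma module_free_space: "module (scalars :: 'k::field ring) (free_space S)"
proof (intro module.intro cring_scalars abelian_groupI module_axioms.intro)
  fix x :: "'a \<Rightarrow> 'k" assume "x \<in> carrier (free_space S)"
  then show "\<exists>y\<in>carrier (free_space S). y \<oplus>\<^bsub>free_space S\<^esub> x = \<zero>\<^bsub>free_space S\<^esub>"
    by (intro bexI[of _ "\<lambda>t. - x t"]) (auto simp: free_space_def)
next
  fix x y :: "'a \<Rightarrow> 'k" assume "x \<in> carrier (free_space S)" "y \<in> carrier (free_space S)"
  then show "x \<oplus>\<^bsub>free_space S\<^esub> y \<in> carrier (free_space S)"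
    by (simp add: free_space_def fin_add subset_iff) (metis add.right_neutral)
qed (auto simp: free_space_def scalars_def algebra_simps intro!: fin_smult)

section \<open>Trees, grafting and block permutations\<close>

primrec subst :: "('l \<Rightarrow> ('v, 'm) btree) \<Rightarrow> ('v, 'l) btree \<Rightarrow> ('v, 'm) btree" where
  "subst h (Leaf l) = h l"
| "subst h (Node v s t) = Node v (subst h s) (subst h t)"

lemma subst_subst: "subst h (subst g t) = subst (\<lambda>l. subst h (g l)) t"
  by (induction t) auto

lemma subst_cong: "(\<And>l. l \<in> set (leaves t) \<Longrightarrow> g l = h l) \<Longrightarrow> subst g t = subst h t"
  by (induction t) auto

lemma relabel_subst: "relabel f t = subst (\<lambda>l. Leaf (f l)) t"
  by (induction t) auto

lemma subst_Leaf [simp]: "subst Leaf t = t"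
  by (induction t) auto

lemma leaves_subst: "leaves (subst h t) = concat (map (\<lambda>l. leaves (h l)) (leaves t))"
  by (induction t) auto

lemma vertices_subst: "vertices (subst h t) = vertices t \<union> (\<Union>l\<in>set (leaves t). vertices (h l))"
  by (induction t) auto

lemma leaves_map_btree [simp]: "leaves (map_btree g f t) = map f (leaves t)"
  by (induction t) auto

definition graft_at :: "nat \<Rightarrow> nat \<Rightarrow> ('v, nat) btree \<Rightarrow> nat \<Rightarrow> ('v, nat) btree" where
  "graft_at n i t j =
     (if j < i then Leaf j else if j = i then relabel (\<lambda>l. i + l) t else Leaf (j + n - 1))"

text \<open>Relabelling and grafting are both instances of \<open>subst\<close>, which composes by
  \<open>subst_subst\<close>. The operad axioms for trees thus become comparisons of two functions
  on the leaf labels of one tree.\<close>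

lemma graft_subst: "graft n i s t = subst (graft_at n i t) s"
  by (induction s) (auto simp: graft_at_def)

lemma map_btree_graft:
  "map_btree g id (graft n i s t) = graft n i (map_btree g id s) (map_btree g id t)"
  by (induction s) (auto simp: btree.map_comp o_def)

lemma treesD:
  assumes "t \<in> trees S n"
  shows "vertices t \<subseteq> S" "distinct (leaves t)" "set (leaves t) = {..<n}"
    "\<And>l. l \<in> set (leaves t) \<Longrightarrow> l < n"
  using assms by (auto simp: trees_def)

lemma leaves_nonempty: "leaves t \<noteq> []"
  by (induction t) auto

text \<open>There are no trees of arity 0. This keeps the truncated subtraction in labels
  \<open>j + n - 1\<close> and arities \<open>m + n - 1\<close> under control.\<close>

lemma trees_pos: "t \<in> trees S n \<Longrightarrow> 0 < n"
  using leaves_nonempty[of t] treesD(3)[of t S n] by (cases n) auto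

lemma distinct_concat_map:
  assumes "distinct xs" "\<And>x. x \<in> set xs \<Longrightarrow> distinct (f x)"
    and "\<And>x y z. \<lbrakk>x \<in> set xs; y \<in> set xs; z \<in> set (f x); z \<in> set (f y)\<rbrakk> \<Longrightarrow> x = y"
  shows "distinct (concat (map f xs))"
  using assms
proof (induction xs)
  case (Cons a xs)
  have "set (f a) \<inter> set (concat (map f xs)) = {}"
    using Cons.prems(1) Cons.prems(3)[of a] by fastforce
  moreover have "distinct (concat (map f xs))"
    using Cons.prems by (intro Cons.IH) auto
  ultimately show ?case using Cons.prems(2) by simp
qed simp

text \<open>The leaves of \<open>p\<close> contribute consecutive blocks of labels: \<open>j\<close>
  itself below \<open>i\<close>, a block of length \<open>n\<close> starting at \<open>i\<close>,
  and \<open>j + n - 1\<close> above; these partition \<open>{..<m + n - 1}\<close>.\<close>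

lemma graft_trees:
  assumes i: "i < m" and p: "p \<in> trees S m" and q: "q \<in> trees S n"
  shows "graft n i p q \<in> trees S (m + n - 1)"
proof -
  note n = trees_pos[OF q] note pD = treesD[OF p] note qD = treesD[OF q]
  have lv: "leaves (graft_at n i q j) =
      (if j < i then [j] else if j = i then map (\<lambda>l. i + l) (leaves q) else [j + n - 1])" for j
    by (auto simp: graft_at_def)
  have mem: "l \<in> set (leaves (graft_at n i q j)) \<longleftrightarrow>
      j < i \<and> l = j \<or> j = i \<and> i \<le> l \<and> l < i + n \<or> i < j \<and> l = j + n - 1" for j l
  proof -
    have "l \<in> (\<lambda>l. i + l) ` {..<n} \<longleftrightarrow> i \<le> l \<and> l < i + n"
      by (auto simp: image_iff intro!: bexI[of _ "l - i"])
    then show ?thesis by (simp add: lv qD(3))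
  qed
  have dist: "distinct (leaves (graft_at n i q j))" for j
    using qD(2) by (simp add: lv distinct_map inj_on_def)
  have "j = j'" if "l \<in> set (leaves (graft_at n i q j))" "l \<in> set (leaves (graft_at n i q j'))" for l j j'
    using that n unfolding mem by linarith
  then have "distinct (leaves (graft n i p q))"
    unfolding graft_subst leaves_subst by (intro distinct_concat_map pD(2) dist)
  moreover have "set (leaves (graft n i p q)) = {..<m + n - 1}"
  proof -
    have "(\<exists>j<m. l \<in> set (leaves (graft_at n i q j))) \<longleftrightarrow> l < m + n - 1" for l
    proof
      assume "\<exists>j<m. l \<in> set (leaves (graft_at n i q j))"
      then show "l < m + n - 1" using i n unfolding mem by auto
    next
      assume l: "l < m + n - 1"
      consider "l < i" | "i \<le> l" "l < i + n" | "i + n \<le> l" by linarith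
      then show "\<exists>j<m. l \<in> set (leaves (graft_at n i q j))"
      proof cases
        case 1 then show ?thesis using i by (intro exI[of _ l]) (simp add: mem)
      next
        case 2 then show ?thesis using i by (intro exI[of _ i]) (simp add: mem)
      next
        case 3
        \<comment> \<open>A label \<open>l\<close> beyond the block stems from the leaf
          \<open>l + 1 - n\<close> of \<open>p\<close>.\<close>
        then have "l + 1 - n < m" "i < l + 1 - n" "l = (l + 1 - n) + n - 1" using n l by linarith+
        then show ?thesis unfolding mem by blast
      qed
    qed
    then show ?thesis unfolding graft_subst leaves_subst by (auto simp: pD(3))
  qed
  moreover have "vertices (graft n i p q) \<subseteq> S"
    unfolding graft_subst vertices_subst using pD(1) qD(1)
    by (auto simp: graft_at_def btree.set_map split: if_splits)
  ultimately show ?thesis by (simp add: trees_def)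
qed

lemma relabel_trees: "\<sigma> permutes {..<n} \<Longrightarrow> t \<in> trees S n \<Longrightarrow> relabel \<sigma> t \<in> trees S n"
  by (auto simp: trees_def btree.set_map distinct_map permutes_image permutes_inj_on)

lemma graft_unit_left: "graft n 0 (Leaf 0) q = q"
proof -
  have "(+) (0::nat) = id" by (simp add: fun_eq_iff)
  then show ?thesis by (simp add: btree.map_id)
qed

lemma graft_unit_right: "graft 1 i (p :: ('v, nat) btree) (Leaf 0) = p"
proof -
  have "graft_at 1 i (Leaf 0 :: ('v, nat) btree) = Leaf" by (auto simp: graft_at_def fun_eq_iff)
  then show ?thesis by (simp only: graft_subst subst_Leaf)
qed

lemma graft_at_simps:
  "j < i \<Longrightarrow> graft_at n i t j = Leaf j"
  "graft_at n i t i = subst (\<lambda>l. Leaf (i + l)) t"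
  "i < j \<Longrightarrow> graft_at n i t j = Leaf (j + n - 1)"
  by (simp_all add: graft_at_def relabel_subst)

lemma graft_sequential:
  assumes "j < m" "0 < n"
  shows "graft n (i + j) (graft m i p q) r = graft (m + n - 1) i p (graft n j q r)"
  unfolding graft_subst subst_subst
proof (rule subst_cong)
  fix a
  \<comment> \<open>The leaf \<open>i\<close> of \<open>p\<close> is replaced by \<open>q\<close>,
    so equality there is decided leaf by leaf on \<open>q\<close>.\<close>
  have eq: "subst (graft_at n (i + j) r) (subst (\<lambda>l. Leaf (i + l)) q) =
      subst (\<lambda>l. Leaf (i + l)) (subst (graft_at n j r) q)"
    unfolding subst_subst
  proof (rule subst_cong)
    fix b
    consider "b < j" | "b = j" | "j < b" by linarith
    then show "subst (graft_at n (i + j) r) (Leaf (i + b)) =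
        subst (\<lambda>l. Leaf (i + l)) (graft_at n j r b)"
      by cases (use assms in \<open>simp_all add: graft_at_simps subst_subst add.assoc\<close>)
  qed
  consider "a < i" | "a = i" | "i < a" by linarith
  then show "subst (graft_at n (i + j) r) (graft_at m i q a) =
      graft_at (m + n - 1) i (subst (graft_at n j r) q) a"
  proof cases
    case 3
    \<comment> \<open>A leaf of \<open>p\<close> to the right of \<open>i\<close> lands beyond all
      labels of \<open>q\<close>, hence beyond the grafting point \<open>i + j\<close>; this uses
      \<open>j < m\<close>.\<close>
    then have "i + j < a + m - 1" using assms by linarith
    then show ?thesis using 3 assms by (simp add: graft_at_simps)
  qed (use eq in \<open>simp_all add: graft_at_simps\<close>)
qed

lemma graft_parallel:
  assumes "i < k" "0 < n" and q: "q \<in> trees S m"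
  shows "graft n (k + m - 1) (graft m i p q) r = graft m i (graft n k p r) q"
  unfolding graft_subst subst_subst
proof (rule subst_cong)
  fix a
  note m = trees_pos[OF q]
  \<comment> \<open>The labels of \<open>q\<close> end below \<open>k + m - 1\<close>, so the second
    graft does not touch them.\<close>
  have eq1: "subst (graft_at n (k + m - 1) r) (subst (\<lambda>l. Leaf (i + l)) q) =
      subst (\<lambda>l. Leaf (i + l)) q"
    unfolding subst_subst
  proof (rule subst_cong)
    fix l assume "l \<in> set (leaves q)"
    then have "i + l < k + m - 1" using treesD(4)[OF q, of l] assms(1) by linarith
    then show "subst (graft_at n (k + m - 1) r) (Leaf (i + l)) = Leaf (i + l)"
      by (simp add: graft_at_simps)
  qed
  \<comment> \<open>The labels of \<open>r\<close> start at \<open>k\<close>, to the right of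
    \<open>i\<close>, so grafting \<open>q\<close> shifts all of them by
    \<open>m - 1\<close>.\<close>
  have eq2: "subst (graft_at m i q) (subst (\<lambda>l. Leaf (k + l)) r) =
      subst (\<lambda>l. Leaf (k + m - 1 + l)) r"
    unfolding subst_subst
    by (rule subst_cong) (use assms m in \<open>simp add: graft_at_simps\<close>)
  consider "a < i" | "a = i" | "i < a" "a < k" | "a = k" | "k < a" by linarith
  then show "subst (graft_at n (k + m - 1) r) (graft_at m i q a) =
      subst (graft_at m i q) (graft_at n k r a)"
    by cases (use assms eq1 eq2 m in \<open>simp_all add: graft_at_simps\<close>)
qed

text \<open>At a leaf \<open>a\<close> of \<open>p\<close> other than \<open>i\<close>, only the
  order of \<open>\<sigma> a\<close> and \<open>\<sigma> i\<close> decides whether the new label is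
  shifted past the block; inside the block \<open>\<tau>\<close> acts.\<close>

lemma graft_equivariant:
  assumes i: "i < m" and \<sigma>: "\<sigma> permutes {..<m}" and p: "p \<in> trees S m" and q: "q \<in> trees S n"
  shows "relabel (perm_comp m n i \<sigma> \<tau>) (graft n i p q) =
    graft n (\<sigma> i) (relabel \<sigma> p) (relabel \<tau> q)"
  unfolding graft_subst relabel_subst subst_subst
proof (rule subst_cong)
  let ?\<pi> = "perm_comp m n i \<sigma> \<tau>"
  fix a assume "a \<in> set (leaves p)"
  then have a: "a < m" by (rule treesD(4)[OF p])
  note n = trees_pos[OF q]
  have ne: "\<sigma> a = \<sigma> i \<longleftrightarrow> a = i"
    using permutes_inj[OF \<sigma>] by (auto dest: injD)
  have eq: "subst (\<lambda>l. Leaf (?\<pi> l)) (subst (\<lambda>l. Leaf (i + l)) q) =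
      subst (\<lambda>l. Leaf (\<sigma> i + l)) (subst (\<lambda>l. Leaf (\<tau> l)) q)"
    unfolding subst_subst
    by (rule subst_cong) (use treesD(4)[OF q] in \<open>simp add: perm_comp_def\<close>)
  have "?\<pi> a = (if \<sigma> a < \<sigma> i then \<sigma> a else \<sigma> a + n - 1)" if "a < i"
    using that by (simp add: perm_comp_def)
  moreover have "?\<pi> (a + n - 1) = (if \<sigma> a < \<sigma> i then \<sigma> a else \<sigma> a + n - 1)" if "i < a"
  proof -
    have "\<not> a + n - 1 < i" "\<not> a + n - 1 < i + n" "a + n - 1 < m + n - 1" "a + n - 1 + 1 - n = a"
      using that a n by linarith+
    then show ?thesis by (simp add: perm_comp_def Let_def del: One_nat_def)
  qed
  ultimately show "subst (\<lambda>l. Leaf (?\<pi> l)) (graft_at n i q a) =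
      subst (graft_at n (\<sigma> i) (subst (\<lambda>l. Leaf (\<tau> l)) q)) (Leaf (\<sigma> a))"
    using eq ne by (cases "a < i"; cases "a = i") (auto simp: graft_at_simps graft_at_def relabel_subst)
qed

text \<open>An injective self-map of a finite set is bijective, so range and injectivity
  suffice.\<close>

lemma perm_comp_permutes:
  assumes i: "i < m" and \<sigma>: "\<sigma> permutes {..<m}" and \<tau>: "\<tau> permutes {..<n}"
  shows "perm_comp m n i \<sigma> \<tau> permutes {..<m + n - 1}"
proof -
  let ?\<pi> = "perm_comp m n i \<sigma> \<tau>"
  have \<sigma>eq: "\<sigma> l = \<sigma> l' \<longleftrightarrow> l = l'" for l l' using permutes_inj[OF \<sigma>] by (auto dest: injD)
  have \<tau>eq: "\<tau> l = \<tau> l' \<longleftrightarrow> l = l'" for l l' using permutes_inj[OF \<tau>] by (auto dest: injD)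
  have \<sigma>lt: "\<sigma> l < m" if "l < m" for l using permutes_in_image[OF \<sigma>, of l] that by auto
  have \<tau>lt: "\<tau> l < n" if "l < n" for l using permutes_in_image[OF \<tau>, of l] that by auto
  have lt: "?\<pi> l < m + n - 1" if l: "l < m + n - 1" for l
  proof -
    consider "l < i" | "i \<le> l" "l < i + n" | "i + n \<le> l" by linarith
    then show ?thesis
    proof cases
      case 1
      then show ?thesis using \<sigma>lt[of l] \<sigma>lt[OF i] \<sigma>eq[of l i] i by (auto simp: perm_comp_def Let_def)
    next
      case 2
      then have "?\<pi> l = \<sigma> i + \<tau> (l - i)" "\<tau> (l - i) < n" using \<tau>lt[of "l - i"] by (auto simp: perm_comp_def)
      then show ?thesis using \<sigma>lt[OF i] by linarith
    next
      case 3
      then have c: "l + 1 - n < m" "l + 1 - n \<noteq> i" using l i by linarith+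
      then have "\<sigma> (l + 1 - n) \<noteq> \<sigma> i" by (simp add: \<sigma>eq)
      moreover have "?\<pi> l = (if \<sigma> (l + 1 - n) < \<sigma> i then \<sigma> (l + 1 - n) else \<sigma> (l + 1 - n) + n - 1)"
        using 3 l by (simp add: perm_comp_def Let_def)
      ultimately show ?thesis using \<sigma>lt[OF c(1)] \<sigma>lt[OF i] by (simp split: if_split) linarith
    qed
  qed
  have inj: "l = l'" if l: "l < m + n - 1" "l' < m + n - 1" and eq: "?\<pi> l = ?\<pi> l'" for l l'
  proof -
    \<comment> \<open>\<open>c l\<close> is the letter of \<open>\<sigma>\<close> to which the
      position \<open>l\<close> of the composite belongs.\<close>
    define c where "c l = (if l < i then l else if l < i + n then i else l + 1 - n)" for l
    have in_block: "?\<pi> l = \<sigma> i + \<tau> (l - i)" if "i \<le> l" "l < i + n" for l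
      using that by (simp add: perm_comp_def)
    have out_block: "?\<pi> l = (if \<sigma> (c l) < \<sigma> i then \<sigma> (c l) else \<sigma> (c l) + n - 1)"
      if "l < m + n - 1" "\<not> (i \<le> l \<and> l < i + n)" for l
      using that by (auto simp: perm_comp_def c_def Let_def)
    have nb: "\<not> (i \<le> l \<and> l < i + n) \<Longrightarrow> \<sigma> (c l) \<noteq> \<sigma> i" for l
      by (auto simp: \<sigma>eq c_def)
    \<comment> \<open>Positions in the block go to
      \<open>\<sigma> i, ..., \<sigma> i + n - 1\<close> and all others outside this range, so the
      mixed cases are impossible.\<close>
    consider "i \<le> l" "l < i + n" "i \<le> l'" "l' < i + n"
      | "i \<le> l" "l < i + n" "\<not> (i \<le> l' \<and> l' < i + n)"
      | "\<not> (i \<le> l \<and> l < i + n)" "i \<le> l'" "l' < i + n"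
      | "\<not> (i \<le> l \<and> l < i + n)" "\<not> (i \<le> l' \<and> l' < i + n)" by blast
    then show ?thesis
    proof cases
      case 1
      then have "\<tau> (l - i) = \<tau> (l' - i)" using eq in_block l by simp
      then show ?thesis using 1 by (simp add: \<tau>eq)
    next
      case 2
      then have "?\<pi> l = \<sigma> i + \<tau> (l - i)" "\<tau> (l - i) < n" using in_block l \<tau>lt[of "l - i"] by auto
      then show ?thesis using eq out_block[OF l(2) 2(3)] nb[OF 2(3)] by (simp split: if_splits)
    next
      case 3
      then have "?\<pi> l' = \<sigma> i + \<tau> (l' - i)" "\<tau> (l' - i) < n" using in_block l \<tau>lt[of "l' - i"] by auto
      then show ?thesis using eq out_block[OF l(1) 3(1)] nb[OF 3(1)] by (simp split: if_splits)
    next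
      case 4
      then have "\<sigma> (c l) = \<sigma> (c l')"
        using eq out_block[OF l(1) 4(1)] out_block[OF l(2) 4(2)] nb[OF 4(1)] nb[OF 4(2)] by (auto split: if_splits)
      then have "c l = c l'" by (simp add: \<sigma>eq)
      then show ?thesis using 4 by (auto simp: c_def split: if_splits)
    qed
  qed
  have out: "?\<pi> l = l" if "\<not> l < m + n - 1" for l using that i by (auto simp: perm_comp_def)
  have "inj_on ?\<pi> {..<m + n - 1}" using inj by (simp add: inj_on_def)
  moreover from this have "?\<pi> ` {..<m + n - 1} = {..<m + n - 1}"
    using lt by (intro endo_inj_surj) auto
  ultimately have "bij_betw ?\<pi> {..<m + n - 1} {..<m + n - 1}" by (simp add: bij_betw_def)
  then show ?thesis by (rule bij_imp_permutes) (auto simp: out)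
qed

section \<open>The tree operad\<close>

definition tree_ops :: "'v set \<Rightarrow> nat \<Rightarrow> (('v, nat) btree \<Rightarrow> 'k::field) set" where
  "tree_ops S n = {x. fin x \<and> (\<forall>t. x t \<noteq> 0 \<longrightarrow> t \<in> trees S n)}"

lemma tree_opsD:
  assumes "x \<in> tree_ops S n" shows "fin x" "\<And>t. x t \<noteq> 0 \<Longrightarrow> t \<in> trees S n"
  using assms by (auto simp: tree_ops_def)

lemma space_tree_operad [simp]:
  "ops (tree_operad S) n = tree_ops S n"
  "zero (space (tree_operad S) n) = (\<lambda>_. 0)"
  "add (space (tree_operad S) n) x y = (\<lambda>t. x t + y t)"
  "smult (space (tree_operad S) n) c x = (\<lambda>t. c * x t)"
  by (auto simp: tree_operad_def free_space_def tree_ops_def)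

lemma unit_tree_operad [simp]: "unit (tree_operad S) = basis (Leaf 0)"
  by (simp add: tree_operad_def)

lemma act_tree_operad: "act (tree_operad S) n \<sigma> x = (\<lambda>t. x (relabel \<sigma> t))"
  by (simp add: tree_operad_def)

lemma pcomp_tree_operad:
  "pcomp (tree_operad S) m n i x y = lin (\<lambda>p. lin (\<lambda>q. basis (graft n i p q)) y) x"
  by (simp add: tree_operad_def lin_def ev_def sum_distrib_left mult.assoc)

lemma basis_tree_ops: "t \<in> trees S n \<Longrightarrow> basis t \<in> tree_ops S n"
  by (auto simp: tree_ops_def basis_def)

lemma lin_tree_ops:
  assumes "fin x" "\<And>p. x p \<noteq> 0 \<Longrightarrow> F p \<in> tree_ops S n"
  shows "lin F x \<in> tree_ops S n"
  using fin_lin[OF assms(1), of F] supp_lin[of F x] assms(2) by (fastforce simp: tree_ops_def)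

text \<open>The action precomposes coefficients with \<open>relabel \<sigma>\<close>, so the single
  tree with coefficient 1 moves by the inverse permutation.\<close>

lemma act_basis:
  assumes "\<sigma> permutes {..<n}"
  shows "act (tree_operad S) m \<sigma> (basis t) = basis (relabel (pinv \<sigma>) t)"
proof -
  have "relabel \<sigma> u = t \<longleftrightarrow> u = relabel (pinv \<sigma>) t" for u
    by (auto simp: btree.map_comp permutes_inv_o[OF assms] btree.map_id)
  then show ?thesis by (simp add: act_tree_operad basis_def)
qed

lemma act_lin:
  assumes "\<sigma> permutes {..<n}" "fin x"
  shows "act (tree_operad S) m \<sigma> x = lin (\<lambda>t. basis (relabel (pinv \<sigma>) t)) x"
proof -
  have "act (tree_operad S) m \<sigma> x = (\<lambda>t. lin basis x (relabel \<sigma> t))"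
    using assms by (simp add: act_tree_operad)
  also have "\<dots> = lin (\<lambda>t. act (tree_operad S) m \<sigma> (basis t)) x"
    by (simp add: lin_def act_tree_operad)
  finally show ?thesis by (simp add: act_basis[OF assms(1)])
qed

lemma pcomp_tree_ops:
  assumes "i < m" "x \<in> tree_ops S m" "y \<in> tree_ops S n"
  shows "pcomp (tree_operad S) m n i x y \<in> tree_ops S (m + n - 1)"
  unfolding pcomp_tree_operad using tree_opsD[OF assms(2)] tree_opsD[OF assms(3)]
  by (intro lin_tree_ops basis_tree_ops graft_trees[OF assms(1)]) auto

text \<open>All operations are linear extensions, so the composition axioms reduce to the
  corresponding identities between trees.\<close>

lemma tree_operad_symmetric: "symmetric_operad (tree_operad S :: ('k::field, _) operad)"
proof (rule symmetric_operad.intro)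
  let ?T = "tree_operad S :: ('k, ('a, nat) btree \<Rightarrow> 'k) operad"
  fix m n l i j k :: nat and x x' y y' z :: "('a, nat) btree \<Rightarrow> 'k" and c :: 'k
    and \<sigma> \<tau> :: "nat \<Rightarrow> nat"
  have "space ?T n = free_space (trees S n)" by (simp add: tree_operad_def)
  then show "module scalars (space ?T n)" by (simp add: module_free_space)
  show "unit ?T \<in> ops ?T 1"
    by (auto intro!: basis_tree_ops simp: trees_def)
  show "pcomp ?T m n i x y \<in> ops ?T (m + n - 1)"
    if "i < m" "x \<in> ops ?T m" "y \<in> ops ?T n"
    using that pcomp_tree_ops[of i m x S y n] by simp
  show "pcomp ?T m n i (x \<oplus>\<^bsub>space ?T m\<^esub> x') y =
        pcomp ?T m n i x y \<oplus>\<^bsub>space ?T (m + n - 1)\<^esub> pcomp ?T m n i x' y"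
    if "x \<in> ops ?T m" "x' \<in> ops ?T m"
    using that by (simp add: pcomp_tree_operad tree_opsD lin_add)
  show "pcomp ?T m n i x (y \<oplus>\<^bsub>space ?T n\<^esub> y') =
        pcomp ?T m n i x y \<oplus>\<^bsub>space ?T (m + n - 1)\<^esub> pcomp ?T m n i x y'"
    if "y \<in> ops ?T n" "y' \<in> ops ?T n"
    using that by (simp add: pcomp_tree_operad tree_opsD lin_add lin_add_fun)
  show "pcomp ?T m n i (c \<odot>\<^bsub>space ?T m\<^esub> x) y = c \<odot>\<^bsub>space ?T (m + n - 1)\<^esub> pcomp ?T m n i x y"
    by (simp add: pcomp_tree_operad lin_smult)
  show "pcomp ?T m n i x (c \<odot>\<^bsub>space ?T n\<^esub> y) = c \<odot>\<^bsub>space ?T (m + n - 1)\<^esub> pcomp ?T m n i x y"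
    by (simp add: pcomp_tree_operad lin_smult lin_smult_fun)
  show "act ?T n \<sigma> x \<in> ops ?T n" if \<sigma>: "\<sigma> permutes {..<n}" and x: "x \<in> ops ?T n"
    using x tree_opsD[of x S n]
    by (auto simp: act_lin[OF \<sigma>] intro!: lin_tree_ops basis_tree_ops relabel_trees permutes_inv \<sigma>)
  show "act ?T n \<sigma> (x \<oplus>\<^bsub>space ?T n\<^esub> y) = act ?T n \<sigma> x \<oplus>\<^bsub>space ?T n\<^esub> act ?T n \<sigma> y"
    by (simp add: act_tree_operad)
  show "act ?T n \<sigma> (c \<odot>\<^bsub>space ?T n\<^esub> x) = c \<odot>\<^bsub>space ?T n\<^esub> act ?T n \<sigma> x"
    by (simp add: act_tree_operad)
  show "act ?T n id x = x"
    by (simp add: act_tree_operad btree.map_id)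
  show "act ?T n (\<sigma> \<circ> \<tau>) x = act ?T n \<tau> (act ?T n \<sigma> x)"
    by (simp add: act_tree_operad btree.map_comp)
  show "pcomp ?T 1 n 0 (unit ?T) x = x" if "x \<in> ops ?T n"
    using that by (simp add: pcomp_tree_operad graft_unit_left tree_opsD del: graft.simps)
  show "pcomp ?T m 1 i x (unit ?T) = x" if "x \<in> ops ?T m"
    using that by (simp add: pcomp_tree_operad tree_opsD graft_unit_right[unfolded One_nat_def])
  show "pcomp ?T (l + m - 1) n (i + j) (pcomp ?T l m i x y) z =
        pcomp ?T l (m + n - 1) i x (pcomp ?T m n j y z)"
    if *: "i < l" "j < m" "x \<in> ops ?T l" "y \<in> ops ?T m" "z \<in> ops ?T n"
  proof -
    note D = *(3-5)[simplified, THEN tree_opsD(1)] *(3-5)[simplified, THEN tree_opsD(2), THEN trees_pos]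
    show ?thesis
      unfolding pcomp_tree_operad
      by (simp add: lin_lin fin_lin D graft_sequential[OF *(2)] cong: lin_cong)
  qed
  show "pcomp ?T (l + m - 1) n (k + m - 1) (pcomp ?T l m i x y) z =
        pcomp ?T (l + n - 1) m i (pcomp ?T l n k x z) y"
    if *: "i < k" "k < l" "x \<in> ops ?T l" "y \<in> ops ?T m" "z \<in> ops ?T n"
  proof -
    note D = *(3-5)[simplified, THEN tree_opsD(1)] *(3-5)[simplified, THEN tree_opsD(2)]
    have "pcomp ?T (l + m - 1) n (k + m - 1) (pcomp ?T l m i x y) z =
        lin (\<lambda>p. lin (\<lambda>q. lin (\<lambda>r. basis (graft n (k + m - 1) (graft m i p q) r)) z) y) x"
      unfolding pcomp_tree_operad by (simp add: lin_lin fin_lin D)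
    \<comment> \<open>The two grafts are performed in the opposite order on the right, so the
      summations over \<open>q\<close> and \<open>r\<close> are interchanged.\<close>
    also have "\<dots> = lin (\<lambda>p. lin (\<lambda>r. lin (\<lambda>q. basis (graft m i (graft n k p r) q)) y) z) x"
    proof (subst (2) lin_swap, intro lin_cong arg_cong[where f = basis])
      fix p q r assume "y q \<noteq> 0" "z r \<noteq> 0"
      then show "graft n (k + m - 1) (graft m i p q) r = graft m i (graft n k p r) q"
        using *(1) by (intro graft_parallel[where S = S, OF _ trees_pos[OF D(6)] D(5)]) simp_all
    qed
    also have "\<dots> = pcomp ?T (l + n - 1) m i (pcomp ?T l n k x z) y"
      unfolding pcomp_tree_operad by (simp add: lin_lin fin_lin D)
    finally show ?thesis .
  qed
  show "pcomp ?T m n i (act ?T m \<sigma> x) (act ?T n \<tau> y) =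
        act ?T (m + n - 1) (perm_comp m n i \<sigma> \<tau>) (pcomp ?T m n (\<sigma> i) x y)"
    if i: "i < m" and \<sigma>: "\<sigma> permutes {..<m}" and \<tau>: "\<tau> permutes {..<n}"
      and xy: "x \<in> ops ?T m" "y \<in> ops ?T n"
  proof -
    note D = xy[simplified, THEN tree_opsD(1)] xy[simplified, THEN tree_opsD(2)]
    let ?\<pi> = "perm_comp m n i \<sigma> \<tau>"
    have \<pi>: "?\<pi> permutes {..<m + n - 1}" by (rule perm_comp_permutes[OF i \<sigma> \<tau>])
    \<comment> \<open>\<open>graft_equivariant\<close> for the permuted trees gives this identity
      after applying \<open>relabel ?\<pi>\<close>, which is invertible.\<close>
    have *: "graft n i (relabel (pinv \<sigma>) p) (relabel (pinv \<tau>) q) = relabel (pinv ?\<pi>) (graft n (\<sigma> i) p q)"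
      if "p \<in> trees S m" "q \<in> trees S n" for p q
    proof -
      have "relabel ?\<pi> (graft n i (relabel (pinv \<sigma>) p) (relabel (pinv \<tau>) q)) = graft n (\<sigma> i) p q"
        using graft_equivariant[OF i \<sigma> relabel_trees[OF permutes_inv[OF \<sigma>] that(1)]
            relabel_trees[OF permutes_inv[OF \<tau>] that(2)], of \<tau>]
        by (simp add: btree.map_comp permutes_inv_o[OF \<sigma>] permutes_inv_o[OF \<tau>] btree.map_id)
      then have "relabel (pinv ?\<pi>) (graft n (\<sigma> i) p q) =
          relabel (pinv ?\<pi>) (relabel ?\<pi> (graft n i (relabel (pinv \<sigma>) p) (relabel (pinv \<tau>) q)))"
        by simp
      then show ?thesis by (simp add: btree.map_comp permutes_inv_o[OF \<pi>] btree.map_id)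
    qed
    have "pcomp ?T m n i (act ?T m \<sigma> x) (act ?T n \<tau> y) =
       lin (\<lambda>p. lin (\<lambda>q. basis (graft n i (relabel (pinv \<sigma>) p) (relabel (pinv \<tau>) q))) y) x"
      by (simp add: act_lin[OF \<sigma>] act_lin[OF \<tau>] D pcomp_tree_operad lin_lin)
    also have "\<dots> = lin (\<lambda>p. lin (\<lambda>q. basis (relabel (pinv ?\<pi>) (graft n (\<sigma> i) p q))) y) x"
      using D by (auto simp: * intro!: lin_cong)
    also have "\<dots> = act ?T (m + n - 1) ?\<pi> (pcomp ?T m n (\<sigma> i) x y)"
      by (simp add: act_lin[OF \<pi>] pcomp_tree_operad lin_lin fin_lin D)
    finally show ?thesis .
  qed
qed


section \<open>Quotients of operads and isomorphisms\<close>

lemma scalars_simps [simp]: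
  "carrier scalars = UNIV" "one scalars = 1" "zero scalars = 0"
  "monoid.mult scalars a b = a * b" "add scalars a b = a + b"
  by (simp_all add: scalars_def)

lemma scalars_minus: "a_inv scalars a = - a"
proof -
  interpret cring scalars by (rule cring_scalars)
  show ?thesis using minus_equality[of "- a" a] by simp
qed

lemma smult_minus_one:
  assumes "module (scalars :: 'k::field ring) M" "x \<in> carrier M"
  shows "a_inv M x = smult M (- 1) x"
proof -
  interpret module "scalars :: 'k ring" M by fact
  show ?thesis using smult_l_minus[of 1 x] assms(2) smult_one by (simp add: scalars_minus)
qed

text \<open>Negatives are multiples by \<open>- 1\<close>, so the additive subgroup axioms reduce to
  containing zero and closure under sums and multiples.\<close>

lemma submodule_iff:
  assumes "module (scalars :: 'k::field ring) M"
  shows "submodule N (scalars :: 'k::field ring) M \<longleftrightarrow>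
    N \<subseteq> carrier M \<and> zero M \<in> N \<and> (\<forall>x\<in>N. \<forall>y\<in>N. add M x y \<in> N) \<and> (\<forall>c. \<forall>x\<in>N. smult M c x \<in> N)"
    (is "_ \<longleftrightarrow> ?rhs")
proof -
  interpret module "scalars :: 'k ring" M by fact
  show ?thesis
  proof
    assume N: "submodule N (scalars :: 'k ring) M"
    have "zero M \<in> N" using subgroup.one_closed[OF submodule.axioms(1)[OF N]] by simp
    then show ?rhs using submoduleE[OF N] by auto
  next
    assume N: ?rhs
    show "submodule N (scalars :: 'k ring) M"
      using N smult_minus_one[OF assms] by (intro submoduleI) (auto simp: subset_iff)
  qed
qed

section \<open>Quotient vector spaces\<close>

locale subspace_quotient =
  fixes M :: "('k::field, 'a) module" and N :: "'a set"
  assumes mod: "module scalars M" and sub: "submodule N scalars M"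
begin

sublocale M: module scalars M by (rule mod)

sublocale N: abelian_subgroup N M
  by (intro abelian_subgroupI3 additive_subgroupI submodule.axioms(1)[OF sub] M.abelian_group_axioms)

abbreviation cls :: "'a \<Rightarrow> 'a set" where "cls x \<equiv> N +>\<^bsub>M\<^esub> x"

lemma mem_cls_iff: "y \<in> cls x \<longleftrightarrow> (\<exists>z\<in>N. y = z \<oplus>\<^bsub>M\<^esub> x)"
  by (auto simp: a_r_coset_def')

lemma cls_eq_iff:
  assumes "x \<in> carrier M" "y \<in> carrier M"
  shows "cls x = cls y \<longleftrightarrow> (\<exists>z\<in>N. x = z \<oplus>\<^bsub>M\<^esub> y)"
  using N.a_repr_independence'[of x y] N.a_rcos_self[OF assms(1)] assms mem_cls_iff by metis

lemma cls_eqI: "x \<in> carrier M \<Longrightarrow> z \<in> N \<Longrightarrow> cls (z \<oplus>\<^bsub>M\<^esub> x) = cls x"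
  by (subst cls_eq_iff) auto

lemma cls_self: "x \<in> carrier M \<Longrightarrow> x \<in> cls x"
  by (rule N.a_rcos_self)

lemma cls_member:
  assumes "y \<in> cls x" "x \<in> carrier M" shows "y \<in> carrier M" "cls y = cls x"
  using assms by (auto simp: mem_cls_iff cls_eqI)

text \<open>Scaling, composition and action in the quotients are defined as unions over all
  representatives. Once the term is constant along the coset, the union is its value at a
  representative.\<close>

lemma UN_cls:
  assumes "x \<in> carrier M" "\<And>y. y \<in> cls x \<Longrightarrow> f y = f x"
  shows "(\<Union>y\<in>cls x. f y) = f x"
  using assms cls_self by blast

lemma sub_simps: "x \<in> N \<Longrightarrow> y \<in> N \<Longrightarrow> x \<oplus>\<^bsub>M\<^esub> y \<in> N" "x \<in> N \<Longrightarrow> c \<odot>\<^bsub>M\<^esub> x \<in> N"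
  "\<zero>\<^bsub>M\<^esub> \<in> N" "x \<in> N \<Longrightarrow> x \<in> carrier M"
  using sub[unfolded submodule_iff[OF mod]] by auto

lemma carrier_quot: "carrier (quot_space M N) = cls ` carrier M"
  by (auto simp: quot_space_def A_RCOSETS_def')

lemma zero_quot: "\<zero>\<^bsub>quot_space M N\<^esub> = cls \<zero>\<^bsub>M\<^esub>"
  by (simp add: quot_space_def N.a_rcos_const)

lemma add_quot:
  "x \<in> carrier M \<Longrightarrow> y \<in> carrier M \<Longrightarrow> cls x \<oplus>\<^bsub>quot_space M N\<^esub> cls y = cls (x \<oplus>\<^bsub>M\<^esub> y)"
  by (simp add: quot_space_def N.a_rcos_sum)

lemma smult_quot:
  assumes "x \<in> carrier M"
  shows "c \<odot>\<^bsub>quot_space M N\<^esub> cls x = cls (c \<odot>\<^bsub>M\<^esub> x)"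
proof -
  have "cls (c \<odot>\<^bsub>M\<^esub> y) = cls (c \<odot>\<^bsub>M\<^esub> x)" if "y \<in> cls x" for y
    using that assms by (auto simp: mem_cls_iff M.smult_r_distr cls_eqI sub_simps)
  then have "(\<Union>y\<in>cls x. cls (c \<odot>\<^bsub>M\<^esub> y)) = cls (c \<odot>\<^bsub>M\<^esub> x)" by (rule UN_cls[OF assms])
  then show ?thesis by (simp add: quot_space_def)
qed

lemma module_quot: "module scalars (quot_space M N)"
proof -
  let ?Q = "quot_space M N"
  have rep: "\<exists>x\<in>carrier M. A = cls x" if "A \<in> carrier ?Q" for A
    using that by (auto simp: carrier_quot)
  have Q: "cls x \<in> carrier ?Q" if "x \<in> carrier M" for x
    using that by (auto simp: carrier_quot)
  show ?thesis
  proof (intro moduleI cring_scalars abelian_groupI)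
    fix A B C a b
    assume "A \<in> carrier ?Q"
    then obtain x where x: "x \<in> carrier M" "A = cls x" using rep by auto
    show "\<exists>B\<in>carrier ?Q. B \<oplus>\<^bsub>?Q\<^esub> A = \<zero>\<^bsub>?Q\<^esub>"
      using x by (intro bexI[of _ "cls (\<ominus>\<^bsub>M\<^esub> x)"]) (simp_all add: Q add_quot zero_quot M.l_neg)
    show "\<zero>\<^bsub>?Q\<^esub> \<oplus>\<^bsub>?Q\<^esub> A = A" using x by (simp add: add_quot zero_quot)
    show "a \<odot>\<^bsub>?Q\<^esub> A \<in> carrier ?Q" using x by (simp add: smult_quot Q)
    show "(a \<oplus>\<^bsub>scalars\<^esub> b) \<odot>\<^bsub>?Q\<^esub> A = a \<odot>\<^bsub>?Q\<^esub> A \<oplus>\<^bsub>?Q\<^esub> b \<odot>\<^bsub>?Q\<^esub> A"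
      using x M.smult_l_distr[of a b x] by (simp add: smult_quot add_quot)
    show "(a \<otimes>\<^bsub>scalars\<^esub> b) \<odot>\<^bsub>?Q\<^esub> A = a \<odot>\<^bsub>?Q\<^esub> (b \<odot>\<^bsub>?Q\<^esub> A)"
      using x M.smult_assoc1[of a b x] by (simp add: smult_quot)
    show "\<one>\<^bsub>scalars\<^esub> \<odot>\<^bsub>?Q\<^esub> A = A"
      using x M.smult_one[of x] by (simp add: smult_quot)
    assume "B \<in> carrier ?Q"
    then obtain y where y: "y \<in> carrier M" "B = cls y" using rep by auto
    show "A \<oplus>\<^bsub>?Q\<^esub> B \<in> carrier ?Q" using x y by (simp add: add_quot Q)
    show "A \<oplus>\<^bsub>?Q\<^esub> B = B \<oplus>\<^bsub>?Q\<^esub> A" using x y M.a_comm[of x y] by (simp add: add_quot)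
    show "a \<odot>\<^bsub>?Q\<^esub> (A \<oplus>\<^bsub>?Q\<^esub> B) = a \<odot>\<^bsub>?Q\<^esub> A \<oplus>\<^bsub>?Q\<^esub> a \<odot>\<^bsub>?Q\<^esub> B"
      using x y M.smult_r_distr[of a x y] by (simp add: smult_quot add_quot)
    assume "C \<in> carrier ?Q"
    then obtain z where z: "z \<in> carrier M" "C = cls z" using rep by auto
    show "A \<oplus>\<^bsub>?Q\<^esub> B \<oplus>\<^bsub>?Q\<^esub> C = A \<oplus>\<^bsub>?Q\<^esub> (B \<oplus>\<^bsub>?Q\<^esub> C)"
      using x y z M.a_assoc[of x y z] by (simp add: add_quot)
  qed (auto simp: zero_quot Q)
qed

lemma diff_quot:
  assumes "x \<in> carrier M" "y \<in> carrier M"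
  shows "cls x \<ominus>\<^bsub>quot_space M N\<^esub> cls y = cls (x \<ominus>\<^bsub>M\<^esub> y)"
proof -
  have "\<ominus>\<^bsub>quot_space M N\<^esub> cls y = cls (\<ominus>\<^bsub>M\<^esub> y)"
    using assms by (simp add: smult_minus_one[OF module_quot] smult_minus_one[OF mod] carrier_quot smult_quot)
  then show ?thesis using assms by (simp add: a_minus_def add_quot)
qed

end

lemma submodule_Inter:
  assumes "module (scalars :: 'k::field ring) M" "\<S> \<noteq> {}" "\<And>N. N \<in> \<S> \<Longrightarrow> submodule N (scalars :: 'k ring) M"
  shows "submodule (\<Inter>\<S>) (scalars :: 'k ring) M"
  using assms(2,3) unfolding submodule_iff[OF assms(1)] by (auto simp: subset_iff)

section \<open>Generated submodules and ideals\<close>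

context symmetric_operad
begin

lemma sym_submodule_iff:
  "sym_submodule P n N \<longleftrightarrow>
    N \<subseteq> ops P n \<and> \<zero>\<^bsub>space P n\<^esub> \<in> N \<and> (\<forall>x\<in>N. \<forall>y\<in>N. x \<oplus>\<^bsub>space P n\<^esub> y \<in> N) \<and>
    (\<forall>c. \<forall>x\<in>N. c \<odot>\<^bsub>space P n\<^esub> x \<in> N) \<and> (\<forall>\<sigma>. \<forall>x\<in>N. \<sigma> permutes {..<n} \<longrightarrow> act P n \<sigma> x \<in> N)"
  unfolding sym_submodule_def submodule_iff[OF vector_space] by blast

lemma sym_submodule_ops: "sym_submodule P n (ops P n)"
  unfolding sym_submodule_def using module.carrier_is_submodule[OF vector_space] act_closed by blast

lemma operad_ideal_ops: "operad_ideal P (ops P)"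
  unfolding operad_ideal_def using sym_submodule_ops pcomp_closed by blast

lemma sym_submodule_Inter:
  assumes "\<S> \<noteq> {}" "\<And>N. N \<in> \<S> \<Longrightarrow> sym_submodule P n N"
  shows "sym_submodule P n (\<Inter>\<S>)"
  using assms submodule_Inter[OF vector_space, of \<S> n] unfolding sym_submodule_def by blast

lemma sym_submodule_span: "X \<subseteq> ops P n \<Longrightarrow> sym_submodule P n (sym_span P n X)"
  unfolding sym_span_def using sym_submodule_ops by (intro sym_submodule_Inter) auto

lemma sym_span_least: "sym_submodule P n N \<Longrightarrow> X \<subseteq> N \<Longrightarrow> sym_span P n X \<subseteq> N"
  unfolding sym_span_def by auto

lemma sym_span_superset: "X \<subseteq> sym_span P n X"
  unfolding sym_span_def by auto

text \<open>An intersection of ideals is an ideal. The whole operad belongs to the family, so the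
  family is nonempty and its intersection consists of operations.\<close>

lemma ideal_gen_ideal:
  assumes "X \<subseteq> ops P k"
  shows "operad_ideal P (ideal_gen P k X)"
  unfolding operad_ideal_def
proof (intro conjI allI impI)
  fix n
  have "sym_submodule P n (\<Inter>{I n |I. operad_ideal P I \<and> X \<subseteq> I k})"
    using operad_ideal_ops assms by (intro sym_submodule_Inter) (auto simp: operad_ideal_def)
  then show "sym_submodule P n (ideal_gen P k X n)" by (simp add: ideal_gen_def)
next
  fix m n i \<mu> \<nu>
  assume *: "i < m \<and> \<mu> \<in> ops P m \<and> \<nu> \<in> ops P n \<and> (\<mu> \<in> ideal_gen P k X m \<or> \<nu> \<in> ideal_gen P k X n)"
  have "pcomp P m n i \<mu> \<nu> \<in> I (m + n - 1)" if I: "operad_ideal P I" "X \<subseteq> I k" for I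
  proof -
    have "\<mu> \<in> I m \<or> \<nu> \<in> I n" using * I by (auto simp: ideal_gen_def)
    then show ?thesis using * I(1) unfolding operad_ideal_def by blast
  qed
  then show "pcomp P m n i \<mu> \<nu> \<in> ideal_gen P k X (m + n - 1)"
    by (auto simp: ideal_gen_def)
qed

lemma ideal_gen_least:
  "operad_ideal P I \<Longrightarrow> X \<subseteq> I k \<Longrightarrow> ideal_gen P k X n \<subseteq> I n"
  by (auto simp: ideal_gen_def)

lemma ideal_gen_superset: "X \<subseteq> ideal_gen P k X k"
  by (auto simp: ideal_gen_def)

end

section \<open>Quotient operads\<close>

locale operad_quotient = symmetric_operad P
  for P :: "('k::field, 'a) operad" +
  fixes I :: "nat \<Rightarrow> 'a set"
  assumes ideal: "operad_ideal P I"
begin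

sublocale quot: subspace_quotient "space P n" "I n" for n
  using vector_space ideal
  by (intro subspace_quotient.intro) (auto simp: operad_ideal_def sym_submodule_def)

abbreviation cls :: "nat \<Rightarrow> 'a \<Rightarrow> 'a set" where
  "cls n x \<equiv> I n +>\<^bsub>space P n\<^esub> x"

lemma ideal_act: "\<sigma> permutes {..<n} \<Longrightarrow> x \<in> I n \<Longrightarrow> act P n \<sigma> x \<in> I n"
  using ideal by (auto simp: operad_ideal_def sym_submodule_def)

lemma ideal_pcomp_left:
  "\<lbrakk>i < m; \<mu> \<in> I m; \<nu> \<in> ops P n\<rbrakk> \<Longrightarrow> pcomp P m n i \<mu> \<nu> \<in> I (m + n - 1)"
  using ideal quot.sub_simps(4) by (auto simp: operad_ideal_def)

lemma ideal_pcomp_right: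
  "\<lbrakk>i < m; \<mu> \<in> ops P m; \<nu> \<in> I n\<rbrakk> \<Longrightarrow> pcomp P m n i \<mu> \<nu> \<in> I (m + n - 1)"
  using ideal quot.sub_simps(4) by (auto simp: operad_ideal_def)

lemma space_quot: "space (quot_operad P I) n = quot_space (space P n) (I n)"
  by (simp add: quot_operad_def)

lemma ops_quot: "ops (quot_operad P I) n = cls n ` ops P n"
  by (simp add: space_quot quot.carrier_quot)

lemma unit_quot: "unit (quot_operad P I) = cls 1 (unit P)"
  by (simp add: quot_operad_def)

text \<open>Representatives are changed one argument at a time: first \<open>\<nu>\<close> with an
  arbitrary \<open>\<mu>'\<close> fixed, then \<open>\<mu>\<close> with \<open>\<nu>\<close> fixed.
  Each change adds an element of the ideal to the composite.\<close>

lemma pcomp_quot: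
  assumes i: "i < m" and \<mu>: "\<mu> \<in> ops P m" and \<nu>: "\<nu> \<in> ops P n"
  shows "pcomp (quot_operad P I) m n i (cls m \<mu>) (cls n \<nu>) = cls (m + n - 1) (pcomp P m n i \<mu> \<nu>)"
proof -
  have 1: "cls (m + n - 1) (pcomp P m n i \<mu>' \<nu>') = cls (m + n - 1) (pcomp P m n i \<mu>' \<nu>)"
    if \<nu>': "\<nu>' \<in> cls n \<nu>" and \<mu>': "\<mu>' \<in> ops P m" for \<mu>' \<nu>'
  proof -
    obtain z where z: "z \<in> I n" "\<nu>' = z \<oplus>\<^bsub>space P n\<^esub> \<nu>" using \<nu>' by (auto simp: quot.mem_cls_iff)
    show ?thesis
      unfolding z(2) pcomp_add_right[OF i \<mu>' quot.sub_simps(4)[OF z(1)] \<nu>]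
      by (intro quot.cls_eqI pcomp_closed ideal_pcomp_right i \<nu> \<mu>' z)
  qed
  have 2: "cls (m + n - 1) (pcomp P m n i \<mu>' \<nu>) = cls (m + n - 1) (pcomp P m n i \<mu> \<nu>)"
    if \<mu>': "\<mu>' \<in> cls m \<mu>" for \<mu>'
  proof -
    obtain z where z: "z \<in> I m" "\<mu>' = z \<oplus>\<^bsub>space P m\<^esub> \<mu>" using \<mu>' by (auto simp: quot.mem_cls_iff)
    show ?thesis
      unfolding z(2) pcomp_add_left[OF i quot.sub_simps(4)[OF z(1)] \<mu> \<nu>]
      by (intro quot.cls_eqI pcomp_closed ideal_pcomp_left i \<mu> \<nu> z)
  qed
  have "(\<Union>\<nu>'\<in>cls n \<nu>. cls (m + n - 1) (pcomp P m n i \<mu>' \<nu>')) = cls (m + n - 1) (pcomp P m n i \<mu> \<nu>)"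
    if "\<mu>' \<in> cls m \<mu>" for \<mu>'
  proof -
    have "(\<Union>\<nu>'\<in>cls n \<nu>. cls (m + n - 1) (pcomp P m n i \<mu>' \<nu>')) = cls (m + n - 1) (pcomp P m n i \<mu>' \<nu>)"
      by (rule quot.UN_cls[OF \<nu>]) (rule 1[OF _ quot.cls_member(1)[OF that \<mu>]])
    then show ?thesis using 2[OF that] by (rule trans)
  qed
  then have "(\<Union>\<mu>'\<in>cls m \<mu>. \<Union>\<nu>'\<in>cls n \<nu>. cls (m + n - 1) (pcomp P m n i \<mu>' \<nu>')) =
      cls (m + n - 1) (pcomp P m n i \<mu> \<nu>)"
    using quot.cls_self[OF \<mu>] by blast
  then show ?thesis by (simp add: quot_operad_def)
qed

lemma act_quot:
  assumes \<sigma>: "\<sigma> permutes {..<n}" and \<mu>: "\<mu> \<in> ops P n"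
  shows "act (quot_operad P I) n \<sigma> (cls n \<mu>) = cls n (act P n \<sigma> \<mu>)"
proof -
  have "cls n (act P n \<sigma> \<mu>') = cls n (act P n \<sigma> \<mu>)" if \<mu>': "\<mu>' \<in> cls n \<mu>" for \<mu>'
  proof -
    obtain z where z: "z \<in> I n" "\<mu>' = z \<oplus>\<^bsub>space P n\<^esub> \<mu>" using \<mu>' by (auto simp: quot.mem_cls_iff)
    show ?thesis
      unfolding z(2) act_add[OF \<sigma> quot.sub_simps(4)[OF z(1)] \<mu>]
      by (intro quot.cls_eqI act_closed ideal_act \<sigma> \<mu> z)
  qed
  then have "(\<Union>\<mu>'\<in>cls n \<mu>. cls n (act P n \<sigma> \<mu>')) = cls n (act P n \<sigma> \<mu>)" by (rule quot.UN_cls[OF \<mu>])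
  then show ?thesis by (simp add: quot_operad_def)
qed

lemma symmetric_quot: "symmetric_operad (quot_operad P I)"
proof (rule symmetric_operad.intro)
  let ?Q = "quot_operad P I"
  have rep: "\<exists>x\<in>ops P n. A = cls n x" if "A \<in> ops ?Q n" for A n
    using that by (auto simp: ops_quot)
  have Q: "cls n x \<in> ops ?Q n" if "x \<in> ops P n" for x n
    using that by (auto simp: ops_quot)
  fix n
  show "module scalars (space ?Q n)" by (simp add: space_quot quot.module_quot)
  show "unit ?Q \<in> ops ?Q 1" using Q[OF unit_closed] by (simp add: unit_quot)
  fix C assume "C \<in> ops ?Q n"
  then obtain z where z: "z \<in> ops P n" "C = cls n z" using rep by blast
  show "act ?Q n id C = C" using z permutes_id[of "{..<n}"] by (simp add: act_quot act_id)
  show "pcomp ?Q 1 n 0 (unit ?Q) C = C"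
    using z pcomp_quot[of 0 1 "unit P" z n] unit_closed by (simp add: unit_quot unit_left[unfolded One_nat_def])
  show "pcomp ?Q n 1 i C (unit ?Q) = C" if "i < n" for i
    using z that pcomp_quot[of i n z "unit P" 1] unit_closed by (simp add: unit_quot unit_right[unfolded One_nat_def])
  show "act ?Q n \<sigma> C \<in> ops ?Q n" if "\<sigma> permutes {..<n}" for \<sigma>
    using that z by (simp add: act_quot Q act_closed)
  show "act ?Q n (\<sigma> \<circ> \<tau>) C = act ?Q n \<tau> (act ?Q n \<sigma> C)"
    if "\<sigma> permutes {..<n}" "\<tau> permutes {..<n}" for \<sigma> \<tau>
    using that z act_comp[of \<sigma> n \<tau> z] permutes_compose[OF that(2,1)] by (simp add: act_quot act_closed)
  show "act ?Q n \<sigma> (c \<odot>\<^bsub>space ?Q n\<^esub> C) = c \<odot>\<^bsub>space ?Q n\<^esub> act ?Q n \<sigma> C"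
    if "\<sigma> permutes {..<n}" for \<sigma> c
    using that z act_smult[of \<sigma> n z c]
    by (simp add: space_quot act_quot act_closed quot.smult_quot quot.M.smult_closed)
  fix m B i assume B: "B \<in> ops ?Q m"
  then obtain y where y: "y \<in> ops P m" "B = cls m y" using rep by blast
  show "act ?Q n \<sigma> (C \<oplus>\<^bsub>space ?Q n\<^esub> C') = act ?Q n \<sigma> C \<oplus>\<^bsub>space ?Q n\<^esub> act ?Q n \<sigma> C'"
    if \<sigma>: "\<sigma> permutes {..<n}" and C': "C' \<in> ops ?Q n" for \<sigma> C'
  proof -
    obtain z' where z': "z' \<in> ops P n" "C' = cls n z'" using rep[OF C'] by blast
    show ?thesis using \<sigma> z z' act_add[of \<sigma> n z z']
      by (simp add: space_quot act_quot act_closed quot.add_quot)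
  qed
  show "pcomp ?Q m n i B (C \<oplus>\<^bsub>space ?Q n\<^esub> C') =
        pcomp ?Q m n i B C \<oplus>\<^bsub>space ?Q (m + n - 1)\<^esub> pcomp ?Q m n i B C'"
    if i: "i < m" and C': "C' \<in> ops ?Q n" for i C'
  proof -
    obtain z' where z': "z' \<in> ops P n" "C' = cls n z'" using rep[OF C'] by blast
    show ?thesis using i y z z' pcomp_add_right[of i m y z n z'] pcomp_closed[OF i y(1) z(1)]
        pcomp_closed[OF i y(1) z'(1)]
      by (simp add: space_quot pcomp_quot quot.add_quot)
  qed
  show "pcomp ?Q m n i (B \<oplus>\<^bsub>space ?Q m\<^esub> B') C =
        pcomp ?Q m n i B C \<oplus>\<^bsub>space ?Q (m + n - 1)\<^esub> pcomp ?Q m n i B' C"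
    if i: "i < m" and B': "B' \<in> ops ?Q m" for i B'
  proof -
    obtain y' where y': "y' \<in> ops P m" "B' = cls m y'" using rep[OF B'] by blast
    show ?thesis using i z y y' pcomp_add_left[of i m y y' z n] pcomp_closed[OF i y(1) z(1)]
        pcomp_closed[OF i y'(1) z(1)]
      by (simp add: space_quot pcomp_quot quot.add_quot)
  qed
  show "pcomp ?Q m n i B C \<in> ops ?Q (m + n - 1)" if "i < m" for i
    using that y z Q[OF pcomp_closed[OF that y(1) z(1)]] by (simp add: pcomp_quot)
  show "pcomp ?Q m n i (c \<odot>\<^bsub>space ?Q m\<^esub> B) C = c \<odot>\<^bsub>space ?Q (m + n - 1)\<^esub> pcomp ?Q m n i B C"
    if i: "i < m" for i c
    using i y z pcomp_smult_left[of i m y z n c] pcomp_closed[OF i y(1) z(1)]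
    by (simp add: space_quot pcomp_quot quot.smult_quot quot.M.smult_closed)
  show "pcomp ?Q m n i B (c \<odot>\<^bsub>space ?Q n\<^esub> C) = c \<odot>\<^bsub>space ?Q (m + n - 1)\<^esub> pcomp ?Q m n i B C"
    if i: "i < m" for i c
    using i y z pcomp_smult_right[of i m y z n c] pcomp_closed[OF i y(1) z(1)]
    by (simp add: space_quot pcomp_quot quot.smult_quot quot.M.smult_closed)
  show "pcomp ?Q m n i (act ?Q m \<sigma> B) (act ?Q n \<tau> C) =
       act ?Q (m + n - 1) (perm_comp m n i \<sigma> \<tau>) (pcomp ?Q m n (\<sigma> i) B C)"
    if i: "i < m" and \<sigma>: "\<sigma> permutes {..<m}" and \<tau>: "\<tau> permutes {..<n}" for i \<sigma> \<tau>
  proof -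
    have "\<sigma> i < m" using permutes_in_image[OF \<sigma>, of i] i by simp
    then show ?thesis
      using i \<sigma> \<tau> y z equivariance[OF i \<sigma> \<tau> y(1) z(1)] perm_comp_permutes[OF i \<sigma> \<tau>]
        pcomp_closed[OF _ y(1) z(1), of "\<sigma> i"]
      by (simp add: act_quot pcomp_quot act_closed)
  qed
  fix l A i assume A: "A \<in> ops ?Q l"
  then obtain x where x: "x \<in> ops P l" "A = cls l x" using rep by blast
  show "pcomp ?Q (l + m - 1) n (i + j) (pcomp ?Q l m i A B) C =
       pcomp ?Q l (m + n - 1) i A (pcomp ?Q m n j B C)"
    if ij: "i < l" "j < m" for i j
  proof -
    \<comment> \<open>Both sides live in the same space only after arithmetic with truncated
      subtraction, which the bounds on \<open>i\<close> and \<open>j\<close> justify.\<close>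
    have eq: "l + m - 1 + n - 1 = l + (m + n - 1) - 1" "i + j < l + m - 1" using ij by linarith+
    show ?thesis
      using pcomp_quot[OF eq(2) pcomp_closed[OF ij(1) x(1) y(1)] z(1)]
        pcomp_quot[OF ij(1) x(1) pcomp_closed[OF ij(2) y(1) z(1)]]
        sequential[OF ij x(1) y(1) z(1)]
      unfolding x(2) y(2) z(2) eq(1) pcomp_quot[OF ij(1) x(1) y(1)] pcomp_quot[OF ij(2) y(1) z(1)]
      by simp
  qed
  show "pcomp ?Q (l + m - 1) n (k + m - 1) (pcomp ?Q l m i A B) C =
       pcomp ?Q (l + n - 1) m i (pcomp ?Q l n k A C) B"
    if ik: "i < k" "k < l" for i k
  proof -
    have i: "i < l" "k + m - 1 < l + m - 1" "i < l + n - 1" using ik by linarith+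
    have eq: "l + m - 1 + n - 1 = l + n - 1 + m - 1" using ik by linarith
    show ?thesis
      using pcomp_quot[OF i(2) pcomp_closed[OF i(1) x(1) y(1)] z(1)]
        pcomp_quot[OF i(3) pcomp_closed[OF ik(2) x(1) z(1)] y(1)]
        parallel[OF ik x(1) y(1) z(1)]
      unfolding x(2) y(2) z(2) eq pcomp_quot[OF i(1) x(1) y(1)] pcomp_quot[OF ik(2) x(1) z(1)]
      by simp
  qed
qed

end

section \<open>Isomorphisms of operads\<close>

locale operad_iso = operad_hom P Q f
  for P :: "('k::field, 'a) operad" and Q :: "('k, 'b) operad" and f +
  assumes bij: "bij_betw (f n) (ops P n) (ops Q n)"
begin

lemma hom_zero: "f n \<zero>\<^bsub>space P n\<^esub> = \<zero>\<^bsub>space Q n\<^esub>"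
proof -
  interpret M: module scalars "space P n" by (rule P.vector_space)
  interpret N: module scalars "space Q n" by (rule Q.vector_space)
  have "f n \<zero>\<^bsub>space P n\<^esub> = f n (0 \<odot>\<^bsub>space P n\<^esub> \<zero>\<^bsub>space P n\<^esub>)"
    using M.smult_r_null[of 0] by simp
  also have "\<dots> = 0 \<odot>\<^bsub>space Q n\<^esub> f n \<zero>\<^bsub>space P n\<^esub>" by (rule hom_smult) simp
  also have "\<dots> = \<zero>\<^bsub>space Q n\<^esub>" using N.smult_l_null hom_closed[OF M.zero_closed] by simp
  finally show ?thesis .
qed

lemma image_ops: "f n ` ops P n = ops Q n"
  using bij by (simp add: bij_betw_def)

lemma sym_submodule_image:
  assumes N: "sym_submodule P n N" shows "sym_submodule Q n (f n ` N)"
proof -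
  note N = N[unfolded P.sym_submodule_iff]
  have sub: "x \<in> ops P n" if "x \<in> N" for x using that N by auto
  show ?thesis
    unfolding Q.sym_submodule_iff
  proof (intro conjI ballI allI impI)
    show "f n ` N \<subseteq> ops Q n" using sub hom_closed by auto
    show "\<zero>\<^bsub>space Q n\<^esub> \<in> f n ` N" using N hom_zero by (metis imageI)
  next
    fix a b assume "a \<in> f n ` N" "b \<in> f n ` N"
    then obtain x y where "x \<in> N" "a = f n x" "y \<in> N" "b = f n y" by auto
    then show "a \<oplus>\<^bsub>space Q n\<^esub> b \<in> f n ` N" using N sub hom_add by (metis imageI)
  next
    fix c a assume "a \<in> f n ` N"
    then obtain x where "x \<in> N" "a = f n x" by auto
    then show "c \<odot>\<^bsub>space Q n\<^esub> a \<in> f n ` N" using N sub hom_smult by (metis imageI)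
  next
    fix \<sigma> a assume "a \<in> f n ` N" and \<sigma>: "\<sigma> permutes {..<n}"
    then obtain x where "x \<in> N" "a = f n x" by auto
    then show "act Q n \<sigma> a \<in> f n ` N" using N sub hom_act[OF \<sigma>] \<sigma> by (metis imageI)
  qed
qed

lemma operad_ideal_image:
  assumes I: "operad_ideal P I" shows "operad_ideal Q (\<lambda>n. f n ` I n)"
  unfolding operad_ideal_def
proof (intro conjI allI impI)
  fix n show "sym_submodule Q n (f n ` I n)"
    using I sym_submodule_image by (simp add: operad_ideal_def)
next
  have sub: "x \<in> ops P n" if "x \<in> I n" for x n
    using that I by (auto simp: operad_ideal_def P.sym_submodule_iff)
  fix m n i \<mu> \<nu>
  assume *: "i < m \<and> \<mu> \<in> ops Q m \<and> \<nu> \<in> ops Q n \<and> (\<mu> \<in> f m ` I m \<or> \<nu> \<in> f n ` I n)"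
  then obtain x y where xy: "x \<in> ops P m" "\<mu> = f m x" "y \<in> ops P n" "\<nu> = f n y" "x \<in> I m \<or> y \<in> I n"
    using sub unfolding image_ops[symmetric] by blast
  then have "pcomp P m n i x y \<in> I (m + n - 1)"
    using I * unfolding operad_ideal_def by blast
  then show "pcomp Q m n i \<mu> \<nu> \<in> f (m + n - 1) ` I (m + n - 1)"
    using xy * hom_pcomp[of i m x y n] by (metis imageI)
qed

lemma inverse: "operad_iso Q P (\<lambda>n. inv_into (ops P n) (f n))"
proof -
  let ?g = "\<lambda>n. inv_into (ops P n) (f n)"
  have g: "?g n x \<in> ops P n" "f n (?g n x) = x" if "x \<in> ops Q n" for n x
    using that image_ops[of n] by (auto intro: inv_into_into f_inv_into_f)
  have eqI: "?g n x = y" if "y \<in> ops P n" "f n y = x" for n x y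
    using that bij[of n] by (auto simp: bij_betw_def inv_into_f_f)
  interpret MP: module scalars "space P n" for n by (rule P.vector_space)
  show ?thesis
  proof (intro operad_iso.intro operad_hom.intro operad_hom_axioms.intro operad_iso_axioms.intro
      P.symmetric_operad_axioms Q.symmetric_operad_axioms)
    show "bij_betw (?g n) (ops Q n) (ops P n)" for n using bij by (rule bij_betw_inv_into)
    show "?g 1 (unit Q) = unit P" by (intro eqI P.unit_closed hom_unit)
    show "?g n x \<in> ops P n" if "x \<in> ops Q n" for n x using that by (rule g)
    show "?g n (x \<oplus>\<^bsub>space Q n\<^esub> y) = ?g n x \<oplus>\<^bsub>space P n\<^esub> ?g n y"
      if "x \<in> ops Q n" "y \<in> ops Q n" for n x y
      using that by (intro eqI) (simp_all add: g hom_add)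
    show "?g n (c \<odot>\<^bsub>space Q n\<^esub> x) = c \<odot>\<^bsub>space P n\<^esub> ?g n x" if "x \<in> ops Q n" for n c x
      using that by (intro eqI) (simp_all add: g hom_smult MP.smult_closed)
    show "?g n (act Q n \<sigma> x) = act P n \<sigma> (?g n x)" if "\<sigma> permutes {..<n}" "x \<in> ops Q n" for n \<sigma> x
      using that by (intro eqI) (simp_all add: g hom_act P.act_closed)
    show "?g (m + n - 1) (pcomp Q m n i x y) = pcomp P m n i (?g m x) (?g n y)"
      if "i < m" "x \<in> ops Q m" "y \<in> ops Q n" for m n i x y
      using that P.pcomp_closed[of i m "?g m x" "?g n y" n] hom_pcomp[of i m "?g m x" "?g n y" n]
      by (intro eqI) (simp_all add: g)
  qed
qed

lemma inv_image: "X \<subseteq> ops P n \<Longrightarrow> inv_into (ops P n) (f n) ` (f n ` X) = X"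
  using bij[of n] by (intro inv_into_image_cancel) (auto simp: bij_betw_def)

lemma image_inv: "Y \<subseteq> ops Q n \<Longrightarrow> f n ` (inv_into (ops P n) (f n) ` Y) = Y"
  using image_ops by (intro image_inv_into_cancel) auto

text \<open>The image of an ideal containing \<open>X\<close> is an ideal containing the image of
  \<open>X\<close>, so minimality gives one inclusion; the inverse isomorphism gives the
  other.\<close>

lemma ideal_gen_image:
  assumes X: "X \<subseteq> ops P k"
  shows "f n ` ideal_gen P k X n = ideal_gen Q k (f k ` X) n"
proof
  interpret inv: operad_iso Q P "\<lambda>n. inv_into (ops P n) (f n)" by (rule inverse)
  have fX: "f k ` X \<subseteq> ops Q k" using X hom_closed by auto
  note I = P.ideal_gen_ideal[OF X] note J = Q.ideal_gen_ideal[OF fX]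
  have sub: "ideal_gen P k X n \<subseteq> ops P n" "ideal_gen Q k (f k ` X) n \<subseteq> ops Q n"
    using I J by (auto simp: operad_ideal_def P.sym_submodule_iff Q.sym_submodule_iff)
  show "ideal_gen Q k (f k ` X) n \<subseteq> f n ` ideal_gen P k X n"
    by (rule Q.ideal_gen_least[OF operad_ideal_image[OF I]])
       (intro image_mono P.ideal_gen_superset)
  have "X \<subseteq> inv_into (ops P k) (f k) ` ideal_gen Q k (f k ` X) k"
    using image_mono[OF Q.ideal_gen_superset[of "f k ` X" k], of "inv_into (ops P k) (f k)"]
    by (simp add: inv_image[OF X])
  then have "ideal_gen P k X n \<subseteq> inv_into (ops P n) (f n) ` ideal_gen Q k (f k ` X) n"
    by (rule P.ideal_gen_least[OF inv.operad_ideal_image[OF J]])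
  then show "f n ` ideal_gen P k X n \<subseteq> ideal_gen Q k (f k ` X) n"
    using image_inv[OF sub(2)] by blast
qed

lemma sym_span_image:
  assumes X: "X \<subseteq> ops P n"
  shows "f n ` sym_span P n X = sym_span Q n (f n ` X)"
proof
  interpret inv: operad_iso Q P "\<lambda>n. inv_into (ops P n) (f n)" by (rule inverse)
  have fX: "f n ` X \<subseteq> ops Q n" using X hom_closed by auto
  note I = P.sym_submodule_span[OF X] note J = Q.sym_submodule_span[OF fX]
  have sub: "sym_span Q n (f n ` X) \<subseteq> ops Q n"
    using J by (auto simp: Q.sym_submodule_iff)
  show "sym_span Q n (f n ` X) \<subseteq> f n ` sym_span P n X"
    by (rule Q.sym_span_least[OF sym_submodule_image[OF I]])
       (intro image_mono P.sym_span_superset)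
  have "X \<subseteq> inv_into (ops P n) (f n) ` sym_span Q n (f n ` X)"
    using image_mono[OF Q.sym_span_superset[of "f n ` X" n], of "inv_into (ops P n) (f n)"]
    by (simp add: inv_image[OF X])
  then have "sym_span P n X \<subseteq> inv_into (ops P n) (f n) ` sym_span Q n (f n ` X)"
    by (rule P.sym_span_least[OF inv.sym_submodule_image[OF J]])
  then show "f n ` sym_span P n X \<subseteq> sym_span Q n (f n ` X)"
    using image_inv[OF sub] by blast
qed

lemma image_cls:
  assumes "operad_ideal P I" "x \<in> ops P n"
  shows "f n ` (I n +>\<^bsub>space P n\<^esub> x) = f n ` I n +>\<^bsub>space Q n\<^esub> f n x"
proof -
  interpret operad_quotient P I using assms(1) by unfold_locales
  show ?thesis using assms(2) hom_add[OF quot.sub_simps(4)]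
    by (force simp: a_r_coset_def' image_iff)
qed

text \<open>Serves for both levels of quotient, by the relations of the free operad and by the
  quadratic relations. The map on cosets takes images of sets, so no representatives are
  chosen.\<close>

lemma quot_iso:
  assumes I: "operad_ideal P I" and J: "\<And>n. f n ` I n = J n"
  shows "operad_iso (quot_operad P I) (quot_operad Q J) (\<lambda>n A. f n ` A)"
proof -
  have "J = (\<lambda>n. f n ` I n)" using J by auto
  then have "operad_ideal Q J" using operad_ideal_image[OF I] by simp
  then interpret QQ: operad_quotient Q J by unfold_locales
  interpret PQ: operad_quotient P I using I by unfold_locales
  have im: "f n ` PQ.cls n x = QQ.cls n (f n x)" if "x \<in> ops P n" for n x
    using image_cls[OF I that] by (simp add: J)
  show ?thesis
  proof (intro operad_iso.intro operad_hom.intro operad_hom_axioms.intro operad_iso_axioms.intro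
      PQ.symmetric_quot QQ.symmetric_quot)
    fix n
    show "f 1 ` unit (quot_operad P I) = unit (quot_operad Q J)"
      using im[OF P.unit_closed] by (simp add: PQ.unit_quot QQ.unit_quot hom_unit[unfolded One_nat_def])
    \<comment> \<open>Taking images is injective on the cosets because all of them lie in the domain
      on which \<open>f n\<close> is injective.\<close>
    have "\<Union> (ops (quot_operad P I) n) \<subseteq> ops P n"
      using PQ.quot.cls_member(1) by (auto simp: PQ.ops_quot)
    then have "inj_on (\<lambda>A. f n ` A) (ops (quot_operad P I) n)"
      using bij[of n] by (intro inj_on_image) (auto simp: bij_betw_def intro: inj_on_subset)
    moreover have "(\<lambda>A. f n ` A) ` ops (quot_operad P I) n = ops (quot_operad Q J) n"
      using im by (force simp: PQ.ops_quot QQ.ops_quot image_ops[symmetric] image_iff)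
    ultimately show "bij_betw (\<lambda>A. f n ` A) (ops (quot_operad P I) n) (ops (quot_operad Q J) n)"
      by (simp add: bij_betw_def)
    fix A assume "A \<in> ops (quot_operad P I) n"
    then obtain x where x: "x \<in> ops P n" "A = PQ.cls n x" by (auto simp: PQ.ops_quot)
    show "f n ` A \<in> ops (quot_operad Q J) n" using x by (auto simp: im QQ.ops_quot hom_closed)
    show "f n ` (c \<odot>\<^bsub>space (quot_operad P I) n\<^esub> A) = c \<odot>\<^bsub>space (quot_operad Q J) n\<^esub> f n ` A" for c
      using x hom_smult[OF x(1)]
      by (simp add: PQ.space_quot QQ.space_quot PQ.quot.smult_quot QQ.quot.smult_quot im hom_closed)
    show "f n ` act (quot_operad P I) n \<sigma> A = act (quot_operad Q J) n \<sigma> (f n ` A)"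
      if "\<sigma> permutes {..<n}" for \<sigma>
      using x that hom_act[OF that x(1)]
      by (simp add: PQ.act_quot QQ.act_quot im hom_closed P.act_closed)
    fix m B assume "B \<in> ops (quot_operad P I) m"
    then obtain y where y: "y \<in> ops P m" "B = PQ.cls m y" by (auto simp: PQ.ops_quot)
    show "f (n + m - 1) ` pcomp (quot_operad P I) n m i A B =
        pcomp (quot_operad Q J) n m i (f n ` A) (f m ` B)" if "i < n" for i
      using that x y hom_pcomp[OF that x(1) y(1)] im[OF P.pcomp_closed[OF that x(1) y(1)]]
      by (simp add: PQ.pcomp_quot QQ.pcomp_quot im hom_closed)
  next
    fix n A B assume "A \<in> ops (quot_operad P I) n" "B \<in> ops (quot_operad P I) n"
    then obtain x y where "x \<in> ops P n" "A = PQ.cls n x" "y \<in> ops P n" "B = PQ.cls n y"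
      by (auto simp: PQ.ops_quot)
    then show "f n ` (A \<oplus>\<^bsub>space (quot_operad P I) n\<^esub> B) =
        f n ` A \<oplus>\<^bsub>space (quot_operad Q J) n\<^esub> f n ` B"
      using hom_add[of x n y]
      by (simp add: PQ.space_quot QQ.space_quot PQ.quot.add_quot QQ.quot.add_quot im hom_closed)
  qed
qed

end

lemma operad_iso_isomorphic: "operad_iso P Q f \<Longrightarrow> P \<cong>\<^sub>o\<^sub>p Q"
  by (auto simp: operad_isomorphic_def operad_iso_def operad_iso_axioms_def)


section \<open>Free operads and changes of generators\<close>

definition tree_map :: "('v \<Rightarrow> 'w) \<Rightarrow> (('v, nat) btree \<Rightarrow> 'k::field) \<Rightarrow> ('w, nat) btree \<Rightarrow> 'k" where
  "tree_map g = lin (\<lambda>t. basis (map_btree g id t))"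

lemma tree_map_basis [simp]: "tree_map g (basis t) = basis (map_btree g id t)"
  by (simp add: tree_map_def)

lemma tree_map_diff:
  "fin x \<Longrightarrow> fin y \<Longrightarrow> tree_map g (\<lambda>t. x t - y t) = (\<lambda>t. tree_map g x t - tree_map g y t)"
  by (simp add: tree_map_def lin_diff)

lemma tree_map_smult: "tree_map g (\<lambda>t. c * x t) = (\<lambda>t. c * tree_map g x t)"
  by (simp add: tree_map_def lin_smult)

lemma tree_map_trees:
  assumes "\<And>v. v \<in> S \<Longrightarrow> g v \<in> S'" "t \<in> trees S n"
  shows "map_btree g id t \<in> trees S' n"
  using assms by (auto simp: trees_def btree.set_map)

lemma tree_map_tree_ops:
  assumes "\<And>v. v \<in> S \<Longrightarrow> g v \<in> S'" "x \<in> tree_ops S n"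
  shows "tree_map g x \<in> tree_ops S' n"
  unfolding tree_map_def
  using tree_opsD[OF assms(2)] by (intro lin_tree_ops basis_tree_ops tree_map_trees[OF assms(1)]) auto

lemma tree_map_inverse:
  assumes "\<And>v. v \<in> S \<Longrightarrow> h (g v) = v" "x \<in> tree_ops S n"
  shows "tree_map h (tree_map g x) = x"
proof -
  have "map_btree h id (map_btree g id t) = t" if "t \<in> trees S n" for t
  proof -
    have "map_btree (h \<circ> g) id t = map_btree id id t"
      using treesD(1)[OF that] assms(1) by (intro btree.map_cong0) auto
    then show ?thesis by (simp add: btree.map_comp btree.map_id)
  qed
  then have "lin (\<lambda>t. basis (map_btree h id (map_btree g id t))) x = lin basis x"
    using tree_opsD[OF assms(2)] by (intro lin_cong) auto
  then show ?thesis
    using tree_opsD(1)[OF assms(2)] by (simp add: tree_map_def lin_lin)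
qed

lemma tree_operad_iso:
  assumes g: "bij_betw g S S'"
  shows "operad_iso (tree_operad S :: ('k::field, _) operad) (tree_operad S') (\<lambda>n. tree_map g)"
proof (intro operad_iso.intro operad_hom.intro operad_hom_axioms.intro operad_iso_axioms.intro
    tree_operad_symmetric)
  let ?T = "tree_operad S :: ('k, _) operad" and ?T' = "tree_operad S' :: ('k, _) operad"
  let ?h = "inv_into S g"
  have gS: "g v \<in> S'" if "v \<in> S" for v using g that by (auto simp: bij_betw_def)
  have hS: "?h v \<in> S" if "v \<in> S'" for v using g that by (auto simp: bij_betw_def inv_into_into)
  have hg: "?h (g v) = v" if "v \<in> S" for v using g that by (simp add: bij_betw_inv_into_left)
  have gh: "g (?h v) = v" if "v \<in> S'" for v using g that by (simp add: bij_betw_inv_into_right)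
  fix n
  have "bij_betw (tree_map g) (tree_ops S n :: (_ \<Rightarrow> 'k) set) (tree_ops S' n)"
    using tree_map_inverse[of S ?h g, OF hg] tree_map_inverse[of S' g ?h, OF gh]
      tree_map_tree_ops[of S g S', OF gS] tree_map_tree_ops[of S' ?h S, OF hS]
    by (intro bij_betw_byWitness[where f' = "tree_map ?h"]) auto
  then show "bij_betw (tree_map g) (ops ?T n) (ops ?T' n)" by simp
  show "tree_map g (unit ?T) = unit ?T'" by simp
  fix x assume x: "x \<in> ops ?T n"
  then have fx: "fin x" by (simp add: tree_opsD)
  show "tree_map g x \<in> ops ?T' n" using x gS tree_map_tree_ops[of S g S' x n] by simp
  show "tree_map g (c \<odot>\<^bsub>space ?T n\<^esub> x) = c \<odot>\<^bsub>space ?T' n\<^esub> tree_map g x" for c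
    by (simp add: tree_map_smult)
  show "tree_map g (x \<oplus>\<^bsub>space ?T n\<^esub> y) = tree_map g x \<oplus>\<^bsub>space ?T' n\<^esub> tree_map g y"
    if "y \<in> ops ?T n" for y
    using fx that by (simp add: tree_map_def lin_add tree_opsD)
  show "tree_map g (act ?T n \<sigma> x) = act ?T' n \<sigma> (tree_map g x)" if \<sigma>: "\<sigma> permutes {..<n}" for \<sigma>
  proof -
    have "fin (tree_map g x)" unfolding tree_map_def using fx by (intro fin_lin) auto
    then show ?thesis
      using fx by (simp add: act_lin[OF \<sigma>] tree_map_def lin_lin btree.map_comp)
  qed
  show "tree_map g (pcomp ?T n m i x y) = pcomp ?T' n m i (tree_map g x) (tree_map g y)"
    if "y \<in> ops ?T m" for m i y
  proof -
    have fy: "fin y" using that by (simp add: tree_opsD)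
    show ?thesis
      by (simp add: pcomp_tree_operad tree_map_def lin_lin fx fy fin_lin map_btree_graft)
  qed
qed

lemma tree_ops_diff:
  assumes "x \<in> tree_ops S n" "y \<in> tree_ops S n"
  shows "(\<lambda>t. x t - y t) \<in> tree_ops S n"
proof -
  have "t \<in> trees S n" if "x t - y t \<noteq> 0" for t
    using that tree_opsD(2)[OF assms(1), of t] tree_opsD(2)[OF assms(2), of t] by (cases "x t = 0") auto
  then show ?thesis
    using fin_diff[OF tree_opsD(1)[OF assms(1)] tree_opsD(1)[OF assms(2)]] by (simp add: tree_ops_def)
qed

lemma tree_ops_smult: "x \<in> tree_ops S n \<Longrightarrow> (\<lambda>t. c * x t) \<in> tree_ops S n"
  by (simp add: tree_ops_def fin_smult)

section \<open>Modules over the symmetric group on two letters and their free operads\<close>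

locale s2_rep =
  fixes V :: "('k::field, 'v) s2_module"
  assumes add_closed: "v \<in> carrier V \<Longrightarrow> w \<in> carrier V \<Longrightarrow> v \<oplus>\<^bsub>V\<^esub> w \<in> carrier V"
    and smult_closed: "v \<in> carrier V \<Longrightarrow> c \<odot>\<^bsub>V\<^esub> v \<in> carrier V"
    and flip_closed: "v \<in> carrier V \<Longrightarrow> flip V v \<in> carrier V"
    and flip_add: "v \<in> carrier V \<Longrightarrow> w \<in> carrier V \<Longrightarrow> flip V (v \<oplus>\<^bsub>V\<^esub> w) = flip V v \<oplus>\<^bsub>V\<^esub> flip V w"
    and flip_smult: "v \<in> carrier V \<Longrightarrow> flip V (c \<odot>\<^bsub>V\<^esub> v) = c \<odot>\<^bsub>V\<^esub> flip V v"
    and flip_flip: "v \<in> carrier V \<Longrightarrow> flip V (flip V v) = v"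
begin

lemma corolla_trees: "v \<in> carrier V \<Longrightarrow> Node v (Leaf 0) (Leaf 1) \<in> trees (carrier V) 2"
  "v \<in> carrier V \<Longrightarrow> Node v (Leaf 1) (Leaf 0) \<in> trees (carrier V) 2"
  by (simp_all add: trees_def lessThan_Suc numeral_2_eq_2 insert_commute)

lemma free_relations_ops: "free_relations V \<subseteq> ops (tree_operad (carrier V)) 2"
proof -
  have "corolla v \<in> tree_ops (carrier V) 2" "basis (Node v (Leaf 1) (Leaf 0)) \<in> tree_ops (carrier V) 2"
    if "v \<in> carrier V" for v
    unfolding corolla_def by (rule basis_tree_ops corolla_trees that)+
  then show ?thesis
    unfolding free_relations_def space_tree_operad
    by (auto simp del: One_nat_def intro!: tree_ops_diff tree_ops_smult add_closed smult_closed flip_closed)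
qed

sublocale tree: symmetric_operad "tree_operad (carrier V)" by (rule tree_operad_symmetric)

sublocale free: operad_quotient "tree_operad (carrier V)" "free_ideal V"
  by (intro operad_quotient.intro operad_quotient_axioms.intro tree_operad_symmetric)
     (simp add: free_ideal_def tree.ideal_gen_ideal[OF free_relations_ops])

lemma symmetric_free: "symmetric_operad (free_operad V)"
  unfolding free_operad_def by (rule free.symmetric_quot)

end

locale s2_iso = V: s2_rep V + W: s2_rep W
  for V :: "('k::field, 'v) s2_module" and W :: "('k, 'w) s2_module" +
  fixes g :: "'v \<Rightarrow> 'w"
  assumes bij: "bij_betw g (carrier V) (carrier W)"
    and g_add: "v \<in> carrier V \<Longrightarrow> w \<in> carrier V \<Longrightarrow> g (v \<oplus>\<^bsub>V\<^esub> w) = g v \<oplus>\<^bsub>W\<^esub> g w"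
    and g_smult: "v \<in> carrier V \<Longrightarrow> g (c \<odot>\<^bsub>V\<^esub> v) = c \<odot>\<^bsub>W\<^esub> g v"
    and g_flip: "v \<in> carrier V \<Longrightarrow> g (flip V v) = flip W (g v)"
begin

lemma image_carrier: "g ` carrier V = carrier W"
  using bij by (simp add: bij_betw_def)

lemma free_relations_image: "tree_map g ` free_relations V = free_relations W"
proof -
  have 1: "tree_map g (\<lambda>t. corolla (v \<oplus>\<^bsub>V\<^esub> w) t - corolla v t - corolla w t) =
      (\<lambda>t. corolla (g v \<oplus>\<^bsub>W\<^esub> g w) t - corolla (g v) t - corolla (g w) t :: 'k)"
    if "v \<in> carrier V" "w \<in> carrier V" for v w
    using that by (simp add: corolla_def tree_map_diff tree_map_diff[OF fin_diff[OF fin_basis fin_basis] fin_basis] g_add)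
  have 2: "tree_map g (\<lambda>t. corolla (c \<odot>\<^bsub>V\<^esub> v) t - c * corolla v t) =
      (\<lambda>t. corolla (c \<odot>\<^bsub>W\<^esub> g v) t - c * corolla (g v) t :: 'k)"
    if "v \<in> carrier V" for c v
    using that by (simp add: corolla_def tree_map_diff fin_smult tree_map_smult g_smult)
  have 3: "tree_map g (\<lambda>t. corolla (flip V v) t - basis (Node v (Leaf 1) (Leaf 0)) t) =
      (\<lambda>t. corolla (flip W (g v)) t - basis (Node (g v) (Leaf 1) (Leaf 0)) t :: 'k)"
    if "v \<in> carrier V" for v
    using that by (simp add: corolla_def tree_map_diff g_flip)
  \<comment> \<open>Writing the set comprehensions as images lets parameters in
    \<open>carrier W\<close> be pulled back along \<open>g\<close>.\<close>
  have U: "{f v w | v w. v \<in> A \<and> w \<in> A} = (\<lambda>(v, w). f v w) ` (A \<times> A)"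
    "{f' c v | c v. v \<in> A} = (\<lambda>(c, v). f' c v) ` (UNIV \<times> A)"
    "{f'' v | v. v \<in> A} = f'' ` A" for f f' f'' and A
    by auto
  have P: "carrier W \<times> carrier W = map_prod g g ` (carrier V \<times> carrier V)"
    "UNIV \<times> carrier W = map_prod id g ` (UNIV \<times> carrier V)"
    by (auto simp: image_carrier[symmetric] image_iff)
  show ?thesis
    unfolding free_relations_def image_Un U P image_image
    unfolding image_carrier[symmetric] image_image
    by (intro arg_cong2[where f = "(\<union>)"] image_cong refl) (auto simp: 1 2 3 simp del: One_nat_def)
qed

lemma tree_iso: "operad_iso (tree_operad (carrier V) :: ('k, _) operad) (tree_operad (carrier W)) (\<lambda>n. tree_map g)"
  by (rule tree_operad_iso[OF bij])

lemma free_ideal_image: "tree_map g ` free_ideal V n = free_ideal W n"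
  using operad_iso.ideal_gen_image[OF tree_iso V.free_relations_ops] free_relations_image
  by (simp add: free_ideal_def)

lemma free_iso: "operad_iso (free_operad V) (free_operad W) (\<lambda>n A. tree_map g ` A)"
  unfolding free_operad_def
  by (rule operad_iso.quot_iso[OF tree_iso V.free.ideal free_ideal_image])

lemma image_cls: "x \<in> tree_ops (carrier V) n \<Longrightarrow> tree_map g ` V.free.cls n x = W.free.cls n (tree_map g x)"
  using operad_iso.image_cls[OF tree_iso V.free.ideal, of x n] by (simp add: free_ideal_image)

lemma quadratic_iso:
  assumes R: "R \<subseteq> ops (free_operad V) 3" and R': "(\<lambda>A. tree_map g ` A) ` R = R'"
  shows "quadratic_operad \<lparr>gens = W, rels = R'\<rparr> \<cong>\<^sub>o\<^sub>p quadratic_operad \<lparr>gens = V, rels = R\<rparr>"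
proof -
  interpret F: operad_iso "free_operad V" "free_operad W" "\<lambda>n A. tree_map g ` A" by (rule free_iso)
  have "operad_iso (quadratic_operad \<lparr>gens = V, rels = R\<rparr>) (quadratic_operad \<lparr>gens = W, rels = R'\<rparr>)
      (\<lambda>n B. (\<lambda>A. tree_map g ` A) ` B)"
    unfolding quadratic_operad_def quadratic_data.simps
    by (rule F.quot_iso[OF F.P.ideal_gen_ideal[OF R]]) (simp add: F.ideal_gen_image[OF R] R')
  from operad_iso_isomorphic[OF operad_iso.inverse[OF this]] show ?thesis .
qed

end


section \<open>Coordinates of arity 3\<close>

lemma length_leaves_pos: "0 < length (leaves t)"
  using leaves_nonempty[of t] by simp

lemma length_leaves_1:
  assumes "length (leaves t) = 1" obtains l where "t = Leaf l"
proof (cases t)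
  case (Node v r s)
  then show ?thesis using assms length_leaves_pos[of r] length_leaves_pos[of s] by simp
qed (rule that)

lemma length_leaves_2:
  assumes "length (leaves t) = 2" obtains v i j where "t = Node v (Leaf i) (Leaf j)"
proof (cases t)
  case (Node v r s)
  then have "length (leaves r) = 1" "length (leaves s) = 1"
    using assms length_leaves_pos[of r] length_leaves_pos[of s]
    unfolding Node leaves.simps length_append by linarith+
  then obtain i j where "r = Leaf i" "s = Leaf j" by (elim length_leaves_1)
  then show ?thesis using Node that by blast
qed (use assms in simp)

lemma length_leaves_3:
  assumes "length (leaves t) = 3"
  obtains v w i j k where "t = Node v (Node w (Leaf i) (Leaf j)) (Leaf k)"
  | v w i j k where "t = Node v (Leaf k) (Node w (Leaf i) (Leaf j))"
proof (cases t)
  case (Node v r s)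
  then consider "length (leaves r) = 2" "length (leaves s) = 1" | "length (leaves r) = 1" "length (leaves s) = 2"
    using assms length_leaves_pos[of r] length_leaves_pos[of s]
    unfolding Node leaves.simps length_append by linarith
  then show ?thesis
  proof cases
    case 1
    then obtain w i j k where "r = Node w (Leaf i) (Leaf j)" "s = Leaf k"
      by (elim length_leaves_1 length_leaves_2)
    then show ?thesis using Node that(1) by blast
  next
    case 2
    then obtain w i j k where "s = Node w (Leaf i) (Leaf j)" "r = Leaf k"
      by (elim length_leaves_1 length_leaves_2)
    then show ?thesis using Node that(2) by blast
  qed
qed (use assms in simp)

lemma length_leaves_trees: "t \<in> trees S n \<Longrightarrow> length (leaves t) = n"
  using treesD(2,3)[of t S n] distinct_card[of "leaves t"] by simp

lemma trees_1:
  assumes "t \<in> trees S 1" shows "t = Leaf 0"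
proof -
  obtain l where l: "t = Leaf l" using length_leaves_1[OF length_leaves_trees[OF assms]] .
  then show ?thesis using treesD(4)[OF assms, of l] by simp
qed

lemma trees_2E:
  assumes "t \<in> trees S 2"
  obtains v where "v \<in> S" "t = Node v (Leaf 0) (Leaf 1)" | v where "v \<in> S" "t = Node v (Leaf 1) (Leaf 0)"
proof -
  obtain v i j where t: "t = Node v (Leaf i) (Leaf j)"
    using length_leaves_2[OF length_leaves_trees[OF assms]] .
  have "v \<in> S" "i \<noteq> j" "i < 2" "j < 2"
    using treesD[OF assms] unfolding t by auto
  then show ?thesis using that t by (auto simp: less_2_cases_iff)
qed

text \<open>The test made by \<^const>\<open>left_comb\<close>; for a permutation \<open>\<sigma>\<close> of three letters,
  \<open>cyc (\<sigma> 0) (\<sigma> 1)\<close> says that \<open>\<sigma>\<close> is even.\<close>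

definition cyc :: "nat \<Rightarrow> nat \<Rightarrow> bool" where
  "cyc i j \<longleftrightarrow> j = (i + 1) mod 3"

lemma trees_3E:
  assumes "t \<in> trees S 3"
  obtains v w i j k where "v \<in> S" "w \<in> S" "distinct [i, j, k]" "{i, j, k} = {..<3}"
    "t = Node v (Node w (Leaf i) (Leaf j)) (Leaf k)"
  | v w i j k where "v \<in> S" "w \<in> S" "distinct [i, j, k]" "{i, j, k} = {..<3}"
    "t = Node v (Leaf k) (Node w (Leaf i) (Leaf j))"
proof (rule length_leaves_3[OF length_leaves_trees[OF assms]])
  fix v w i j k
  assume t: "t = Node v (Node w (Leaf i) (Leaf j)) (Leaf k)"
  show thesis using that(1)[OF _ _ _ _ t] treesD[OF assms] unfolding t by auto
next
  fix v w i j k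
  assume t: "t = Node v (Leaf k) (Node w (Leaf i) (Leaf j))"
  have *: "{i, j, k} = {k, i, j}" by auto
  show thesis using that(2)[OF _ _ _ _ t] treesD[OF assms] unfolding t * by auto
qed

lemma less_3_cases: "(i::nat) < 3 \<longleftrightarrow> i = 0 \<or> i = 1 \<or> i = 2"
  by auto

lemma permutes_3_cases:
  fixes \<pi> :: "nat \<Rightarrow> nat"
  assumes "\<pi> permutes {..<3}"
  shows "(\<pi> 0, \<pi> 1, \<pi> 2) \<in> {(0,1,2), (0,2,1), (1,0,2), (1,2,0), (2,0,1), (2,1,0)}"
proof -
  have "\<pi> 0 < 3" "\<pi> 1 < 3" "\<pi> 2 < 3"
    using permutes_in_image[OF assms, of 0] permutes_in_image[OF assms, of 1]
      permutes_in_image[OF assms, of 2] by auto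
  moreover have "\<pi> 0 \<noteq> \<pi> 1" "\<pi> 0 \<noteq> \<pi> 2" "\<pi> 1 \<noteq> \<pi> 2"
    by (simp_all add: inj_eq[OF permutes_inj[OF assms]])
  ultimately show ?thesis unfolding less_3_cases by (elim disjE) simp_all
qed

text \<open>An even permutation of three letters is a rotation and preserves the orientation of
  every pair in the cycle 0, 1, 2; an odd one reverses it. The six permutations are checked one by
  one.\<close>

lemma cyc_permutes:
  assumes "\<pi> permutes {..<3}" "i < 3" "j < 3" "i \<noteq> j"
  shows "cyc (\<pi> i) (\<pi> j) \<longleftrightarrow> (cyc i j \<longleftrightarrow> cyc (\<pi> 0) (\<pi> 1))"
proof -
  have 1: "i = 0 \<or> i = 1 \<or> i = 2" "j = 0 \<or> j = 1 \<or> j = 2" using assms by auto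
  have 2: "cyc 0 1" "cyc 1 2" "cyc 2 0" "\<not> cyc 1 0" "\<not> cyc 2 1" "\<not> cyc 0 2"
    by (simp_all add: cyc_def)
  from permutes_3_cases[OF assms(1)] show ?thesis
    unfolding insert_iff prod.inject empty_iff
    by (elim disjE conjE FalseE; insert 1 assms(4); elim disjE; simp only: 2 simp_thms)
qed

lemma cyc_swap: "i < 3 \<Longrightarrow> j < 3 \<Longrightarrow> i \<noteq> j \<Longrightarrow> cyc j i \<longleftrightarrow> \<not> cyc i j"
  unfolding less_3_cases by (elim disjE) (auto simp: cyc_def)

lemma left_comb_cyc:
  "left_comb \<phi> (Node v (Node w (Leaf i) (Leaf j)) (Leaf k)) = (v, if cyc i j then w else \<phi> w, k)"
  "left_comb \<phi> (Node v (Leaf k) (Node w (Leaf i) (Leaf j))) = (\<phi> v, if cyc i j then w else \<phi> w, k)"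
  by (simp_all add: cyc_def)

text \<open>Relabelling keeps the shape and hence the outer vertex, and moves the remaining input to
  \<open>\<pi> l\<close>. An odd \<open>\<pi>\<close> reverses the inner pair, which costs one flip
  of the inner vertex; a double flip cancels by the assumption on \<open>\<phi>\<close>.\<close>

lemma left_comb_relabel:
  assumes t: "t \<in> trees S 3" and \<pi>: "\<pi> permutes {..<3}" and \<phi>: "\<And>v. v \<in> S \<Longrightarrow> \<phi> (\<phi> v) = v"
    and c: "left_comb \<phi> t = (v, w, l)"
  shows "left_comb \<phi> (relabel \<pi> t) = (v, if cyc (\<pi> 0) (\<pi> 1) then w else \<phi> w, \<pi> l)"
  using t
proof (cases rule: trees_3E)
  case (1 v' w' i j k)
  have "i < 3" "j < 3" "i \<noteq> j" using 1(3,4) by (simp, blast, simp, blast, simp)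
  note cyc_permutes[OF \<pi> this]
  moreover have "w = (if cyc i j then w' else \<phi> w')" "l = k" "left_comb \<phi> t = (v, w, l)"
    using c unfolding 1(5) left_comb_cyc by simp_all
  ultimately show ?thesis
    using \<phi>[OF 1(2)] unfolding 1(5) btree.map left_comb_cyc by simp
next
  case (2 v' w' i j k)
  have "i < 3" "j < 3" "i \<noteq> j" using 2(3,4) by (simp, blast, simp, blast, simp)
  note cyc_permutes[OF \<pi> this]
  moreover have "w = (if cyc i j then w' else \<phi> w')" "l = k" "left_comb \<phi> t = (v, w, l)"
    using c unfolding 2(5) left_comb_cyc by simp_all
  ultimately show ?thesis
    using \<phi>[OF 2(2)] unfolding 2(5) btree.map left_comb_cyc by simp
qed

lemma left_comb_closed:
  assumes "t \<in> trees S 3" "\<And>v. v \<in> S \<Longrightarrow> \<phi> v \<in> S" "left_comb \<phi> t = (v, w, l)"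
  shows "v \<in> S" "w \<in> S" "l < 3"
  using assms(1) by (cases rule: trees_3E; use assms(2,3) in \<open>auto split: if_splits\<close>)+

lemma ev_act:
  assumes "\<sigma> permutes {..<n}" "fin x"
  shows "ev L (act (tree_operad S) m \<sigma> x) = ev (\<lambda>t. L (relabel (pinv \<sigma>) t)) x"
  using assms by (simp add: act_lin ev_lin)

lemma tree_ops_add:
  assumes "x \<in> tree_ops S n" "y \<in> tree_ops S n"
  shows "(\<lambda>t. x t + y t) \<in> tree_ops S n"
  using tree_ops_diff[OF assms(1) tree_ops_smult[OF assms(2), of "- 1"]] by simp

section \<open>Coordinate functionals on the free operad\<close>

context s2_rep
begin

definition linear_form :: "('v \<Rightarrow> 'k) \<Rightarrow> bool" where
  "linear_form \<alpha> \<longleftrightarrow>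
    (\<forall>v\<in>carrier V. \<forall>w\<in>carrier V. \<alpha> (v \<oplus>\<^bsub>V\<^esub> w) = \<alpha> v + \<alpha> w) \<and>
    (\<forall>c. \<forall>v\<in>carrier V. \<alpha> (c \<odot>\<^bsub>V\<^esub> v) = c * \<alpha> v)"

lemma linear_form_flip: "linear_form \<alpha> \<Longrightarrow> linear_form (\<lambda>v. \<alpha> (flip V v))"
  by (simp add: linear_form_def flip_add flip_smult flip_closed)

text \<open>F(V)(2) is a copy of V, and this is the form \<open>\<alpha>\<close> on it: a corolla
  with exchanged inputs stands for the flipped operation.\<close>

fun coord2 :: "('v \<Rightarrow> 'k) \<Rightarrow> ('v, nat) btree \<Rightarrow> 'k" where
  "coord2 \<alpha> (Node v (Leaf i) (Leaf j)) = (if i = 0 then \<alpha> v else \<alpha> (flip V v))"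

text \<open>The functional \<alpha> \<otimes> \<beta> on the copy \<open>k\<close> of V \<otimes> V.
  It has the form of \<open>tree_pairing\<close> with one argument fixed, which is how facts about
  coordinates become facts about the pairing.\<close>

definition coord3 :: "('v \<Rightarrow> 'k) \<Rightarrow> ('v \<Rightarrow> 'k) \<Rightarrow> nat \<Rightarrow> ('v, nat) btree \<Rightarrow> 'k" where
  "coord3 \<alpha> \<beta> k t = (case left_comb (flip V) t of (v, w, l) \<Rightarrow> if k = l then \<alpha> v * \<beta> w else 0)"

lemma coord2_relabel:
  assumes "t \<in> trees (carrier V) 2" "\<pi> permutes {..<2}"
  shows "coord2 \<alpha> (relabel \<pi> t) = coord2 (if \<pi> 0 = 0 then \<alpha> else (\<lambda>v. \<alpha> (flip V v))) t"
proof -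
  have "\<pi> 0 < 2" "\<pi> 1 < 2"
    using permutes_in_image[OF assms(2), of 0] permutes_in_image[OF assms(2), of 1] by auto
  moreover have "\<pi> 0 \<noteq> \<pi> 1" by (simp add: inj_eq[OF permutes_inj[OF assms(2)]])
  ultimately consider "\<pi> 0 = 0" "\<pi> 1 = 1" | "\<pi> 0 = 1" "\<pi> 1 = 0" by linarith
  then show ?thesis using assms(1)
    by cases (auto elim!: trees_2E simp: flip_flip)
qed

text \<open>Permuting the inputs turns a coordinate functional into another one, so the common
  kernel of all of them is stable under the symmetric group.\<close>

lemma coord3_relabel:
  assumes t: "t \<in> trees (carrier V) 3" and \<pi>: "\<pi> permutes {..<3}"
  shows "coord3 \<alpha> \<beta> k (relabel \<pi> t) =
    coord3 \<alpha> (if cyc (\<pi> 0) (\<pi> 1) then \<beta> else (\<lambda>v. \<beta> (flip V v))) (pinv \<pi> k) t"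
proof -
  obtain v w l where c: "left_comb (flip V) t = (v, w, l)" by (metis prod_cases3)
  have "k = \<pi> l \<longleftrightarrow> pinv \<pi> k = l" using permutes_inverses[OF \<pi>] by metis
  then show ?thesis
    by (simp add: coord3_def c left_comb_relabel[OF t \<pi> flip_flip c])
qed

text \<open>The input left out of \<open>q\<close> gets the label 2 when grafting at 0, and 0 when
  grafting at 1, where the orientation of the root is reversed. Coordinates of a composite are thus
  products of coordinates, which is why the kernel is an ideal.\<close>

lemma coord3_graft:
  assumes p: "p \<in> trees (carrier V) 2" and q: "q \<in> trees (carrier V) 2" and i: "i < 2"
  shows "coord3 \<alpha> \<beta> k (graft 2 i p q) =
    (if k = (if i = 0 then 2 else 0)
     then coord2 (if i = 0 then \<alpha> else (\<lambda>v. \<alpha> (flip V v))) p * coord2 \<beta> q else 0)"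
proof -
  have "i = 0 \<or> i = 1" using i by auto
  then show ?thesis
    using p q by (elim trees_2E disjE) (auto simp: coord3_def flip_flip)
qed

text \<open>A lower bound for the quotient \<open>F(V)(3)\<close>: an ideal cut out by coordinate functionals in arities
  2 and 3, and as small as possible in arities 0 and 1, contains the relations of \<open>F(V)\<close>. From
  arity 4 on it is everything, so that only compositions of two binary operations matter.\<close>

definition kernel :: "nat \<Rightarrow> (('v, nat) btree \<Rightarrow> 'k) set" where
  "kernel n = {x \<in> tree_ops (carrier V) n.
     (n \<le> 1 \<longrightarrow> x = (\<lambda>_. 0)) \<and>
     (n = 2 \<longrightarrow> (\<forall>\<alpha>. linear_form \<alpha> \<longrightarrow> ev (coord2 \<alpha>) x = 0)) \<and>
     (n = 3 \<longrightarrow> (\<forall>\<alpha> \<beta> k. linear_form \<alpha> \<longrightarrow> linear_form \<beta> \<longrightarrow> ev (coord3 \<alpha> \<beta> k) x = 0))}"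

lemma zero_kernel: "(\<lambda>_. 0) \<in> kernel n"
  by (simp add: kernel_def tree_ops_def)

lemma smult_kernel: "x \<in> kernel n \<Longrightarrow> (\<lambda>t. c * x t) \<in> kernel n"
  by (simp add: kernel_def tree_ops_smult ev_smult)

lemma sym_submodule_kernel: "sym_submodule (tree_operad (carrier V)) n (kernel n)"
  unfolding tree.sym_submodule_iff
proof (intro conjI ballI allI impI)
  fix x y :: "('v, nat) btree \<Rightarrow> 'k" assume xy: "x \<in> kernel n" "y \<in> kernel n"
  then have "fin x" "fin y" using tree_opsD(1) unfolding kernel_def by blast+
  with xy show "x \<oplus>\<^bsub>space (tree_operad (carrier V)) n\<^esub> y \<in> kernel n"
    by (simp add: kernel_def tree_ops_add ev_add tree_opsD)
next
  fix \<sigma> and x :: "('v, nat) btree \<Rightarrow> 'k" assume x: "x \<in> kernel n" and \<sigma>: "\<sigma> permutes {..<n}"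
  let ?y = "act (tree_operad (carrier V)) n \<sigma> x"
  have xo: "x \<in> tree_ops (carrier V) n" using x by (simp add: kernel_def)
  note \<sigma>' = permutes_inv[OF \<sigma>]
  have "?y \<in> tree_ops (carrier V) n" using tree.act_closed[OF \<sigma>, of x] xo by simp
  moreover have "?y = (\<lambda>_. 0)" if "n \<le> 1" using that x by (simp add: kernel_def act_tree_operad)
  moreover have "ev (coord2 \<alpha>) ?y = 0" if n: "n = 2" and \<alpha>: "linear_form \<alpha>" for \<alpha>
  proof -
    let ?\<alpha> = "if pinv \<sigma> 0 = 0 then \<alpha> else (\<lambda>v. \<alpha> (flip V v))"
    have "ev (coord2 \<alpha>) ?y = ev (coord2 ?\<alpha>) x"
      unfolding ev_act[OF \<sigma> tree_opsD(1)[OF xo]]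
      using tree_opsD(2)[OF xo] \<sigma>' unfolding n by (intro ev_cong coord2_relabel)
    moreover have "linear_form ?\<alpha>" using \<alpha> linear_form_flip by auto
    ultimately show ?thesis using x n by (simp add: kernel_def)
  qed
  moreover have "ev (coord3 \<alpha> \<beta> k) ?y = 0"
    if n: "n = 3" and \<alpha>: "linear_form \<alpha>" and \<beta>: "linear_form \<beta>" for \<alpha> \<beta> k
  proof -
    let ?\<beta> = "if cyc (pinv \<sigma> 0) (pinv \<sigma> 1) then \<beta> else (\<lambda>v. \<beta> (flip V v))"
    have "ev (coord3 \<alpha> \<beta> k) ?y = ev (coord3 \<alpha> ?\<beta> (pinv (pinv \<sigma>) k)) x"
      unfolding ev_act[OF \<sigma> tree_opsD(1)[OF xo]]
      using tree_opsD(2)[OF xo] \<sigma>' unfolding n by (intro ev_cong coord3_relabel)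
    moreover have "linear_form ?\<beta>" using \<beta> linear_form_flip by auto
    ultimately show ?thesis using x n \<alpha> by (simp add: kernel_def)
  qed
  ultimately show "?y \<in> kernel n" by (simp add: kernel_def)
qed (auto simp: zero_kernel smult_kernel, simp add: kernel_def)

lemma tree_ops_0: "x \<in> tree_ops S 0 \<Longrightarrow> x = (\<lambda>_. 0)"
  using tree_opsD(2)[of x S 0] trees_pos[of _ S 0] by blast

text \<open>Arity 1 is the line spanned by the unit, so composing with its elements is
  scaling.\<close>

lemma tree_ops_1:
  fixes x :: "('v, nat) btree \<Rightarrow> 'k"
  assumes "x \<in> tree_ops S 1"
  shows "x = (\<lambda>t. x (Leaf 0) * basis (Leaf 0) t)"
  using tree_opsD(2)[OF assms] trees_1[of _ S] by (fastforce simp: basis_def)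

lemma operad_ideal_kernel: "operad_ideal (tree_operad (carrier V)) kernel"
  unfolding operad_ideal_def
proof (intro conjI allI impI sym_submodule_kernel)
  let ?T = "tree_operad (carrier V) :: ('k, _) operad"
  fix m n i and \<mu> \<nu> :: "('v, nat) btree \<Rightarrow> 'k"
  assume *: "i < m \<and> \<mu> \<in> ops ?T m \<and> \<nu> \<in> ops ?T n \<and> (\<mu> \<in> kernel m \<or> \<nu> \<in> kernel n)"
  then have i: "i < m" and \<mu>: "\<mu> \<in> tree_ops (carrier V) m" and \<nu>: "\<nu> \<in> tree_ops (carrier V) n" by auto
  note D = tree_opsD[OF \<mu>] tree_opsD[OF \<nu>]
  have 0: "pcomp ?T m n i \<mu> \<nu> \<in> kernel (m + n - 1)" if "\<mu> = (\<lambda>_. 0) \<or> \<nu> = (\<lambda>_. 0)"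
    using that zero_kernel by (auto simp: pcomp_tree_operad)
  \<comment> \<open>For \<open>n = 0\<close> there are no trees, and an argument of arity 1 is a
    multiple of the unit, zero if it lies in the kernel. Otherwise both arities are at least 2, and
    the composite has arity below 4 only if both equal 2.\<close>
  consider "n = 0" | "m = 1" "\<mu> \<in> kernel m" | "n = 1" "\<nu> \<in> kernel n" | "m = 1" "\<nu> \<in> kernel n"
    | "n = 1" "\<mu> \<in> kernel m" | "m = 2" "n = 2" | "4 \<le> m + n - 1"
    using * by linarith
  then show "pcomp ?T m n i \<mu> \<nu> \<in> kernel (m + n - 1)"
  proof cases
    case 1 then show ?thesis using tree_ops_0 \<nu> by (intro 0) auto
  next
    case 2 then show ?thesis by (intro 0) (simp add: kernel_def)
  next
    case 3 then show ?thesis by (intro 0) (simp add: kernel_def)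
  next
    case 4
    then have "\<mu> = (\<lambda>t. \<mu> (Leaf 0) * basis (Leaf 0) t)" using tree_ops_1 \<mu> by simp
    then have "pcomp ?T m n i \<mu> \<nu> = pcomp ?T m n i (\<lambda>t. \<mu> (Leaf 0) * basis (Leaf 0) t) \<nu>" by simp
    also have "\<dots> = (\<lambda>t. \<mu> (Leaf 0) * \<nu> t)"
      using 4 i by (simp add: pcomp_tree_operad lin_smult graft_unit_left D del: graft.simps)
    finally show ?thesis using smult_kernel[OF 4(2)] 4(1) by simp
  next
    case 5
    then have "\<nu> = (\<lambda>t. \<nu> (Leaf 0) * basis (Leaf 0) t)" using tree_ops_1 \<nu> by simp
    then have "pcomp ?T m n i \<mu> \<nu> = pcomp ?T m n i \<mu> (\<lambda>t. \<nu> (Leaf 0) * basis (Leaf 0) t)" by simp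
    also have "\<dots> = (\<lambda>t. \<nu> (Leaf 0) * \<mu> t)"
      using 5 by (simp add: pcomp_tree_operad lin_smult lin_smult_fun graft_unit_right[unfolded One_nat_def] D)
    finally show ?thesis using smult_kernel[OF 5(2)] 5(1) by simp
  next
    case 6
    have "ev (coord3 \<alpha> \<beta> k) (pcomp ?T 2 2 i \<mu> \<nu>) = 0"
      if \<alpha>: "linear_form \<alpha>" and \<beta>: "linear_form \<beta>" for \<alpha> \<beta> k
    proof -
      let ?\<alpha> = "if i = 0 then \<alpha> else (\<lambda>v. \<alpha> (flip V v))"
      let ?c = "if k = (if i = 0 then 2 else 0) then 1 else 0"
      have "ev (coord3 \<alpha> \<beta> k) (pcomp ?T 2 2 i \<mu> \<nu>) =
          ev (\<lambda>p. ev (\<lambda>q. coord3 \<alpha> \<beta> k (graft 2 i p q)) \<nu>) \<mu>"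
        by (simp add: pcomp_tree_operad ev_lin fin_lin D)
      also have "\<dots> = ev (\<lambda>p. ev (\<lambda>q. coord2 ?\<alpha> p * (?c * coord2 \<beta> q)) \<nu>) \<mu>"
        using D i 6 by (intro ev_cong) (simp add: coord3_graft)
      also have "\<dots> = ev (coord2 ?\<alpha>) \<mu> * (?c * ev (coord2 \<beta>) \<nu>)"
        unfolding ev_smult_fun ev_mult_fun ..
      also have "\<dots> = 0"
      proof -
        have "linear_form ?\<alpha>" using \<alpha> linear_form_flip by auto
        then have "ev (coord2 ?\<alpha>) \<mu> = 0 \<or> ev (coord2 \<beta>) \<nu> = 0"
          using * 6 \<beta> by (auto simp: kernel_def)
        then show ?thesis by auto
      qed
      finally show ?thesis .
    qed
    moreover have "pcomp ?T 2 2 i \<mu> \<nu> \<in> tree_ops (carrier V) (2 + 2 - 1)"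
      using pcomp_tree_ops[OF i \<mu> \<nu>] 6 by simp
    ultimately show ?thesis using 6 by (simp add: kernel_def)
  next
    case 7
    then show ?thesis using pcomp_tree_ops[OF i \<mu> \<nu>] by (simp add: kernel_def)
  qed
qed

lemma free_relations_kernel: "free_relations V \<subseteq> kernel 2"
proof
  fix x assume x: "x \<in> free_relations V"
  have "ev (coord2 \<alpha>) x = 0" if \<alpha>: "linear_form \<alpha>" for \<alpha>
    using x \<alpha> flip_flip unfolding free_relations_def corolla_def linear_form_def
    by (auto simp: ev_diff ev_diff[OF fin_diff[OF fin_basis fin_basis] fin_basis] fin_smult ev_smult)
  then show "x \<in> kernel 2" using x free_relations_ops by (auto simp: kernel_def)
qed

text \<open>By minimality the ideal generated by the relations lies in \<open>kernel\<close>. Hence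
  the coordinates descend to F(V)(3).\<close>

lemma coord3_free_ideal:
  assumes "x \<in> free_ideal V 3" "linear_form \<alpha>" "linear_form \<beta>"
  shows "ev (coord3 \<alpha> \<beta> k) x = 0"
proof -
  have "x \<in> kernel 3"
    using tree.ideal_gen_least[OF operad_ideal_kernel free_relations_kernel] assms(1)
    by (auto simp: free_ideal_def)
  then show ?thesis using assms by (simp add: kernel_def)
qed

end


section \<open>Normal forms in arity 3\<close>

abbreviation ltree :: "'v \<Rightarrow> 'v \<Rightarrow> (nat \<Rightarrow> nat) \<Rightarrow> ('v, nat) btree" where
  "ltree v w \<sigma> \<equiv> Node v (Node w (Leaf (\<sigma> 0)) (Leaf (\<sigma> 1))) (Leaf (\<sigma> 2))"

abbreviation rtree :: "'v \<Rightarrow> 'v \<Rightarrow> (nat \<Rightarrow> nat) \<Rightarrow> ('v, nat) btree" where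
  "rtree v w \<sigma> \<equiv> Node v (Leaf (\<sigma> 0)) (Node w (Leaf (\<sigma> 1)) (Leaf (\<sigma> 2)))"

lemma graft_corolla:
  "graft 2 0 (Node v (Leaf 0) (Leaf 1)) (Node w (Leaf 0) (Leaf 1)) = ltree v w id"
  "graft 2 1 (Node v (Leaf 0) (Leaf 1)) (Node w (Leaf 0) (Leaf 1)) = rtree v w id"
  "graft 2 0 (Node v (Leaf 1) (Leaf 0)) (Node w (Leaf 0) (Leaf 1)) =
     Node v (Leaf 2) (Node w (Leaf 0) (Leaf 1))"
  "graft 2 0 (Node v (Leaf 0) (Leaf 1)) (Node w (Leaf 1) (Leaf 0)) =
     Node v (Node w (Leaf 1) (Leaf 0)) (Leaf 2)"
  by simp_all

lemma ltree_trees: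
  assumes "v \<in> S" "w \<in> S" "\<sigma> permutes {..<3}"
  shows "ltree v w \<sigma> \<in> trees S 3" "rtree v w \<sigma> \<in> trees S 3"
proof -
  have "ltree v w id \<in> trees S 3" "rtree v w id \<in> trees S 3"
    using assms(1,2) by (simp_all add: trees_def lessThan_Suc numeral_3_eq_3 numeral_2_eq_2 insert_commute)
  from this[THEN relabel_trees[OF assms(3)]] show "ltree v w \<sigma> \<in> trees S 3" "rtree v w \<sigma> \<in> trees S 3"
    by simp_all
qed

lemma ex_permutation_3:
  assumes "distinct [i, j, k]" "{i, j, k} = {..<3::nat}"
  obtains \<sigma> where "\<sigma> permutes {..<3}" "\<sigma> 0 = i" "\<sigma> 1 = j" "\<sigma> 2 = k"
proof
  let ?\<sigma> = "\<lambda>l. if l = 0 then i else if l = 1 then j else if l = 2 then k else l"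
  have 3: "{..<3::nat} = {0, 1, 2}" by auto
  have "bij_betw ?\<sigma> {0, 1, 2} {i, j, k}"
    using assms(1) by (auto simp: bij_betw_def inj_on_def)
  then show "?\<sigma> permutes {..<3}"
    by (intro bij_imp_permutes) (auto simp: assms(2) 3)
qed auto

section \<open>Congruence modulo the relations of the free operad\<close>

context s2_rep
begin

lemma free_ideal_add: "x \<in> free_ideal V n \<Longrightarrow> y \<in> free_ideal V n \<Longrightarrow> (\<lambda>t. x t + y t) \<in> free_ideal V n"
  using free.quot.sub_simps(1)[of x n y] by simp

lemma free_ideal_smult: "x \<in> free_ideal V n \<Longrightarrow> (\<lambda>t. c * x t) \<in> free_ideal V n"
  using free.quot.sub_simps(2)[of x n c] by simp

lemma free_ideal_zero: "(\<lambda>t. 0) \<in> free_ideal V n"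
  using free.quot.sub_simps(3)[of n] by simp

lemma free_ideal_sum:
  "finite A \<Longrightarrow> (\<And>i. i \<in> A \<Longrightarrow> F i \<in> free_ideal V n) \<Longrightarrow> (\<lambda>t. \<Sum>i\<in>A. c i * F i t) \<in> free_ideal V n"
  by (induction A rule: finite_induct) (simp_all add: free_ideal_zero free_ideal_add free_ideal_smult)

lemma free_ideal_lin:
  "fin x \<Longrightarrow> (\<And>p. x p \<noteq> 0 \<Longrightarrow> F p \<in> free_ideal V n) \<Longrightarrow> lin F x \<in> free_ideal V n"
  unfolding lin_def ev_def by (rule free_ideal_sum) auto

text \<open>Equality in F(V)(3), phrased on representatives so that sums of trees can be rewritten
  without forming cosets.\<close>

definition cong3 :: "(('v, nat) btree \<Rightarrow> 'k) \<Rightarrow> (('v, nat) btree \<Rightarrow> 'k) \<Rightarrow> bool" (infix "\<approx>" 50) where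
  "x \<approx> y \<longleftrightarrow> (\<lambda>t. x t - y t) \<in> free_ideal V 3"

lemma cong3_refl [simp]: "x \<approx> x"
  by (simp add: cong3_def free_ideal_zero)

lemma cong3_sym: "x \<approx> y \<Longrightarrow> y \<approx> x"
  using free_ideal_smult[of "\<lambda>t. x t - y t" 3 "- 1"] by (simp add: cong3_def)

lemma cong3_trans [trans]: "x \<approx> y \<Longrightarrow> y \<approx> z \<Longrightarrow> x \<approx> z"
  using free_ideal_add[of "\<lambda>t. x t - y t" 3 "\<lambda>t. y t - z t"] by (simp add: cong3_def)

lemma cong3_add: "x \<approx> x' \<Longrightarrow> y \<approx> y' \<Longrightarrow> (\<lambda>t. x t + y t) \<approx> (\<lambda>t. x' t + y' t)"
  using free_ideal_add[of "\<lambda>t. x t - x' t" 3 "\<lambda>t. y t - y' t"] by (simp add: cong3_def algebra_simps)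

lemma cong3_smult: "x \<approx> y \<Longrightarrow> (\<lambda>t. c * x t) \<approx> (\<lambda>t. c * y t)"
  using free_ideal_smult[of "\<lambda>t. x t - y t" 3 c] by (simp add: cong3_def algebra_simps)

lemma cong3_sum:
  "finite A \<Longrightarrow> (\<And>i. i \<in> A \<Longrightarrow> F i \<approx> G i) \<Longrightarrow> (\<lambda>t. \<Sum>i\<in>A. c i * F i t) \<approx> (\<lambda>t. \<Sum>i\<in>A. c i * G i t)"
  by (induction A rule: finite_induct) (simp_all add: cong3_add cong3_smult)

lemma cong3_lin:
  assumes "fin x" "\<And>s. x s \<noteq> 0 \<Longrightarrow> basis s \<approx> F s"
  shows "x \<approx> lin F x"
proof -
  have "lin (\<lambda>s t. basis s t - F s t) x \<in> free_ideal V 3"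
    using assms by (intro free_ideal_lin) (auto simp: cong3_def)
  moreover have "lin (\<lambda>s t. basis s t - F s t) x = (\<lambda>t. lin basis x t - lin F x t)"
    unfolding lin_def ev_def by (simp add: algebra_simps sum_subtractf)
  ultimately show ?thesis using assms(1) by (simp add: cong3_def)
qed

lemma relations_in_ideal: "free_relations V \<subseteq> free_ideal V 2"
  unfolding free_ideal_def by (rule tree.ideal_gen_superset)

lemma corolla_ops: "v \<in> carrier V \<Longrightarrow> basis (Node v (Leaf 0) (Leaf 1)) \<in> tree_ops (carrier V) 2"
  by (intro basis_tree_ops corolla_trees)

text \<open>Every left comb is a relabelling of one corolla grafted at leaf 0 of another, so a
  relation inserted at its outer vertex yields an element of the ideal.\<close>

lemma lin_graft_outer:
  assumes r: "r \<in> free_ideal V 2" and w: "w \<in> carrier V" and \<sigma>: "\<sigma> permutes {..<3}"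
  shows "lin (\<lambda>p. basis (relabel \<sigma> (graft 2 0 p (Node w (Leaf 0) (Leaf 1))))) r \<in> free_ideal V 3"
proof -
  let ?T = "tree_operad (carrier V) :: ('k, _) operad"
  have fr: "fin r" using free.quot.sub_simps(4)[OF r] by (simp add: tree_opsD)
  have "pcomp ?T 2 2 0 r (basis (Node w (Leaf 0) (Leaf 1))) \<in> free_ideal V (2 + 2 - 1)"
    using r corolla_ops[OF w] by (intro free.ideal_pcomp_left) simp_all
  \<comment> \<open>The action of \<open>pinv \<sigma>\<close> relabels leaves by
    \<open>\<sigma>\<close>.\<close>
  then have "act ?T 3 (pinv \<sigma>) (pcomp ?T 2 2 0 r (basis (Node w (Leaf 0) (Leaf 1)))) \<in> free_ideal V 3"
    by (intro free.ideal_act permutes_inv[OF \<sigma>]) simp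
  then show ?thesis
    using fr by (simp add: act_lin[OF permutes_inv[OF \<sigma>]] pcomp_tree_operad lin_lin fin_lin
        permutes_inv_inv[OF \<sigma>] del: graft.simps)
qed

text \<open>Here the relation sits at the inner vertex, so closure of the ideal in the other
  argument of the composition is used.\<close>

lemma lin_graft_inner:
  assumes r: "r \<in> free_ideal V 2" and v: "v \<in> carrier V" and \<sigma>: "\<sigma> permutes {..<3}"
  shows "lin (\<lambda>q. basis (relabel \<sigma> (graft 2 0 (Node v (Leaf 0) (Leaf 1)) q))) r \<in> free_ideal V 3"
proof -
  let ?T = "tree_operad (carrier V) :: ('k, _) operad"
  have fr: "fin r" using free.quot.sub_simps(4)[OF r] by (simp add: tree_opsD)
  have "pcomp ?T 2 2 0 (basis (Node v (Leaf 0) (Leaf 1))) r \<in> free_ideal V (2 + 2 - 1)"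
    using r corolla_ops[OF v] by (intro free.ideal_pcomp_right) simp_all
  then have "act ?T 3 (pinv \<sigma>) (pcomp ?T 2 2 0 (basis (Node v (Leaf 0) (Leaf 1))) r) \<in> free_ideal V 3"
    by (intro free.ideal_act permutes_inv[OF \<sigma>]) simp
  then show ?thesis
    using fr by (simp add: act_lin[OF permutes_inv[OF \<sigma>]] pcomp_tree_operad lin_lin fin_lin
        permutes_inv_inv[OF \<sigma>] del: graft.simps)
qed

lemma relation_add:
  "v \<in> carrier V \<Longrightarrow> w \<in> carrier V \<Longrightarrow>
    (\<lambda>t. corolla (v \<oplus>\<^bsub>V\<^esub> w) t - corolla v t - corolla w t) \<in> free_ideal V 2"
  by (rule subsetD[OF relations_in_ideal]) (unfold free_relations_def, blast)

lemma relation_smult: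
  "v \<in> carrier V \<Longrightarrow> (\<lambda>t. corolla (c \<odot>\<^bsub>V\<^esub> v) t - c * corolla v t) \<in> free_ideal V 2"
  by (rule subsetD[OF relations_in_ideal]) (unfold free_relations_def, blast)

lemma relation_flip:
  "v \<in> carrier V \<Longrightarrow> (\<lambda>t. corolla (flip V v) t - basis (Node v (Leaf 1) (Leaf 0)) t) \<in> free_ideal V 2"
  by (rule subsetD[OF relations_in_ideal]) (unfold free_relations_def, blast)

lemmas lin_diffs = lin_diff lin_diff[OF fin_diff[OF fin_basis fin_basis] fin_basis] lin_smult fin_smult

section \<open>Left combs are bilinear and equivariant in their vertices\<close>

context
  fixes \<sigma> :: "nat \<Rightarrow> nat" assumes \<sigma>: "\<sigma> permutes {..<3}"
begin

lemma ltree_add_outer: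
  assumes "v \<in> carrier V" "v' \<in> carrier V" "w \<in> carrier V"
  shows "basis (ltree (v \<oplus>\<^bsub>V\<^esub> v') w \<sigma>) \<approx> (\<lambda>t. basis (ltree v w \<sigma>) t + basis (ltree v' w \<sigma>) t)"
  using lin_graft_outer[OF relation_add[OF assms(1,2)] assms(3) \<sigma>]
  by (simp add: cong3_def corolla_def lin_diffs graft_corolla del: graft.simps One_nat_def flip: diff_diff_eq)

lemma ltree_add_inner:
  assumes "v \<in> carrier V" "w \<in> carrier V" "w' \<in> carrier V"
  shows "basis (ltree v (w \<oplus>\<^bsub>V\<^esub> w') \<sigma>) \<approx> (\<lambda>t. basis (ltree v w \<sigma>) t + basis (ltree v w' \<sigma>) t)"
  using lin_graft_inner[OF relation_add[OF assms(2,3)] assms(1) \<sigma>]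
  by (simp add: cong3_def corolla_def lin_diffs graft_corolla del: graft.simps One_nat_def flip: diff_diff_eq)

lemma ltree_smult_outer:
  assumes "v \<in> carrier V" "w \<in> carrier V"
  shows "basis (ltree (c \<odot>\<^bsub>V\<^esub> v) w \<sigma>) \<approx> (\<lambda>t. c * basis (ltree v w \<sigma>) t)"
  using lin_graft_outer[OF relation_smult[OF assms(1)] assms(2) \<sigma>]
  by (simp add: cong3_def corolla_def lin_diffs graft_corolla del: graft.simps One_nat_def)

lemma ltree_smult_inner:
  assumes "v \<in> carrier V" "w \<in> carrier V"
  shows "basis (ltree v (c \<odot>\<^bsub>V\<^esub> w) \<sigma>) \<approx> (\<lambda>t. c * basis (ltree v w \<sigma>) t)"
  using lin_graft_inner[OF relation_smult[OF assms(2)] assms(1) \<sigma>]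
  by (simp add: cong3_def corolla_def lin_diffs graft_corolla del: graft.simps One_nat_def)

lemma ltree_flip_outer:
  assumes "v \<in> carrier V" "w \<in> carrier V"
  shows "basis (ltree (flip V v) w \<sigma>) \<approx>
    basis (Node v (Leaf (\<sigma> 2)) (Node w (Leaf (\<sigma> 0)) (Leaf (\<sigma> 1))))"
  using lin_graft_outer[OF relation_flip[OF assms(1)] assms(2) \<sigma>]
  by (simp add: cong3_def corolla_def lin_diffs graft_corolla del: graft.simps One_nat_def)

lemma ltree_flip_inner:
  assumes "v \<in> carrier V" "w \<in> carrier V"
  shows "basis (ltree v (flip V w) \<sigma>) \<approx>
    basis (Node v (Node w (Leaf (\<sigma> 1)) (Leaf (\<sigma> 0))) (Leaf (\<sigma> 2)))"
  using lin_graft_inner[OF relation_flip[OF assms(2)] assms(1) \<sigma>]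
  by (simp add: cong3_def corolla_def lin_diffs graft_corolla del: graft.simps One_nat_def)

end

text \<open>For \<open>k < 3\<close> this is the labelling k + 1, k + 2, k modulo 3 of the left comb
  that represents the copy \<open>k\<close> of V \<otimes> V.\<close>

definition rot :: "nat \<Rightarrow> nat \<Rightarrow> nat" where
  "rot k = (\<lambda>l. if l < 3 then (k + l + 1) mod 3 else l)"

lemma rot_permutes: "rot k permutes {..<3}"
proof -
  have "inj_on (rot k) {..<3}"
  proof (rule inj_onI)
    fix l l' assume "l \<in> {..<3}" "l' \<in> {..<3}" "rot k l = rot k l'"
    then have *: "l = 0 \<or> l = 1 \<or> l = 2" "l' = 0 \<or> l' = 1 \<or> l' = 2"
      and "(k + l + 1) mod 3 = (k + l' + 1) mod 3" by (auto simp: rot_def)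
    moreover have "(k mod 3 + l + 1) mod 3 = (k + l + 1) mod 3" for l
      using mod_add_left_eq[of k 3 "l + 1"] by (simp only: add.assoc)
    moreover have "k mod 3 = 0 \<or> k mod 3 = 1 \<or> k mod 3 = 2" by linarith
    ultimately have "(k mod 3 + l + 1) mod 3 = (k mod 3 + l' + 1) mod 3" by (simp only:)
    then show "l = l'" using * \<open>k mod 3 = 0 \<or> _\<close> by (elim disjE) simp_all
  qed
  moreover from this have "rot k ` {..<3} = {..<3}"
    by (intro endo_inj_surj) (auto simp: rot_def)
  ultimately have "bij_betw (rot k) {..<3} {..<3}" by (simp add: bij_betw_def)
  then show ?thesis by (rule bij_imp_permutes) (simp add: rot_def)
qed

lemma rot_eq:
  assumes "distinct [i, j, k]" "{i, j, k} = {..<3::nat}" "cyc i j"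
  shows "rot k 0 = i" "rot k 1 = j" "rot k 2 = k"
proof -
  have *: "i < 3" "j < 3" "k < 3" unfolding lessThan_iff[symmetric] assms(2)[symmetric] by simp_all
  then have "i = 0 \<or> i = 1 \<or> i = 2" "k = 0 \<or> k = 1 \<or> k = 2" by linarith+
  moreover have "j = (i + 1) mod 3" "i \<noteq> k" "j \<noteq> k" using assms(1,3) by (simp_all add: cyc_def)
  ultimately have "i = (k + 1) mod 3" "j = (k + 2) mod 3" by (elim disjE; simp)+
  then show "rot k 0 = i" "rot k 1 = j" "rot k 2 = k" using * by (simp_all add: rot_def)
qed

text \<open>Each flip made by \<open>left_comb\<close> is an instance of a flip relation. Hence the
  three copies of V \<otimes> V span F(V)(3), the bound complementary to
  \<open>coord3_free_ideal\<close>.\<close>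

lemma left_comb_normal:
  assumes t: "t \<in> trees (carrier V) 3" and c: "left_comb (flip V) t = (v, w, k)"
  shows "basis t \<approx> basis (ltree v w (rot k))"
proof -
  have left: "basis (Node v' (Node w' (Leaf i) (Leaf j)) (Leaf k)) \<approx>
      basis (ltree v' (if cyc i j then w' else flip V w') (rot k))"
    if v': "v' \<in> carrier V" and w': "w' \<in> carrier V"
      and d: "distinct [i, j, k]" and eq: "{i, j, k} = {..<3::nat}"
    for v' w' i j k
  proof (cases "cyc i j")
    case True
    then show ?thesis using rot_eq[OF d eq] by (simp del: One_nat_def)
  next
    case False
    have *: "i < 3" "j < 3" unfolding lessThan_iff[symmetric] eq[symmetric] by simp_all
    \<comment> \<open>The reversed pair is cyclically oriented, so the labels are those of
      \<open>rot k\<close> after one inner flip.\<close>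
    have "distinct [j, i, k]" using d by auto
    moreover have "{j, i, k} = {..<3}" by (rule trans[OF insert_commute eq])
    moreover have "cyc j i" using cyc_swap[OF *] False d by simp
    ultimately have r: "rot k 0 = j" "rot k 1 = i" "rot k 2 = k" by (rule rot_eq)+
    show ?thesis
      using ltree_flip_inner[OF rot_permutes v' w', of k] False unfolding r
      by (simp add: cong3_sym)
  qed
  show ?thesis using t
  proof (cases rule: trees_3E)
    case (1 v' w' i j k')
    then show ?thesis using left[OF 1(1-4)] c unfolding 1(5) left_comb_cyc by simp
  next
    case (2 v' w' i j k')
    obtain \<sigma> where \<sigma>: "\<sigma> permutes {..<3}" "\<sigma> 0 = i" "\<sigma> 1 = j" "\<sigma> 2 = k'"
      using ex_permutation_3[OF 2(3,4)] .
    \<comment> \<open>A right comb is a left comb with flipped root, to which the previous case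
      applies.\<close>
    have "basis t \<approx> basis (ltree (flip V v') w' \<sigma>)"
      unfolding 2(5) using cong3_sym[OF ltree_flip_outer[OF \<sigma>(1) 2(1,2)]] \<sigma>(2-) by simp
    also have "\<dots> \<approx> basis (ltree v w (rot k))"
      unfolding \<sigma> using left[OF flip_closed[OF 2(1)] 2(2-4)] c unfolding 2(5) left_comb_cyc by simp
    finally show ?thesis .
  qed
qed

end


section \<open>The pairing\<close>

lemma sgn_dual_simps [simp]:
  "f \<oplus>\<^bsub>sgn_dual V\<^esub> g = (\<lambda>v. f v + g v)" "c \<odot>\<^bsub>sgn_dual V\<^esub> f = (\<lambda>v. c * f v)"
  "flip (sgn_dual V) f = (\<lambda>v. if v \<in> carrier V then - f (flip V v) else 0)"
  by (simp_all add: sgn_dual_def)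

context s2_rep
begin

lemma dual_carrier:
  "f \<in> carrier (sgn_dual V) \<longleftrightarrow> linear_form f \<and> (\<forall>v. v \<notin> carrier V \<longrightarrow> f v = 0)"
  by (simp add: sgn_dual_def linear_form_def)

lemma s2_rep_dual: "s2_rep (sgn_dual V)"
proof
  fix f assume "f \<in> carrier (sgn_dual V)"
  then show "flip (sgn_dual V) (flip (sgn_dual V) f) = f"
    by (auto simp: dual_carrier flip_flip flip_closed)
qed (auto simp: dual_carrier linear_form_def algebra_simps add_closed smult_closed flip_closed
      flip_add flip_smult)

end

locale s2_dual = s2_rep V + dual: s2_rep "sgn_dual V" for V :: "('k::field, 'v) s2_module"
begin

lemma tree_pairing_coord3:
  assumes "left_comb (flip (sgn_dual V)) s = (f, g, k)"
  shows "tree_pairing V s t = coord3 f g k t"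
  by (simp add: tree_pairing_def coord3_def assms split: prod.splits)

text \<open>Evaluations at \<open>v\<close> and \<open>w\<close> are linear forms on the dual, so
  the pairing with a fixed right argument is a coordinate functional too, now of the free operad on
  \<open>sgn_dual V\<close>.\<close>

lemma tree_pairing_dual_coord3:
  assumes "left_comb (flip V) t = (v, w, l)"
  shows "tree_pairing V s t = dual.coord3 (\<lambda>f. f v) (\<lambda>f. f w) l s"
  by (auto simp: tree_pairing_def dual.coord3_def assms split: prod.splits)

lemma formal_pairing_ev: "formal_pairing V x y = ev (\<lambda>s. ev (tree_pairing V s) y) x"
  by (simp add: formal_pairing_def ev_def sum_distrib_left mult.assoc)

lemma formal_pairing_basis: "formal_pairing V x (basis t) = ev (\<lambda>s. tree_pairing V s t) x"
  by (simp add: formal_pairing_ev)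

lemma formal_pairing_add_left:
  "fin x \<Longrightarrow> fin x' \<Longrightarrow>
    formal_pairing V (\<lambda>s. x s + x' s) y = formal_pairing V x y + formal_pairing V x' y"
  by (simp add: formal_pairing_ev ev_add)

lemma formal_pairing_smult_left: "formal_pairing V (\<lambda>s. c * x s) y = c * formal_pairing V x y"
  by (simp add: formal_pairing_ev ev_smult)

lemma formal_pairing_add_right:
  "fin y \<Longrightarrow> fin y' \<Longrightarrow>
    formal_pairing V x (\<lambda>s. y s + y' s) = formal_pairing V x y + formal_pairing V x y'"
  by (simp add: formal_pairing_ev ev_add ev_add_fun)

lemma formal_pairing_smult_right: "formal_pairing V x (\<lambda>s. c * y s) = c * formal_pairing V x y"
  by (simp add: formal_pairing_ev ev_smult ev_smult_fun)

lemma formal_pairing_diff_right: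
  "fin y \<Longrightarrow> fin y' \<Longrightarrow>
    formal_pairing V x (\<lambda>s. y s - y' s) = formal_pairing V x y - formal_pairing V x y'"
  using formal_pairing_add_right[of y "\<lambda>s. - 1 * y' s" x] formal_pairing_smult_right[of x "- 1" y']
    fin_smult[of y' "- 1"] by simp

lemma formal_pairing_ideal_left:
  assumes "x \<in> free_ideal (sgn_dual V) 3"
  shows "formal_pairing V x y = 0"
proof -
  have "ev (\<lambda>s. tree_pairing V s t) x = 0" for t
  proof -
    obtain v w l where c: "left_comb (flip V) t = (v, w, l)" by (metis prod_cases3)
    show ?thesis
      unfolding tree_pairing_dual_coord3[OF c]
      by (rule dual.coord3_free_ideal[OF assms]) (simp_all add: dual.linear_form_def)
  qed
  then show ?thesis unfolding formal_pairing_ev by (subst ev_swap) simp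
qed

text \<open>The vertices of the trees in \<open>x\<close> now serve as the forms of the coordinate
  functional, so they have to lie in \<open>sgn_dual V\<close>; evaluations at vectors, used on the
  other side, are always linear.\<close>

lemma formal_pairing_ideal_right:
  assumes "y \<in> free_ideal V 3" and x: "x \<in> tree_ops (carrier (sgn_dual V)) 3"
  shows "formal_pairing V x y = 0"
proof -
  have "ev (tree_pairing V s) y = 0" if "x s \<noteq> 0" for s
  proof -
    obtain f g k where c: "left_comb (flip (sgn_dual V)) s = (f, g, k)" by (metis prod_cases3)
    have "f \<in> carrier (sgn_dual V)" "g \<in> carrier (sgn_dual V)"
      using left_comb_closed[OF tree_opsD(2)[OF x that] dual.flip_closed c] by simp_all
    then show ?thesis
      unfolding tree_pairing_coord3[OF c] using coord3_free_ideal[OF assms(1)]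
      by (simp add: dual_carrier)
  qed
  then show ?thesis unfolding formal_pairing_ev by (subst ev_cong[where M = "\<lambda>_. 0"]) auto
qed

text \<open>Both ideals pair to zero, so all representatives give one value; cosets contain their
  representatives, so the \<open>THE\<close> in \<open>pairing\<close> picks this value.\<close>

lemma pairing_cls:
  assumes x: "x \<in> tree_ops (carrier (sgn_dual V)) 3" and y: "y \<in> tree_ops (carrier V) 3"
  shows "pairing V (dual.free.cls 3 x) (free.cls 3 y) = formal_pairing V x y"
proof -
  have *: "formal_pairing V x' y' = formal_pairing V x y"
    if x': "x' \<in> dual.free.cls 3 x" and y': "y' \<in> free.cls 3 y" for x' y'
  proof -
    obtain a where a: "a \<in> free_ideal (sgn_dual V) 3" "x' = (\<lambda>t. a t + x t)"
      using x' by (auto simp: dual.free.quot.mem_cls_iff)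
    obtain b where b: "b \<in> free_ideal V 3" "y' = (\<lambda>t. b t + y t)"
      using y' by (auto simp: free.quot.mem_cls_iff)
    have ao: "a \<in> tree_ops (carrier (sgn_dual V)) 3" using dual.free.quot.sub_simps(4)[OF a(1)] by simp
    have bo: "b \<in> tree_ops (carrier V) 3" using free.quot.sub_simps(4)[OF b(1)] by simp
    note fins = ao bo x y
    have "formal_pairing V x' y' = formal_pairing V x y'"
      using fins[THEN tree_opsD(1)] formal_pairing_ideal_left[OF a(1)] by (simp add: a(2) formal_pairing_add_left)
    also have "\<dots> = formal_pairing V x y"
      using fins[THEN tree_opsD(1)] formal_pairing_ideal_right[OF b(1) x] by (simp add: b(2) formal_pairing_add_right)
    finally show ?thesis .
  qed
  have self: "x \<in> dual.free.cls 3 x" "y \<in> free.cls 3 y"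
    using x y dual.free.quot.cls_self[of x 3] free.quot.cls_self[of y 3] by simp_all
  show ?thesis
    unfolding pairing_def
  proof (rule the_equality)
    show "\<forall>x'\<in>dual.free.cls 3 x. \<forall>y'\<in>free.cls 3 y. formal_pairing V x' y' = formal_pairing V x y"
      by (intro ballI *)
  next
    fix c assume "\<forall>x'\<in>dual.free.cls 3 x. \<forall>y'\<in>free.cls 3 y. formal_pairing V x' y' = c"
    from bspec[OF bspec[OF this self(1)] self(2)] show "c = formal_pairing V x y" by (rule sym)
  qed
qed

end

section \<open>The dual of a regular representation and nondegeneracy\<close>

lemma regular_simps [simp]:
  "v \<oplus>\<^bsub>regular_s2\<^esub> w = (\<lambda>p. v p + w p)" "c \<odot>\<^bsub>regular_s2\<^esub> v = (\<lambda>p. c * v p)"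
  "flip regular_s2 v = (\<lambda>(b, e). v (b, \<not> e))"
  by (simp_all add: regular_s2_def free_space_def)

lemma carrier_regular:
  assumes "finite (UNIV :: 'b set)"
  shows "carrier (regular_s2 :: ('k::field, 'b \<times> bool \<Rightarrow> 'k) s2_module) = UNIV"
proof -
  have "finite (UNIV :: ('b \<times> bool) set)" using assms by (simp add: finite_Prod_UNIV)
  then show ?thesis by (auto simp: regular_s2_def free_space_def intro: rev_finite_subset)
qed

lemma s2_rep_regular:
  assumes "finite (UNIV :: 'b set)"
  shows "s2_rep (regular_s2 :: ('k::field, 'b \<times> bool \<Rightarrow> 'k) s2_module)"
  by standard (auto simp: carrier_regular[OF assms])

text \<open>Of the two orderings of the labels other than \<open>k\<close> exactly one is cyclic, so
  either orientation can be prescribed.\<close>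

lemma ex_cyc:
  assumes "k < 3"
  shows "\<exists>i j. distinct [i, j, k] \<and> {i, j, k} = {..<3} \<and> (cyc i j \<longleftrightarrow> P)"
proof -
  have 3: "{..<3::nat} = {0, 1, 2}" by auto
  have e: "\<exists>i j. Q i j" if "Q 1 2 \<or> Q 2 1 \<or> Q 2 0 \<or> Q 0 2 \<or> Q 0 1 \<or> Q 1 0" for Q :: "nat \<Rightarrow> nat \<Rightarrow> bool"
    using that by blast
  from assms have "k = 0 \<or> k = 1 \<or> k = 2" by linarith
  then show ?thesis
    by (cases P; elim disjE; intro e) (simp_all add: 3 cyc_def insert_commute)
qed

locale regular_dual = s2_dual V for V :: "('k::field, 'b \<times> bool \<Rightarrow> 'k) s2_module" +
  assumes V_regular: "V = regular_s2" and finite_ops: "finite (UNIV :: 'b set)"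
begin

abbreviation "W \<equiv> sgn_dual V"

lemma carrier_V [simp]: "carrier V = UNIV"
  unfolding V_regular by (rule carrier_regular[OF finite_ops])

lemma V_simps [simp]:
  "v \<oplus>\<^bsub>V\<^esub> w = (\<lambda>p. v p + w p)" "c \<odot>\<^bsub>V\<^esub> v = (\<lambda>p. c * v p)"
  "flip V v = (\<lambda>(b, e). v (b, \<not> e))"
  by (simp_all add: V_regular)

lemma finite_index [simp]: "finite (UNIV :: ('b \<times> bool) set)"
  using finite_ops by (simp add: finite_Prod_UNIV)

lemma carrier_W: "f \<in> carrier W \<longleftrightarrow>
    (\<forall>v w. f (\<lambda>p. v p + w p) = f v + f w) \<and> (\<forall>c v. f (\<lambda>p. c * v p) = c * f v)"
  by (simp add: dual_carrier linear_form_def)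

lemma linear_expand:
  assumes "f \<in> carrier W"
  shows "f v = (\<Sum>a\<in>UNIV. f (basis a) * v a)"
proof -
  have f: "f (\<lambda>p. v p + w p) = f v + f w" "f (\<lambda>p. c * v p) = c * f v" for v w c
    using assms by (auto simp: carrier_W)
  have expand: "f (\<lambda>p. \<Sum>a\<in>A. v a * basis a p) = (\<Sum>a\<in>A. f (basis a) * v a)" if "finite A" for A
    using that
  proof (induction A rule: finite_induct)
    case empty
    show ?case using f(2)[of 0 "\<lambda>_. 0"] by simp
  next
    case (insert a A)
    then show ?case using f by (simp add: mult.commute)
  qed
  have "(\<lambda>p. \<Sum>a\<in>UNIV. v a * basis a p) = v"
  proof
    fix p
    have "(\<Sum>a\<in>UNIV. v a * basis a p) = (\<Sum>a\<in>UNIV. if p = a then v a else 0)"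
      by (intro sum.cong) (auto simp: basis_def)
    then show "(\<Sum>a\<in>UNIV. v a * basis a p) = v p" by simp
  qed
  then show ?thesis using expand[OF finite_index] by simp
qed

definition dual_basis :: "'b \<times> bool \<Rightarrow> ('b \<times> bool \<Rightarrow> 'k) \<Rightarrow> 'k" where
  "dual_basis a v = v a"

lemma dual_basis_carrier: "dual_basis a \<in> carrier W"
  by (simp add: carrier_W dual_basis_def)

lemma sum_carrier: "finite A \<Longrightarrow> (\<lambda>v. \<Sum>a\<in>A. c a * dual_basis a v) \<in> carrier W"
  by (simp add: carrier_W dual_basis_def sum.distrib sum_distrib_left algebra_simps)

lemma ltree_zero:
  assumes "g \<in> carrier W" "\<sigma> permutes {..<3}"
  shows "dual.cong3 (basis (ltree (\<lambda>_. 0) g \<sigma>)) (\<lambda>_. 0)" "dual.cong3 (basis (ltree g (\<lambda>_. 0) \<sigma>)) (\<lambda>_. 0)"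
  using dual.ltree_smult_outer[OF assms(2,1,1), of 0] dual.ltree_smult_inner[OF assms(2,1,1), of 0]
  by simp_all

lemma ltree_sum_outer:
  assumes "finite A" and g: "g \<in> carrier W" and \<sigma>: "\<sigma> permutes {..<3}"
  shows "dual.cong3 (basis (ltree (\<lambda>v. \<Sum>a\<in>A. c a * dual_basis a v) g \<sigma>))
    (\<lambda>t. \<Sum>a\<in>A. c a * basis (ltree (dual_basis a) g \<sigma>) t)"
  using assms(1)
proof (induction A rule: finite_induct)
  case empty
  then show ?case using ltree_zero[OF g \<sigma>] by simp
next
  case (insert a A)
  let ?f = "\<lambda>v. \<Sum>a\<in>A. c a * dual_basis a v"
  have ca: "(\<lambda>v. c a * dual_basis a v) \<in> carrier W"
    using dual.smult_closed[OF dual_basis_carrier, of "c a" a] by simp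
  have "dual.cong3 (basis (ltree (\<lambda>v. c a * dual_basis a v + ?f v) g \<sigma>))
      (\<lambda>t. basis (ltree (\<lambda>v. c a * dual_basis a v) g \<sigma>) t + basis (ltree ?f g \<sigma>) t)"
    using dual.ltree_add_outer[OF \<sigma> ca sum_carrier[OF insert(1)] g] by simp
  also have "dual.cong3 \<dots> (\<lambda>t. c a * basis (ltree (dual_basis a) g \<sigma>) t +
      (\<Sum>a\<in>A. c a * basis (ltree (dual_basis a) g \<sigma>) t))"
    using dual.ltree_smult_outer[OF \<sigma> dual_basis_carrier g] by (intro dual.cong3_add insert.IH) simp
  finally show ?case using insert(1,2) by simp
qed

lemma ltree_sum_inner:
  assumes "finite A" and g: "g \<in> carrier W" and \<sigma>: "\<sigma> permutes {..<3}"
  shows "dual.cong3 (basis (ltree g (\<lambda>v. \<Sum>a\<in>A. c a * dual_basis a v) \<sigma>))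
    (\<lambda>t. \<Sum>a\<in>A. c a * basis (ltree g (dual_basis a) \<sigma>) t)"
  using assms(1)
proof (induction A rule: finite_induct)
  case empty
  then show ?case using ltree_zero[OF g \<sigma>] by simp
next
  case (insert a A)
  let ?f = "\<lambda>v. \<Sum>a\<in>A. c a * dual_basis a v"
  have ca: "(\<lambda>v. c a * dual_basis a v) \<in> carrier W"
    using dual.smult_closed[OF dual_basis_carrier, of "c a" a] by simp
  have "dual.cong3 (basis (ltree g (\<lambda>v. c a * dual_basis a v + ?f v) \<sigma>))
      (\<lambda>t. basis (ltree g (\<lambda>v. c a * dual_basis a v) \<sigma>) t + basis (ltree g ?f \<sigma>) t)"
    using dual.ltree_add_inner[OF \<sigma> g ca sum_carrier[OF insert(1)]] by simp
  also have "dual.cong3 \<dots> (\<lambda>t. c a * basis (ltree g (dual_basis a) \<sigma>) t +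
      (\<Sum>a\<in>A. c a * basis (ltree g (dual_basis a) \<sigma>) t))"
    using dual.ltree_smult_inner[OF \<sigma> g dual_basis_carrier] by (intro dual.cong3_add insert.IH) simp
  finally show ?case using insert(1,2) by simp
qed

text \<open>Evaluation at \<open>basis a\<close> reads off the coefficient of
  \<open>dual_basis a\<close>, so these are the coefficients with respect to tensors of dual basis
  vectors.\<close>

abbreviation coord :: "'b \<times> bool \<Rightarrow> 'b \<times> bool \<Rightarrow> nat \<Rightarrow> (('b \<times> bool \<Rightarrow> 'k) \<Rightarrow> 'k, nat) btree \<Rightarrow> 'k" where
  "coord a b k \<equiv> dual.coord3 (\<lambda>f. f (basis a)) (\<lambda>f. f (basis b)) k"

text \<open>After rewriting to normal form, the outer and the inner vertex are expanded in the
  finite dual basis. The sum runs over all copies \<open>k\<close>, so that its range does not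
  depend on the tree and the expansion can be extended linearly.\<close>

lemma basis_tree_expand:
  assumes s: "s \<in> trees (carrier W) 3"
  shows "dual.cong3 (basis s) (\<lambda>t. \<Sum>k<3. \<Sum>a\<in>UNIV. \<Sum>b\<in>UNIV.
    coord a b k s * basis (ltree (dual_basis a) (dual_basis b) (rot k)) t)"
proof -
  obtain f g k where c: "left_comb (flip W) s = (f, g, k)" by (metis prod_cases3)
  have fg: "f \<in> carrier W" "g \<in> carrier W" and k: "k < 3"
    using left_comb_closed[OF s dual.flip_closed c] by simp_all
  have ex: "(\<lambda>v. \<Sum>a\<in>UNIV. f' (basis a) * dual_basis a v) = f'" if "f' \<in> carrier W" for f'
    by (rule ext) (simp add: dual_basis_def linear_expand[OF that, symmetric])
  have "dual.cong3 (basis s) (basis (ltree f g (rot k)))"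
    by (rule dual.left_comb_normal[OF s c])
  also have "dual.cong3 \<dots> (\<lambda>t. \<Sum>a\<in>UNIV. f (basis a) * basis (ltree (dual_basis a) g (rot k)) t)"
    using ltree_sum_outer[OF finite_index fg(2) rot_permutes[of k], where c = "\<lambda>a. f (basis a)"]
    by (simp only: ex[OF fg(1)])
  also have "dual.cong3 \<dots> (\<lambda>t. \<Sum>a\<in>UNIV. f (basis a) *
      (\<Sum>b\<in>UNIV. g (basis b) * basis (ltree (dual_basis a) (dual_basis b) (rot k)) t))"
  proof (rule dual.cong3_sum[OF finite_index])
    fix a
    show "dual.cong3 (basis (ltree (dual_basis a) g (rot k)))
        (\<lambda>t. \<Sum>b\<in>UNIV. g (basis b) * basis (ltree (dual_basis a) (dual_basis b) (rot k)) t)"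
      using ltree_sum_inner[OF finite_index dual_basis_carrier[of a] rot_permutes[of k],
          where c = "\<lambda>b. g (basis b)"]
      by (simp only: ex[OF fg(2)])
  qed
  also have "(\<lambda>t. \<Sum>a\<in>UNIV. f (basis a) *
      (\<Sum>b\<in>UNIV. g (basis b) * basis (ltree (dual_basis a) (dual_basis b) (rot k)) t)) =
     (\<lambda>t. \<Sum>l<3. \<Sum>a\<in>UNIV. \<Sum>b\<in>UNIV.
       coord a b l s * basis (ltree (dual_basis a) (dual_basis b) (rot l)) t)"
  proof
    fix t
    \<comment> \<open>Only the copy in which the normal form lies contributes.\<close>
    have "(\<Sum>l<3. \<Sum>a\<in>UNIV. \<Sum>b\<in>UNIV.
        coord a b l s * basis (ltree (dual_basis a) (dual_basis b) (rot l)) t) =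
      (\<Sum>l<3. if l = k then \<Sum>a\<in>UNIV. \<Sum>b\<in>UNIV. f (basis a) * g (basis b) *
        basis (ltree (dual_basis a) (dual_basis b) (rot k)) t else 0)"
      by (intro sum.cong) (auto simp: dual.coord3_def c)
    also have "\<dots> = (\<Sum>a\<in>UNIV. \<Sum>b\<in>UNIV. f (basis a) * g (basis b) *
        basis (ltree (dual_basis a) (dual_basis b) (rot k)) t)"
      using k by simp
    finally show "(\<Sum>a\<in>UNIV. f (basis a) *
        (\<Sum>b\<in>UNIV. g (basis b) * basis (ltree (dual_basis a) (dual_basis b) (rot k)) t)) =
      (\<Sum>l<3. \<Sum>a\<in>UNIV. \<Sum>b\<in>UNIV.
        coord a b l s * basis (ltree (dual_basis a) (dual_basis b) (rot l)) t)"
      by (simp add: sum_distrib_left mult.assoc)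
  qed
  finally show ?thesis .
qed

text \<open>Expanding every tree of \<open>x\<close> leaves sums of coordinates as coefficients.
  This is the converse of \<open>coord3_free_ideal\<close>: coordinates separate the points of
  F(W)(3).\<close>

lemma coord_zero_ideal:
  assumes x: "x \<in> tree_ops (carrier W) 3"
    and zero: "\<And>a b k. k < 3 \<Longrightarrow> ev (coord a b k) x = 0"
  shows "x \<in> free_ideal W 3"
proof -
  let ?F = "\<lambda>s t. \<Sum>k<3. \<Sum>a\<in>UNIV. \<Sum>b\<in>UNIV.
    coord a b k s * basis (ltree (dual_basis a) (dual_basis b) (rot k)) t"
  have "dual.cong3 x (lin ?F x)"
    using basis_tree_expand tree_opsD[OF x] by (intro dual.cong3_lin) auto
  moreover have "lin ?F x = (\<lambda>_. 0)"
    unfolding lin_def ev_sum_fun ev_mult_fun using zero by simp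
  ultimately show ?thesis by (simp add: dual.cong3_def)
qed

abbreviation mul :: "'b \<Rightarrow> 'b \<times> bool \<Rightarrow> 'k" where "mul b \<equiv> basis (b, False)"

lemma flip_basis: "flip V (basis (b, e)) = basis (b, \<not> e)"
  by (auto simp: basis_def fun_eq_iff)

text \<open>Coordinates at opposites are reached by monomials in the multiplications themselves: a
  right comb flips its root, and an inner pair that is not cyclic flips the inner vertex.\<close>

lemma pairing_zero_ideal:
  assumes x: "x \<in> tree_ops (carrier W) 3"
    and l: "\<And>b b' \<sigma>. \<sigma> permutes {..<3} \<Longrightarrow> formal_pairing V x (basis (ltree (mul b) (mul b') \<sigma>)) = 0"
    and r: "\<And>b b' \<sigma>. \<sigma> permutes {..<3} \<Longrightarrow> formal_pairing V x (basis (rtree (mul b) (mul b') \<sigma>)) = 0"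
  shows "x \<in> free_ideal W 3"
proof (rule coord_zero_ideal[OF x])
  fix a b :: "'b \<times> bool" and k :: nat assume k: "k < 3"
  obtain a' e b' e' where ab: "a = (a', e)" "b = (b', e')" by (cases a, cases b)
  \<comment> \<open>The orientation is chosen so that the inner vertex is flipped exactly when
    \<open>b\<close> is an opposite.\<close>
  have "\<exists>i j. distinct [i, j, k] \<and> {i, j, k} = {..<3} \<and> (cyc i j \<longleftrightarrow> \<not> e')"
    by (rule ex_cyc[OF k])
  then obtain i j where ij: "distinct [i, j, k]" "{i, j, k} = {..<3}" "cyc i j \<longleftrightarrow> \<not> e'" by blast
  have t: "\<exists>t. left_comb (flip V) t = (basis a, basis b, k) \<and> formal_pairing V x (basis t) = 0"
  proof (cases e)
    case False
    obtain \<sigma> where "\<sigma> permutes {..<3}" "\<sigma> 0 = i" "\<sigma> 1 = j" "\<sigma> 2 = k" using ex_permutation_3[OF ij(1,2)] .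
    then show ?thesis using False l[of \<sigma> a' b'] ij(3) unfolding ab
      by (intro exI[of _ "ltree (mul a') (mul b') \<sigma>"]) (simp add: left_comb_cyc flip_basis del: left_comb.simps V_simps One_nat_def)
  next
    case True
    have "distinct [k, i, j]" "{k, i, j} = {..<3}"
      using ij(1) trans[OF _ ij(2), of "{k, i, j}"] by auto
    then obtain \<sigma> where "\<sigma> permutes {..<3}" "\<sigma> 0 = k" "\<sigma> 1 = i" "\<sigma> 2 = j" using ex_permutation_3[of k i j] by blast
    then show ?thesis using True r[of \<sigma> a' b'] ij(3) unfolding ab
      by (intro exI[of _ "rtree (mul a') (mul b') \<sigma>"]) (simp add: left_comb_cyc flip_basis del: left_comb.simps V_simps One_nat_def)
  qed
  then show "ev (coord a b k) x = 0"
    using tree_pairing_dual_coord3 by (auto simp: formal_pairing_basis)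
qed

end


section \<open>The orthogonal complement\<close>

text \<open>With one value fixed, only the transposition of the other two remains, and it changes
  the parity. The positions 0 and 2 are those of the outer leaf in right and left combs.\<close>

lemma permutes_3_eqI:
  fixes \<sigma> \<tau> :: "nat \<Rightarrow> nat"
  assumes \<sigma>: "\<sigma> permutes {..<3}" and \<tau>: "\<tau> permutes {..<3}"
    and "\<sigma> 0 = \<tau> 0 \<or> \<sigma> 2 = \<tau> 2" "cyc (\<sigma> 0) (\<sigma> 1) \<longleftrightarrow> cyc (\<tau> 0) (\<tau> 1)"
  shows "\<sigma> = \<tau>"
proof
  fix l :: nat
  have c: "cyc 0 1" "cyc 1 2" "cyc 2 0" "\<not> cyc 1 0" "\<not> cyc 2 1" "\<not> cyc 0 2"
    by (simp_all add: cyc_def)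
  have *: "\<sigma> 0 = \<tau> 0 \<and> \<sigma> 1 = \<tau> 1 \<and> \<sigma> 2 = \<tau> 2"
    using permutes_3_cases[OF \<sigma>] permutes_3_cases[OF \<tau>] assms(3,4) c
    unfolding insert_iff prod.inject empty_iff by (elim disjE conjE FalseE) (simp_all del: One_nat_def)
  consider "l = 0" | "l = 1" | "l = 2" | "l \<notin> {..<3}" by fastforce
  then show "\<sigma> l = \<tau> l"
    by cases (use * permutes_not_in[OF \<sigma>, of l] permutes_not_in[OF \<tau>, of l] in auto)
qed

lemma cyc_rotate:
  assumes "\<sigma> permutes {..<3}"
  shows "cyc (\<sigma> 1) (\<sigma> 2) \<longleftrightarrow> cyc (\<sigma> 0) (\<sigma> 1)" "cyc (\<sigma> 2) (\<sigma> 0) \<longleftrightarrow> cyc (\<sigma> 0) (\<sigma> 1)"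
  using cyc_permutes[OF assms, of 1 2] cyc_permutes[OF assms, of 2 0] by (simp_all add: cyc_def)

lemma relabel_ltree:
  "relabel \<sigma> (ltree v w id) = ltree v w \<sigma>" "relabel \<sigma> (rtree v w id) = rtree v w \<sigma>"
  by simp_all

section \<open>Generators, their products and the action on representatives\<close>

context s2_rep
begin

lemma gen_cls: "gen V v = free.cls 2 (corolla v)"
  by (simp add: gen_def)

lemma gen_mul:
  assumes "v \<in> carrier V" "w \<in> carrier V"
  shows "pcomp (free_operad V) 2 2 0 (gen V v) (gen V w) = free.cls 3 (basis (ltree v w id))"
    "pcomp (free_operad V) 2 2 1 (gen V v) (gen V w) = free.cls 3 (basis (rtree v w id))"
  using free.pcomp_quot[of 0 2 "corolla v" "corolla w" 2] free.pcomp_quot[of 1 2 "corolla v" "corolla w" 2]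
    corolla_ops[OF assms(1)] corolla_ops[OF assms(2)]
  unfolding gen_cls free_operad_def
  by (simp_all add: corolla_def pcomp_tree_operad graft_corolla del: graft.simps One_nat_def)

lemma gen_add:
  assumes "v \<in> carrier V" "w \<in> carrier V"
  shows "gen V v \<oplus>\<^bsub>space (free_operad V) 2\<^esub> gen V w = gen V (v \<oplus>\<^bsub>V\<^esub> w)"
proof -
  have ops: "corolla u \<in> tree_ops (carrier V) 2" if "u \<in> carrier V" for u
    using corolla_ops[OF that] by (simp add: corolla_def)
  have "gen V v \<oplus>\<^bsub>space (free_operad V) 2\<^esub> gen V w = free.cls 2 (\<lambda>t. corolla v t + corolla w t)"
    using free.quot.add_quot[of "corolla v" 2 "corolla w"] assms
    by (simp add: gen_cls free_operad_def free.space_quot ops)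
  also have "\<dots> = free.cls 2 (corolla (v \<oplus>\<^bsub>V\<^esub> w))"
    using free.quot.cls_eqI[OF _ relation_add[OF assms], of "\<lambda>t. corolla v t + corolla w t"]
    by (simp add: tree_ops_add ops assms)
  finally show ?thesis by (simp add: gen_cls)
qed

lemma free_cls_diff:
  assumes "x \<in> tree_ops (carrier V) n" "y \<in> tree_ops (carrier V) n"
  shows "free.cls n x \<ominus>\<^bsub>space (free_operad V) n\<^esub> free.cls n y = free.cls n (\<lambda>t. x t - y t)"
proof -
  have "a_inv (space (tree_operad (carrier V)) n) y = (\<lambda>t. - 1 * y t)"
    using smult_minus_one[OF tree.vector_space, of y n] assms(2) by simp
  then show ?thesis
    using free.quot.diff_quot[of x n y] assms by (simp add: a_minus_def free_operad_def free.space_quot)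
qed

lemma gen_assoc:
  assumes "u \<in> carrier V" "v \<in> carrier V" "w \<in> carrier V" "z \<in> carrier V"
  shows "pcomp (free_operad V) 2 2 0 (gen V u) (gen V v) \<ominus>\<^bsub>space (free_operad V) 3\<^esub>
      pcomp (free_operad V) 2 2 1 (gen V w) (gen V z) =
    free.cls 3 (\<lambda>t. basis (ltree u v id) t - basis (rtree w z id) t)"
  using assms ltree_trees[of _ "carrier V" _ id] permutes_id
  by (simp add: gen_mul free_cls_diff basis_tree_ops del: One_nat_def id_apply)

lemma act_cls: "\<sigma> permutes {..<n} \<Longrightarrow> y \<in> tree_ops (carrier V) n \<Longrightarrow>
    act (free_operad V) n \<sigma> (free.cls n y) = free.cls n (act (tree_operad (carrier V)) n \<sigma> y)"
  using free.act_quot[of \<sigma> n y] by (simp add: free_operad_def)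

lemma space_cls:
  "ops (free_operad V) n = free.cls n ` tree_ops (carrier V) n"
  "\<zero>\<^bsub>space (free_operad V) n\<^esub> = free.cls n (\<lambda>_. 0)"
  "x \<in> tree_ops (carrier V) n \<Longrightarrow> y \<in> tree_ops (carrier V) n \<Longrightarrow>
    free.cls n x \<oplus>\<^bsub>space (free_operad V) n\<^esub> free.cls n y = free.cls n (\<lambda>t. x t + y t)"
  "x \<in> tree_ops (carrier V) n \<Longrightarrow> c \<odot>\<^bsub>space (free_operad V) n\<^esub> free.cls n x = free.cls n (\<lambda>t. c * x t)"
  using free.quot.add_quot[of x n y] free.quot.smult_quot[of x n c] free.quot.zero_quot[of n]
  by (simp_all add: free_operad_def free.space_quot free.quot.carrier_quot)

lemma act_ops: "\<sigma> permutes {..<n} \<Longrightarrow> y \<in> tree_ops (carrier V) n \<Longrightarrow> act (tree_operad (carrier V)) n \<sigma> y \<in> tree_ops (carrier V) n"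
  using tree.act_closed[of \<sigma> n y] by simp

end

lemma zero_ops: "(\<lambda>_. 0) \<in> tree_ops S n"
  by (simp add: tree_ops_def)

section \<open>Associators against dialgebra relations\<close>

context regular_dual
begin

text \<open>Rewriting \<open>carrier V\<close> inside \<open>tree_operad (carrier V)\<close> would block the general facts about
  \<^const>\<open>free_operad\<close>.\<close>

declare carrier_V [simp del]

definition sgn3 :: "(nat \<Rightarrow> nat) \<Rightarrow> 'k" where
  "sgn3 \<sigma> = (if cyc (\<sigma> 0) (\<sigma> 1) then 1 else - 1)"

definition total :: "('b \<times> bool \<Rightarrow> 'k) \<Rightarrow> 'k" where
  "total v = (\<Sum>b\<in>UNIV. v (b, False))"

lemma total_carrier: "total \<in> carrier W"
  by (simp add: carrier_W total_def sum.distrib sum_distrib_left)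

lemma total_basis: "total (basis (b, e)) = (if e then 0 else 1)"
proof -
  have "total (basis (b, e)) = (\<Sum>c\<in>UNIV. if c = b then if e then 0 else 1 else 0)"
    unfolding total_def by (intro sum.cong) (auto simp: basis_def)
  then show ?thesis using finite_ops by simp
qed

lemma flip_total_basis: "flip W total (basis (b, e)) = (if e then - 1 else 0)"
  using flip_basis[of b e] total_basis[of b "\<not> e"] by (simp add: carrier_V)

lemmas comb_simps = left_comb_cyc flip_basis total_basis flip_total_basis

text \<open>\<open>total\<close> is 1 on multiplications and 0 on opposites, its flip is 0 and - 1.
  So a nonzero value needs equal shape, equal outer leaf and equal parity, which forces \<sigma> =
  \<tau>. A flipped inner vertex (odd \<sigma>) and a flipped root (right comb) each contribute a
  factor - 1.\<close>

lemma tree_pairing_total: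
  assumes \<sigma>: "\<sigma> permutes {..<3}" and \<tau>: "\<tau> permutes {..<3}"
  shows "tree_pairing V (ltree total total \<sigma>) (ltree (mul b) (mul b') \<tau>) = (if \<sigma> = \<tau> then sgn3 \<sigma> else 0)"
    "tree_pairing V (ltree total total \<sigma>) (rtree (mul b) (mul b') \<tau>) = 0"
    "tree_pairing V (rtree total total \<sigma>) (ltree (mul b) (mul b') \<tau>) = 0"
    "tree_pairing V (rtree total total \<sigma>) (rtree (mul b) (mul b') \<tau>) = (if \<sigma> = \<tau> then - sgn3 \<sigma> else 0)"
  using permutes_3_eqI[OF \<sigma> \<tau>]
  by (auto simp: tree_pairing_def comb_simps sgn3_def cyc_rotate[OF \<sigma>] cyc_rotate[OF \<tau>]
      simp del: left_comb.simps V_simps sgn_dual_simps One_nat_def)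

definition assoc_rel :: "(nat \<Rightarrow> nat) \<Rightarrow> (('b \<times> bool \<Rightarrow> 'k) \<Rightarrow> 'k, nat) btree \<Rightarrow> 'k" where
  "assoc_rel \<sigma> = (\<lambda>t. basis (ltree total total \<sigma>) t - basis (rtree total total \<sigma>) t)"

lemma assoc_rel_ops: "\<sigma> permutes {..<3} \<Longrightarrow> assoc_rel \<sigma> \<in> tree_ops (carrier W) 3"
  unfolding assoc_rel_def by (intro tree_ops_diff basis_tree_ops ltree_trees total_carrier)

text \<open>The minus sign of the associator cancels the sign of the right comb, so left and right
  monomials get the same value.\<close>

lemma pairing_assoc_rel:
  assumes \<sigma>: "\<sigma> permutes {..<3}" and \<tau>: "\<tau> permutes {..<3}"
  shows "formal_pairing V (assoc_rel \<sigma>) (basis (ltree (mul b) (mul b') \<tau>)) = (if \<sigma> = \<tau> then sgn3 \<sigma> else 0)"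
    "formal_pairing V (assoc_rel \<sigma>) (basis (rtree (mul b) (mul b') \<tau>)) = (if \<sigma> = \<tau> then sgn3 \<sigma> else 0)"
  unfolding formal_pairing_basis assoc_rel_def ev_diff[OF fin_basis fin_basis] ev_basis
    tree_pairing_total[OF \<sigma> \<tau>] by simp_all

definition dialgebra_rel ::
  "'b \<Rightarrow> 'b \<Rightarrow> 'b \<Rightarrow> 'b \<Rightarrow> (nat \<Rightarrow> nat) \<Rightarrow> ('b \<times> bool \<Rightarrow> 'k, nat) btree \<Rightarrow> 'k" where
  "dialgebra_rel b b' c c' \<sigma> =
    (\<lambda>t. basis (ltree (mul b) (mul b') \<sigma>) t - basis (rtree (mul c) (mul c') \<sigma>) t)"

lemma dialgebra_rel_ops: "\<sigma> permutes {..<3} \<Longrightarrow> dialgebra_rel b b' c c' \<sigma> \<in> tree_ops (carrier V) 3"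
  unfolding dialgebra_rel_def by (intro tree_ops_diff basis_tree_ops ltree_trees) (simp_all add: carrier_V)

lemma act_rels:
  assumes \<sigma>: "\<sigma> permutes {..<3}"
  shows "act (tree_operad S) 3 \<sigma> (dialgebra_rel b b' c c' id) = dialgebra_rel b b' c c' (pinv \<sigma>)"
    "act (tree_operad S') 3 \<sigma> (assoc_rel id) = assoc_rel (pinv \<sigma>)"
proof -
  have *: "act (tree_operad S) 3 \<sigma> (\<lambda>t. x t - y t) =
      (\<lambda>t. act (tree_operad S) 3 \<sigma> x t - act (tree_operad S) 3 \<sigma> y t :: 'k)" for S and x y :: "('x, nat) btree \<Rightarrow> 'k"
    by (simp add: act_tree_operad)
  show "act (tree_operad S) 3 \<sigma> (dialgebra_rel b b' c c' id) = dialgebra_rel b b' c c' (pinv \<sigma>)"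
    unfolding dialgebra_rel_def * act_basis[OF \<sigma>] relabel_ltree ..
  show "act (tree_operad S') 3 \<sigma> (assoc_rel id) = assoc_rel (pinv \<sigma>)"
    unfolding assoc_rel_def * act_basis[OF \<sigma>] relabel_ltree ..
qed

definition dialgebra_rels :: "(('b \<times> bool \<Rightarrow> 'k, nat) btree \<Rightarrow> 'k) set set" where
  "dialgebra_rels = {free.cls 3 (dialgebra_rel b b' c c' id) | b b' c c'. True}"

sublocale FV: symmetric_operad "free_operad V" by (rule symmetric_free)
sublocale FW: symmetric_operad "free_operad W" by (rule dual.symmetric_free)

lemma dialgebra_rels_ops: "dialgebra_rels \<subseteq> ops (free_operad V) 3"
  using dialgebra_rel_ops[OF permutes_id] by (auto simp: dialgebra_rels_def space_cls)

text \<open>The span contains the translates of the relations to every labelling \<sigma>, which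
  gives one direction. For the other, the classes whose translates all pair to zero with
  \<open>x\<close> form a submodule containing the relations.\<close>

lemma orthogonal_iff:
  assumes x: "x \<in> tree_ops (carrier W) 3"
  shows "(\<forall>Y\<in>sym_span (free_operad V) 3 dialgebra_rels. pairing V (dual.free.cls 3 x) Y = 0) \<longleftrightarrow>
    (\<forall>b b' c c' \<sigma>. \<sigma> permutes {..<3} \<longrightarrow> formal_pairing V x (basis (ltree (mul b) (mul b') \<sigma>)) =
       formal_pairing V x (basis (rtree (mul c) (mul c') \<sigma>)))" (is "?lhs \<longleftrightarrow> ?rhs")
proof -
  have *: "formal_pairing V x (dialgebra_rel b b' c c' \<sigma>) =
      formal_pairing V x (basis (ltree (mul b) (mul b') \<sigma>)) -
      formal_pairing V x (basis (rtree (mul c) (mul c') \<sigma>))" for b b' c c' \<sigma>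
    by (simp only: dialgebra_rel_def formal_pairing_diff_right fin_basis)
  show ?thesis
  proof
    assume L: ?lhs
    show ?rhs
    proof (intro allI impI)
      fix b b' c c' \<sigma> assume \<sigma>: "\<sigma> permutes {..<3::nat}"
      have "free.cls 3 (dialgebra_rel b b' c c' id) \<in> sym_span (free_operad V) 3 dialgebra_rels"
        by (rule subsetD[OF FV.sym_span_superset]) (unfold dialgebra_rels_def, blast)
      then have "act (free_operad V) 3 (pinv \<sigma>) (free.cls 3 (dialgebra_rel b b' c c' id))
          \<in> sym_span (free_operad V) 3 dialgebra_rels"
        using FV.sym_submodule_span[OF dialgebra_rels_ops] permutes_inv[OF \<sigma>]
        unfolding FV.sym_submodule_iff by blast
      then have "free.cls 3 (dialgebra_rel b b' c c' \<sigma>) \<in> sym_span (free_operad V) 3 dialgebra_rels"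
        by (simp add: act_cls[OF permutes_inv[OF \<sigma>] dialgebra_rel_ops[OF permutes_id]]
            act_rels[OF permutes_inv[OF \<sigma>]] permutes_inv_inv[OF \<sigma>])
      then have "formal_pairing V x (dialgebra_rel b b' c c' \<sigma>) = 0"
        using L pairing_cls[OF x dialgebra_rel_ops[OF \<sigma>]] by metis
      then show "formal_pairing V x (basis (ltree (mul b) (mul b') \<sigma>)) =
          formal_pairing V x (basis (rtree (mul c) (mul c') \<sigma>))" unfolding * by simp
    qed
  next
    assume R: ?rhs
    \<comment> \<open>Asking this of all translates, and not just of \<open>y\<close>, makes
      \<open>N\<close> stable under permutations; the identity recovers the pairing with
      \<open>y\<close>.\<close>
    define N where "N = {free.cls 3 y | y. y \<in> tree_ops (carrier V) 3 \<and>
      (\<forall>\<sigma>. \<sigma> permutes {..<3} \<longrightarrow> formal_pairing V x (act (tree_operad (carrier V)) 3 \<sigma> y) = 0)}"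
    have "sym_submodule (free_operad V) 3 N"
      unfolding FV.sym_submodule_iff
    proof (intro conjI ballI allI impI)
      show "N \<subseteq> ops (free_operad V) 3" by (auto simp: N_def space_cls)
      have "formal_pairing V x (\<lambda>_. 0) = 0" by (simp add: formal_pairing_ev)
      then show "\<zero>\<^bsub>space (free_operad V) 3\<^esub> \<in> N"
        unfolding N_def space_cls mem_Collect_eq
        by (intro exI[of _ "\<lambda>_. 0"]) (simp add: zero_ops act_tree_operad)
    next
      fix A B assume "A \<in> N" "B \<in> N"
      then obtain y z where y: "A = free.cls 3 y" "y \<in> tree_ops (carrier V) 3"
          "\<And>\<sigma>. \<sigma> permutes {..<3} \<Longrightarrow> formal_pairing V x (act (tree_operad (carrier V)) 3 \<sigma> y) = 0"
        and z: "B = free.cls 3 z" "z \<in> tree_ops (carrier V) 3"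
          "\<And>\<sigma>. \<sigma> permutes {..<3} \<Longrightarrow> formal_pairing V x (act (tree_operad (carrier V)) 3 \<sigma> z) = 0"
        unfolding N_def by blast
      have "formal_pairing V x (act (tree_operad (carrier V)) 3 \<sigma> (\<lambda>t. y t + z t)) = 0" if \<sigma>: "\<sigma> permutes {..<3}" for \<sigma>
      proof -
        have "act (tree_operad (carrier V)) 3 \<sigma> (\<lambda>t. y t + z t) =
            (\<lambda>t. act (tree_operad (carrier V)) 3 \<sigma> y t + act (tree_operad (carrier V)) 3 \<sigma> z t)"
          by (simp add: act_tree_operad)
        then show ?thesis
          using formal_pairing_add_right[OF tree_opsD(1)[OF act_ops[OF \<sigma> y(2)]] tree_opsD(1)[OF act_ops[OF \<sigma> z(2)]]]
            y(3)[OF \<sigma>] z(3)[OF \<sigma>] by simp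
      qed
      then show "A \<oplus>\<^bsub>space (free_operad V) 3\<^esub> B \<in> N"
        unfolding y(1) z(1) space_cls(3)[OF y(2) z(2)] N_def using tree_ops_add[OF y(2) z(2)] by blast
    next
      fix c A assume "A \<in> N"
      then obtain y where y: "A = free.cls 3 y" "y \<in> tree_ops (carrier V) 3"
          "\<And>\<sigma>. \<sigma> permutes {..<3} \<Longrightarrow> formal_pairing V x (act (tree_operad (carrier V)) 3 \<sigma> y) = 0"
        unfolding N_def by blast
      have "formal_pairing V x (act (tree_operad (carrier V)) 3 \<sigma> (\<lambda>t. c * y t)) = 0" if "\<sigma> permutes {..<3}" for \<sigma>
        using y(3)[OF that] by (simp add: act_tree_operad formal_pairing_smult_right)
      then show "c \<odot>\<^bsub>space (free_operad V) 3\<^esub> A \<in> N"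
        unfolding y(1) space_cls(4)[OF y(2)] N_def using tree_ops_smult[OF y(2)] by blast
    next
      fix \<tau> A assume "A \<in> N" and \<tau>: "\<tau> permutes {..<3::nat}"
      then obtain y where y: "A = free.cls 3 y" "y \<in> tree_ops (carrier V) 3"
          "\<And>\<sigma>. \<sigma> permutes {..<3} \<Longrightarrow> formal_pairing V x (act (tree_operad (carrier V)) 3 \<sigma> y) = 0"
        unfolding N_def by blast
      have "formal_pairing V x (act (tree_operad (carrier V)) 3 \<sigma> (act (tree_operad (carrier V)) 3 \<tau> y)) = 0"
        if \<sigma>: "\<sigma> permutes {..<3}" for \<sigma>
        using y(3)[OF permutes_compose[OF \<sigma> \<tau>]] tree.act_comp[OF \<tau> \<sigma>, of y] y(2) by simp
      then show "act (free_operad V) 3 \<tau> A \<in> N"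
        unfolding y(1) act_cls[OF \<tau> y(2)] N_def using act_ops[OF \<tau> y(2)] by blast
    qed
    moreover have "dialgebra_rels \<subseteq> N"
    proof -
      have "formal_pairing V x (act (tree_operad (carrier V)) 3 \<sigma> (dialgebra_rel b b' c c' id)) = 0"
        if \<sigma>: "\<sigma> permutes {..<3}" for \<sigma> b b' c c'
        unfolding act_rels[OF \<sigma>] * using R permutes_inv[OF \<sigma>] by simp
      then show ?thesis unfolding dialgebra_rels_def N_def using dialgebra_rel_ops[OF permutes_id] by blast
    qed
    ultimately have sub: "sym_span (free_operad V) 3 dialgebra_rels \<subseteq> N" by (rule FV.sym_span_least)
    show ?lhs
    proof
      fix Y assume "Y \<in> sym_span (free_operad V) 3 dialgebra_rels"
      then obtain y where y: "Y = free.cls 3 y" "y \<in> tree_ops (carrier V) 3"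
          "\<And>\<sigma>. \<sigma> permutes {..<3} \<Longrightarrow> formal_pairing V x (act (tree_operad (carrier V)) 3 \<sigma> y) = 0"
        using sub unfolding N_def by blast
      then show "pairing V (dual.free.cls 3 x) Y = 0"
        using y(3)[OF permutes_id] tree.act_id[of y 3] by (simp add: pairing_cls[OF x])
    qed
  qed
qed

text \<open>The orthogonal complement on representatives, tested only against monomials in the
  multiplications.\<close>

definition orthogonal :: "((('b \<times> bool \<Rightarrow> 'k) \<Rightarrow> 'k, nat) btree \<Rightarrow> 'k) set" where
  "orthogonal = {x \<in> tree_ops (carrier W) 3. \<forall>b b' c c' \<sigma>. \<sigma> permutes {..<3} \<longrightarrow>
     formal_pairing V x (basis (ltree (mul b) (mul b') \<sigma>)) =
     formal_pairing V x (basis (rtree (mul c) (mul c') \<sigma>))}"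

abbreviation "perms3 \<equiv> {\<sigma>. \<sigma> permutes {..<3::nat}}"

lemma finite_perms3: "finite perms3"
  by (rule finite_permutations) simp

lemma formal_pairing_sum_left:
  "finite A \<Longrightarrow> (\<And>i. i \<in> A \<Longrightarrow> fin (F i)) \<Longrightarrow>
    fin (\<lambda>t. \<Sum>i\<in>A. c i * F i t) \<and>
    formal_pairing V (\<lambda>t. \<Sum>i\<in>A. c i * F i t) y = (\<Sum>i\<in>A. c i * formal_pairing V (F i) y)"
proof (induction A rule: finite_induct)
  case empty
  then show ?case by (simp add: formal_pairing_ev)
next
  case (insert a A)
  have "fin (\<lambda>t. c a * F a t)" using insert.prems by (intro fin_smult) simp
  then show ?case using insert
    by (simp add: fin_add formal_pairing_add_left formal_pairing_smult_left)
qed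

lemma cls_sum_closed:
  assumes N: "sym_submodule (free_operad W) 3 N"
    and F: "\<And>i. i \<in> A \<Longrightarrow> F i \<in> tree_ops (carrier W) 3 \<and> dual.free.cls 3 (F i) \<in> N" and "finite A"
  shows "(\<lambda>t. \<Sum>i\<in>A. c i * F i t) \<in> tree_ops (carrier W) 3 \<and> dual.free.cls 3 (\<lambda>t. \<Sum>i\<in>A. c i * F i t) \<in> N"
  using assms(3) F
proof (induction A rule: finite_induct)
  case empty
  then show ?case using N zero_ops by (simp add: FW.sym_submodule_iff dual.space_cls)
next
  case (insert a A)
  let ?x = "\<lambda>t. c a * F a t" and ?y = "\<lambda>t. \<Sum>i\<in>A. c i * F i t"
  have Fa: "F a \<in> tree_ops (carrier W) 3" "dual.free.cls 3 (F a) \<in> N" using insert.prems[of a] by simp_all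
  have IH: "?y \<in> tree_ops (carrier W) 3" "dual.free.cls 3 ?y \<in> N" using insert by simp_all
  have x: "?x \<in> tree_ops (carrier W) 3" by (rule tree_ops_smult[OF Fa(1)])
  have "c a \<odot>\<^bsub>space (free_operad W) 3\<^esub> dual.free.cls 3 (F a) \<in> N"
    using N Fa(2) unfolding FW.sym_submodule_iff by blast
  then have "dual.free.cls 3 ?x \<in> N" unfolding dual.space_cls(4)[OF Fa(1)] .
  then have "dual.free.cls 3 ?x \<oplus>\<^bsub>space (free_operad W) 3\<^esub> dual.free.cls 3 ?y \<in> N"
    using N IH(2) unfolding FW.sym_submodule_iff by blast
  then have "dual.free.cls 3 (\<lambda>t. ?x t + ?y t) \<in> N" unfolding dual.space_cls(3)[OF x IH(1)] .
  then show ?case using insert(1,2) tree_ops_add[OF x IH(1)] by simp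
qed

text \<open>A combination \<open>y\<close> of translated associators is built to have the same
  pairings with monomials as \<open>x\<close>; by nondegeneracy both represent the same
  class.\<close>

lemma orthogonal_cls_in:
  assumes x: "x \<in> orthogonal" and N: "sym_submodule (free_operad W) 3 N"
    and r: "dual.free.cls 3 (assoc_rel id) \<in> N"
  shows "dual.free.cls 3 x \<in> N"
proof -
  \<comment> \<open>The value of \<open>x\<close> on a monomial depends only on its labelling, so an
    arbitrary multiplication can be used to read it off.\<close>
  define b0 :: 'b where "b0 = undefined"
  define c where "c \<sigma> = formal_pairing V x (basis (ltree (mul b0) (mul b0) \<sigma>))" for \<sigma>
  \<comment> \<open>The coefficient contains \<open>sgn3 \<sigma>\<close> to cancel the same sign in
    the pairing of \<open>assoc_rel \<sigma>\<close> with monomials labelled by \<sigma>.\<close>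
  define y where "y = (\<lambda>t. \<Sum>\<sigma>\<in>perms3. (sgn3 \<sigma> * c \<sigma>) * assoc_rel \<sigma> t)"
  have xo: "x \<in> tree_ops (carrier W) 3" using x by (simp add: orthogonal_def)
  have c: "formal_pairing V x (basis (rtree (mul b) (mul b') \<sigma>)) = c \<sigma>"
      "formal_pairing V x (basis (ltree (mul b) (mul b') \<sigma>)) = c \<sigma>" if "\<sigma> permutes {..<3}" for b b' \<sigma>
  proof -
    have *: "formal_pairing V x (basis (ltree (mul b) (mul b') \<sigma>)) =
        formal_pairing V x (basis (rtree (mul d) (mul d') \<sigma>))" for b b' d d'
      using x that unfolding orthogonal_def by blast
    show "formal_pairing V x (basis (rtree (mul b) (mul b') \<sigma>)) = c \<sigma>"
      unfolding c_def by (rule *[symmetric])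
    \<comment> \<open>The relations equate left monomials with right ones, so two left monomials are
      compared through a right one.\<close>
    show "formal_pairing V x (basis (ltree (mul b) (mul b') \<sigma>)) = c \<sigma>"
      unfolding c_def by (rule trans[OF *[of b b' b0 b0] *[symmetric]])
  qed
  have rels: "assoc_rel \<sigma> \<in> tree_ops (carrier W) 3 \<and> dual.free.cls 3 (assoc_rel \<sigma>) \<in> N" if "\<sigma> \<in> perms3" for \<sigma>
  proof -
    have \<sigma>: "\<sigma> permutes {..<3}" using that by simp
    have "act (free_operad W) 3 (pinv \<sigma>) (dual.free.cls 3 (assoc_rel id)) \<in> N"
      using N r permutes_inv[OF \<sigma>] unfolding FW.sym_submodule_iff by blast
    then show ?thesis
      using assoc_rel_ops[OF \<sigma>]
      by (simp add: dual.act_cls[OF permutes_inv[OF \<sigma>] assoc_rel_ops[OF permutes_id]]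
          act_rels[OF permutes_inv[OF \<sigma>]] permutes_inv_inv[OF \<sigma>])
  qed
  have "y \<in> tree_ops (carrier W) 3 \<and> dual.free.cls 3 y \<in> N"
    unfolding y_def by (rule cls_sum_closed[OF N rels finite_perms3])
  then have yo: "y \<in> tree_ops (carrier W) 3" and yN: "dual.free.cls 3 y \<in> N" by simp_all
  \<comment> \<open>\<open>y\<close> pairs with all elementary trees as \<open>x\<close> does, because the translates of the associator
    are dual to the permutations up to sign.\<close>
  have sq: "sgn3 \<sigma> * sgn3 \<sigma> = 1" for \<sigma> by (simp add: sgn3_def)
  have fy: "formal_pairing V y z = (\<Sum>\<sigma>\<in>perms3. (sgn3 \<sigma> * c \<sigma>) * formal_pairing V (assoc_rel \<sigma>) z)" for z
    unfolding y_def using tree_opsD(1)[OF assoc_rel_ops]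
    by (intro conjunct2[OF formal_pairing_sum_left[OF finite_perms3]]) simp
  have delta: "(\<Sum>\<sigma>\<in>perms3. (sgn3 \<sigma> * c \<sigma>) * (if \<sigma> = \<tau> then sgn3 \<sigma> else 0)) = c \<tau>"
    if "\<tau> permutes {..<3}" for \<tau>
  proof -
    have "(\<Sum>\<sigma>\<in>perms3. (sgn3 \<sigma> * c \<sigma>) * (if \<sigma> = \<tau> then sgn3 \<sigma> else 0)) =
        (\<Sum>\<sigma>\<in>perms3. if \<sigma> = \<tau> then c \<tau> else 0)"
      using sq by (intro sum.cong) (auto simp: mult.assoc mult.left_commute)
    also have "\<dots> = c \<tau>" using that finite_perms3 by simp
    finally show ?thesis .
  qed
  have y: "formal_pairing V y (basis (ltree (mul b) (mul b') \<tau>)) = c \<tau>"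
      "formal_pairing V y (basis (rtree (mul b) (mul b') \<tau>)) = c \<tau>" if "\<tau> permutes {..<3}" for b b' \<tau>
    unfolding fy using delta[OF that] pairing_assoc_rel[OF _ that] by simp_all
  define z where "z = (\<lambda>t. x t + - 1 * y t)"
  have zo: "z \<in> tree_ops (carrier W) 3"
    unfolding z_def by (intro tree_ops_add tree_ops_smult xo yo)
  have fz: "formal_pairing V z w = formal_pairing V x w + - 1 * formal_pairing V y w" for w
    unfolding z_def formal_pairing_smult_left[symmetric]
    by (intro formal_pairing_add_left fin_smult tree_opsD(1)[OF xo] tree_opsD(1)[OF yo])
  have "z \<in> free_ideal W 3"
    by (rule pairing_zero_ideal[OF zo]) (simp_all add: fz c y del: One_nat_def)
  moreover have "x = (\<lambda>t. z t + y t)" by (simp add: z_def)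
  ultimately have "dual.free.cls 3 x = dual.free.cls 3 y"
    using dual.free.quot.cls_eqI[of y 3 z] yo by simp
  then show ?thesis using yN by simp
qed

lemma orthogonal_ops: "x \<in> orthogonal \<Longrightarrow> x \<in> tree_ops (carrier W) 3"
  by (simp add: orthogonal_def)

lemma orthogonal_add: "x \<in> orthogonal \<Longrightarrow> y \<in> orthogonal \<Longrightarrow> (\<lambda>t. x t + y t) \<in> orthogonal"
  using tree_opsD(1)[of x "carrier W" 3] tree_opsD(1)[of y "carrier W" 3]
  by (simp add: orthogonal_def tree_ops_add formal_pairing_add_left) metis

lemma orthogonal_smult: "x \<in> orthogonal \<Longrightarrow> (\<lambda>t. c * x t) \<in> orthogonal"
  by (simp add: orthogonal_def tree_ops_smult formal_pairing_smult_left)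

lemma orthogonal_zero: "(\<lambda>t. 0) \<in> orthogonal"
  by (simp add: orthogonal_def zero_ops formal_pairing_ev)

lemma assoc_rel_orthogonal: "\<sigma> permutes {..<3} \<Longrightarrow> assoc_rel \<sigma> \<in> orthogonal"
  by (simp add: orthogonal_def assoc_rel_ops pairing_assoc_rel del: One_nat_def)

lemma cls_assoc_rel_ops: "{dual.free.cls 3 (assoc_rel id)} \<subseteq> ops (free_operad W) 3"
  using assoc_rel_ops[OF permutes_id] by (simp add: dual.space_cls)

text \<open>Stability under permutations is again built into \<open>N\<close> by quantifying over
  translates; those of the associator are the \<open>assoc_rel \<sigma>\<close>, all of them
  orthogonal.\<close>

lemma sym_span_sub_orthogonal:
  assumes "X \<in> sym_span (free_operad W) 3 {dual.free.cls 3 (assoc_rel id)}"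
  shows "\<exists>x\<in>orthogonal. X = dual.free.cls 3 x"
proof -
  define N where "N = {dual.free.cls 3 y | y. y \<in> tree_ops (carrier W) 3 \<and>
    (\<forall>\<sigma>. \<sigma> permutes {..<3} \<longrightarrow> act (tree_operad (carrier W)) 3 \<sigma> y \<in> orthogonal)}"
  have NE: "\<exists>y. A = dual.free.cls 3 y \<and> y \<in> tree_ops (carrier W) 3 \<and>
    (\<forall>\<sigma>. \<sigma> permutes {..<3} \<longrightarrow> act (tree_operad (carrier W)) 3 \<sigma> y \<in> orthogonal)" if "A \<in> N" for A
    using that unfolding N_def by blast
  have NI: "dual.free.cls 3 y \<in> N" if "y \<in> tree_ops (carrier W) 3"
    "\<And>\<sigma>. \<sigma> permutes {..<3} \<Longrightarrow> act (tree_operad (carrier W)) 3 \<sigma> y \<in> orthogonal" for y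
    using that unfolding N_def by blast
  have "sym_submodule (free_operad W) 3 N"
    unfolding FW.sym_submodule_iff
  proof (intro conjI ballI allI impI)
    show "N \<subseteq> ops (free_operad W) 3" by (auto simp: N_def dual.space_cls)
    show "\<zero>\<^bsub>space (free_operad W) 3\<^esub> \<in> N"
      unfolding dual.space_cls using orthogonal_zero by (intro NI zero_ops) (simp add: act_tree_operad)
  next
    fix A B assume "A \<in> N" "B \<in> N"
    from this[THEN NE] show "A \<oplus>\<^bsub>space (free_operad W) 3\<^esub> B \<in> N"
      using orthogonal_add tree_ops_add by (auto simp: dual.space_cls act_tree_operad intro!: NI)
  next
    fix c A assume "A \<in> N"
    from this[THEN NE] show "c \<odot>\<^bsub>space (free_operad W) 3\<^esub> A \<in> N"
      using orthogonal_smult tree_ops_smult by (auto simp: dual.space_cls act_tree_operad intro!: NI)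
  next
    fix \<tau> A assume "A \<in> N" and \<tau>: "\<tau> permutes {..<3::nat}"
    then obtain y where y: "A = dual.free.cls 3 y" "y \<in> tree_ops (carrier W) 3"
        "\<And>\<sigma>. \<sigma> permutes {..<3} \<Longrightarrow> act (tree_operad (carrier W)) 3 \<sigma> y \<in> orthogonal"
      using NE by blast
    show "act (free_operad W) 3 \<tau> A \<in> N"
      unfolding y(1) dual.act_cls[OF \<tau> y(2)]
    proof (intro NI dual.act_ops[OF \<tau> y(2)])
      fix \<sigma> assume \<sigma>: "\<sigma> permutes {..<3::nat}"
      show "act (tree_operad (carrier W)) 3 \<sigma> (act (tree_operad (carrier W)) 3 \<tau> y) \<in> orthogonal"
        using y(3)[OF permutes_compose[OF \<sigma> \<tau>]] dual.tree.act_comp[OF \<tau> \<sigma>, of y] y(2) by simp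
    qed
  qed
  moreover have "dual.free.cls 3 (assoc_rel id) \<in> N"
    using assoc_rel_ops[OF permutes_id] assoc_rel_orthogonal[OF permutes_inv]
    by (intro NI) (simp_all add: act_rels)
  ultimately have "X \<in> N" using FW.sym_span_least[of 3 N "{dual.free.cls 3 (assoc_rel id)}"] assms by blast
  then obtain y where y: "X = dual.free.cls 3 y" "y \<in> tree_ops (carrier W) 3"
      "\<And>\<sigma>. \<sigma> permutes {..<3} \<Longrightarrow> act (tree_operad (carrier W)) 3 \<sigma> y \<in> orthogonal"
    using NE by blast
  have "y \<in> orthogonal" using y(3)[OF permutes_id] dual.tree.act_id[of y 3] y(2) by simp
  then show ?thesis using y(1) by blast
qed

theorem orthogonal_complement:
  "{X \<in> ops (free_operad W) 3. \<forall>Y\<in>sym_span (free_operad V) 3 dialgebra_rels. pairing V X Y = 0} =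
   sym_span (free_operad W) 3 {dual.free.cls 3 (assoc_rel id)}" (is "?L = ?R")
proof
  have *: "dual.free.cls 3 x \<in> ?L \<longleftrightarrow> x \<in> orthogonal" if "x \<in> tree_ops (carrier W) 3" for x
    using orthogonal_iff[OF that] that by (simp add: orthogonal_def dual.space_cls)
  show "?L \<subseteq> ?R"
  proof
    fix X assume X: "X \<in> ?L"
    then obtain x where x: "X = dual.free.cls 3 x" "x \<in> tree_ops (carrier W) 3"
      by (auto simp: dual.space_cls)
    then have "x \<in> orthogonal" using * X by blast
    then show "X \<in> ?R"
      unfolding x(1) by (rule orthogonal_cls_in[OF _ FW.sym_submodule_span[OF cls_assoc_rel_ops]])
        (use FW.sym_span_superset in blast)
  qed
  show "?R \<subseteq> ?L"
  proof
    fix X assume "X \<in> ?R"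
    then obtain x where "x \<in> orthogonal" "X = dual.free.cls 3 x" using sym_span_sub_orthogonal by blast
    then show "X \<in> ?L" using * orthogonal_ops by blast
  qed
qed

end


section \<open>The dual operad\<close>

text \<open>The sign makes the map equivariant for the action on \<open>V\<^sup>* \<otimes> sgn\<close>.\<close>

definition dual_map :: "('b \<Rightarrow> 'c) \<Rightarrow> ('c \<times> bool \<Rightarrow> 'k::field) \<Rightarrow> ('b \<times> bool \<Rightarrow> 'k) \<Rightarrow> 'k" where
  "dual_map \<kappa> u v = (\<Sum>a\<in>UNIV. (if snd a then - 1 else 1) * u (\<kappa> (fst a), snd a) * v a)"

context regular_dual
begin

lemma dual_map_iso:
  fixes \<kappa> :: "'b \<Rightarrow> 'c"
  assumes \<kappa>: "bij \<kappa>"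
  shows "s2_iso (regular_s2 :: ('k, 'c \<times> bool \<Rightarrow> 'k) s2_module) W (dual_map \<kappa>)"
proof -
  have fin: "finite (UNIV :: 'c set)"
    using finite_ops bij_betw_finite[OF \<kappa>] by simp
  let ?U = "regular_s2 :: ('k, 'c \<times> bool \<Rightarrow> 'k) s2_module"
  interpret U: s2_rep ?U by (rule s2_rep_regular[OF fin])
  \<comment> \<open>The inverse records the values of a form on basis vectors, with the same
    signs.\<close>
  let ?h = "\<lambda>f (c, e). (if e then - 1 else 1) * f (basis (inv_into UNIV \<kappa> c, e)) :: 'k"
  have \<kappa>_inv: "inv_into UNIV \<kappa> (\<kappa> b) = b" "\<kappa> (inv_into UNIV \<kappa> c) = c" for b c
    using \<kappa> by (simp_all add: bij_is_inj bij_is_surj surj_f_inv_f)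
  have closed: "dual_map \<kappa> u \<in> carrier W" for u
    by (simp add: carrier_W dual_map_def sum.distrib sum_distrib_left algebra_simps)
  have hg: "?h (dual_map \<kappa> u) = u" for u :: "'c \<times> bool \<Rightarrow> 'k"
  proof (rule ext, clarify)
    fix c :: 'c and e
    have "dual_map \<kappa> u (basis (inv_into UNIV \<kappa> c, e)) =
        (\<Sum>a\<in>UNIV. if a = (inv_into UNIV \<kappa> c, e) then (if e then - 1 else 1) * u (c, e) else 0)"
      unfolding dual_map_def by (intro sum.cong) (auto simp: basis_def \<kappa>_inv)
    then show "(if e then - 1 else 1) * dual_map \<kappa> u (basis (inv_into UNIV \<kappa> c, e)) = u (c, e)"
      by simp
  qed
  have gh: "dual_map \<kappa> (?h f) = f" if "f \<in> carrier W" for f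
  proof
    fix v
    have "dual_map \<kappa> (?h f) v = (\<Sum>a\<in>UNIV. f (basis a) * v a)"
      unfolding dual_map_def by (intro sum.cong) (auto simp: \<kappa>_inv)
    then show "dual_map \<kappa> (?h f) v = f v" by (rule trans[OF _ linear_expand[OF that, symmetric]])
  qed
  show ?thesis
  proof (intro s2_iso.intro s2_iso_axioms.intro U.s2_rep_axioms dual.s2_rep_axioms)
    show "bij_betw (dual_map \<kappa>) (carrier ?U) (carrier W)"
    proof (rule bij_betw_byWitness[where f' = ?h])
      show "\<forall>u\<in>carrier ?U. ?h (dual_map \<kappa> u) = u" by (intro ballI hg)
      show "\<forall>f\<in>carrier W. dual_map \<kappa> (?h f) = f" by (intro ballI gh)
      show "dual_map \<kappa> ` carrier ?U \<subseteq> carrier W" by (intro image_subsetI closed)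
      show "?h ` carrier W \<subseteq> carrier ?U" unfolding carrier_regular[OF fin] by (rule subset_UNIV)
    qed
    show "dual_map \<kappa> (v \<oplus>\<^bsub>?U\<^esub> w) = dual_map \<kappa> v \<oplus>\<^bsub>W\<^esub> dual_map \<kappa> w" for v w :: "'c \<times> bool \<Rightarrow> 'k"
      by (simp add: dual_map_def fun_eq_iff algebra_simps flip: sum.distrib)
    show "dual_map \<kappa> (c \<odot>\<^bsub>?U\<^esub> v) = c \<odot>\<^bsub>W\<^esub> dual_map \<kappa> v" for c and v :: "'c \<times> bool \<Rightarrow> 'k"
      by (simp add: dual_map_def fun_eq_iff sum_distrib_left algebra_simps)
    show "dual_map \<kappa> (flip ?U v) = flip W (dual_map \<kappa> v)" for v :: "'c \<times> bool \<Rightarrow> 'k"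
    proof
      fix w :: "'b \<times> bool \<Rightarrow> 'k"
      \<comment> \<open>Reindexing by the exchange of operations and opposites moves the flip to the
        argument. It also reverses the sign attached to opposites, which produces the twist by
        sgn.\<close>
      let ?s = "\<lambda>a :: 'b \<times> bool. (fst a, \<not> snd a)"
      have "dual_map \<kappa> (flip ?U v) w =
          (\<Sum>a\<in>UNIV. (if snd a then - 1 else 1) * v (\<kappa> (fst a), \<not> snd a) * w a)"
        by (simp add: dual_map_def)
      also have "\<dots> = (\<Sum>a\<in>UNIV. - ((if snd a then - 1 else 1) * v (\<kappa> (fst a), snd a) * w (?s a)))"
        by (rule sum.reindex_bij_witness[where i = ?s and j = ?s]) auto
      also have "\<dots> = flip W (dual_map \<kappa> v) w"
        by (simp add: dual_map_def sum_negf carrier_V case_prod_beta)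
      finally show "dual_map \<kappa> (flip ?U v) w = flip W (dual_map \<kappa> v) w" .
    qed
  qed
qed

lemma dual_map_total:
  assumes "\<And>b e. u (\<kappa> b, e) = (if e then 0 else 1)"
  shows "dual_map \<kappa> u = total"
proof
  fix v
  have "dual_map \<kappa> u v = (\<Sum>b\<in>UNIV. \<Sum>e\<in>UNIV. (if e then - 1 else 1) * u (\<kappa> b, e) * v (b, e))"
    unfolding dual_map_def sum.cartesian_product UNIV_Times_UNIV by (intro sum.cong) auto
  then show "dual_map \<kappa> u v = total v" by (simp add: total_def UNIV_bool assms)
qed

end

lemma UNIV_dialgebra_op: "UNIV = {Vdash, Dashv}"
  using dialgebra_op.exhaust by auto

lemma UNIV_admissible_op: "UNIV = {Succ, Prec}"
  using admissible_op.exhaust by auto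

theorem mainTheorem6:
  shows "quadratic_operad (koszul_dual sDiAss) \<cong>\<^sub>o\<^sub>p
    quadratic_operad (AssAdm :: ('k::field_char_0, admissible_op \<times> bool \<Rightarrow> 'k) quadratic_data)"
proof -
  let ?V = "regular_s2 :: ('k, dialgebra_op \<times> bool \<Rightarrow> 'k) s2_module"
  let ?U = "regular_s2 :: ('k, admissible_op \<times> bool \<Rightarrow> 'k) s2_module"
  have fin: "finite (UNIV :: dialgebra_op set)" by (simp add: UNIV_dialgebra_op)
  interpret D: regular_dual ?V
    by (intro regular_dual.intro s2_dual.intro s2_rep_regular s2_rep.s2_rep_dual
        regular_dual_axioms.intro fin refl)
  \<comment> \<open>Either bijection would serve, since \<open>star\<close> and \<open>total\<close>
    are symmetric in the two operations.\<close>
  define \<kappa> where "\<kappa> = case_dialgebra_op Succ Prec"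
  have "bij \<kappa>"
    by (rule bijI) (auto simp: \<kappa>_def inj_def surj_def UNIV_admissible_op split: dialgebra_op.splits
        intro: admissible_op.exhaust)
  then interpret I: s2_iso ?U "sgn_dual ?V" "dual_map \<kappa>" by (rule D.dual_map_iso)
  \<comment> \<open>By additivity of generators \<open>star\<close> is the generator of this single
    vector, so its associator is a difference of two trees, as in \<open>assoc_rel\<close>.\<close>
  define s :: "admissible_op \<times> bool \<Rightarrow> 'k" where "s = (\<lambda>p. basis (Succ, False) p + basis (Prec, False) p)"
  have "s (\<kappa> b, e) = (if e then 0 else 1)" for b e
    by (cases b) (auto simp: s_def basis_def \<kappa>_def)
  then have s_total: "dual_map \<kappa> s = D.total" by (rule D.dual_map_total)
  have U: "carrier ?U = UNIV" by (rule carrier_regular) (simp add: UNIV_admissible_op)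
  have star: "star = gen ?U s"
    unfolding star_def s_def using I.V.gen_add[of "basis (Succ, False)" "basis (Prec, False)"]
    by (simp add: U)
  let ?a = "\<lambda>t. basis (ltree s s id) t - basis (rtree s s id) t :: 'k"
  have a: "?a \<in> tree_ops (carrier ?U) 3"
    by (intro tree_ops_diff basis_tree_ops ltree_trees permutes_id) (simp_all add: U)
  have AssAdm: "(AssAdm :: ('k, admissible_op \<times> bool \<Rightarrow> 'k) quadratic_data) =
      \<lparr>gens = ?U, rels = sym_span (free_operad ?U) 3 {I.V.free.cls 3 ?a}\<rparr>"
    unfolding AssAdm_def star using I.V.gen_assoc[of s s s s] by (simp add: U)
  have sDiAss: "(sDiAss :: ('k, dialgebra_op \<times> bool \<Rightarrow> 'k) quadratic_data) =
      \<lparr>gens = ?V, rels = sym_span (free_operad ?V) 3 D.dialgebra_rels\<rparr>"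
  proof -
    have "pcomp (free_operad ?V) 2 2 0 (operation o2) (operation o1) \<ominus>\<^bsub>space (free_operad ?V) 3\<^esub>
        pcomp (free_operad ?V) 2 2 1 (operation o3) (operation o4) =
      D.free.cls 3 (D.dialgebra_rel o2 o1 o3 o4 id)" for o1 o2 o3 o4
      unfolding D.dialgebra_rel_def by (rule D.gen_assoc) (simp_all add: D.carrier_V)
    moreover have "{D.free.cls 3 (D.dialgebra_rel o2 o1 o3 o4 id) | o1 o2 o3 o4. True} = D.dialgebra_rels"
      unfolding D.dialgebra_rels_def by blast
    ultimately show ?thesis unfolding sDiAss_def by (simp only:)
  qed
  have dual: "koszul_dual (sDiAss :: ('k, dialgebra_op \<times> bool \<Rightarrow> 'k) quadratic_data) =
      \<lparr>gens = sgn_dual ?V, rels = sym_span (free_operad (sgn_dual ?V)) 3 {D.dual.free.cls 3 (D.assoc_rel id)}\<rparr>"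
    unfolding koszul_dual_def sDiAss quadratic_data.simps D.orthogonal_complement ..
  have cls: "{I.V.free.cls 3 ?a} \<subseteq> ops (free_operad ?U) 3"
    using a by (simp add: I.V.space_cls)
  interpret F: operad_iso "free_operad ?U" "free_operad (sgn_dual ?V)" "\<lambda>n A. tree_map (dual_map \<kappa>) ` A"
    by (rule I.free_iso)
  \<comment> \<open>Isomorphisms commute with spans, so it suffices to match the two generating
    associators.\<close>
  have "tree_map (dual_map \<kappa>) ?a = D.assoc_rel id"
    by (simp add: tree_map_diff D.assoc_rel_def s_total)
  then have "(\<lambda>A. tree_map (dual_map \<kappa>) ` A) ` sym_span (free_operad ?U) 3 {I.V.free.cls 3 ?a} =
      sym_span (free_operad (sgn_dual ?V)) 3 {D.dual.free.cls 3 (D.assoc_rel id)}"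
    using F.sym_span_image[OF cls] I.image_cls[OF a] by simp
  moreover have "sym_span (free_operad ?U) 3 {I.V.free.cls 3 ?a} \<subseteq> ops (free_operad ?U) 3"
    using F.P.sym_submodule_span[OF cls] by (simp add: F.P.sym_submodule_iff)
  ultimately show ?thesis
    unfolding AssAdm dual by (intro I.quadratic_iso)
qed

end
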